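(* Let $(M_k)_{k\in\mathbb N}$ be a sequence of compact orientable $C^2$-manifolds (surfaces without boundary) embedded in $\mathbb R^3$ and let $V_k$ be their induced varifolds. Assume that $V$ is a varifold with mass measure $\|V\|$ such that $$V_k\rightharpoonup V\ \text{ (weakly-* as varifolds)},\qquad \limsup_{k\to\infty}\left[\mathcal W(V_k)+\mathcal H^2(M_k)\right]<\infty.$$ If $M_k$ is connected for all $k\in\mathbb N$, then also $\operatorname{spt}(\|V\|)$ is connected.
   Context: For a $C^2$ surface $M\subset\mathbb R^3$ with induced (multiplicity one) varifold, its Willmore energy is $\int_MH^2\,d\mathcal H^2$, where $H$ is the mean curvature (sum of the principal curvatures, so that a round sphere has energy $16\pi$); $\mathcal W(V_k)$ denotes the Willmore energy of $M_k$. $\mathcal H^2$ is the 2-dimensional Hausdorff measure. *)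

theory Defs
  imports "HOL-Analysis.Analysis"
begin

section \<open>Two-dimensional Hausdorff measure\<close>

text \<open>The normalisation \<open>\<omega>\<^sub>2 (diam C / 2)\<^sup>2\<close> with \<open>\<omega>\<^sub>2 = \<pi>\<close> makes the measure agree with area on
  planes. The library's \<^const>\<open>diameter\<close> is only meaningful on bounded sets, hence the explicit
  boundedness.\<close>

definition hausdorff2_pre :: "real \<Rightarrow> (real^3) set \<Rightarrow> ennreal" where
  "hausdorff2_pre \<delta> A =
     (INF C\<in>{C :: nat \<Rightarrow> (real^3) set.
              A \<subseteq> (\<Union>i. C i) \<and> (\<forall>i. bounded (C i) \<and> diameter (C i) \<le> \<delta>)}.
        \<Sum>i. ennreal (pi * (diameter (C i) / 2)\<^sup>2))"

definition hausdorff2_outer :: "(real^3) set \<Rightarrow> ennreal" where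
  "hausdorff2_outer A = (SUP \<delta>\<in>{0<..}. hausdorff2_pre \<delta> A)"

text \<open>The outer measure is a metric outer measure, so it is countably additive on Borel sets and
  \<^const>\<open>measure_of\<close> takes exactly its values there.\<close>

definition hausdorff2 :: "(real^3) measure" where
  "hausdorff2 = measure_of UNIV (sets borel) hausdorff2_outer"

section \<open>Embedded surfaces of class \<open>C\<^sup>2\<close>\<close>

definition C2_on :: "('a::real_normed_vector \<Rightarrow> 'b::real_normed_vector) \<Rightarrow> 'a set \<Rightarrow> bool" where
  "C2_on f D \<longleftrightarrow>
     (\<exists>(f' :: 'a \<Rightarrow> 'a \<Rightarrow>\<^sub>L 'b) (f'' :: 'a \<Rightarrow> 'a \<Rightarrow>\<^sub>L 'a \<Rightarrow>\<^sub>L 'b).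
        (\<forall>u\<in>D. (f has_derivative blinfun_apply (f' u)) (at u)) \<and>
        (\<forall>u\<in>D. (f' has_derivative blinfun_apply (f'' u)) (at u)) \<and>
        continuous_on D f'')"

definition local_parametrization ::
  "(real^3) set \<Rightarrow> (real^2) set \<Rightarrow> (real^2 \<Rightarrow> real^3) \<Rightarrow> bool" where
  "local_parametrization M D f \<longleftrightarrow>
     open D \<and> C2_on f D \<and> (\<forall>u\<in>D. inj (frechet_derivative f (at u))) \<and>
     openin (top_of_set M) (f ` D) \<and> (\<exists>g. homeomorphism D (f ` D) f g)"

definition embedded_C2_surface :: "(real^3) set \<Rightarrow> bool" where
  "embedded_C2_surface M \<longleftrightarrow> (\<forall>p\<in>M. \<exists>D f. local_parametrization M D f \<and> p \<in> f ` D)"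

text \<open>Orientability: some atlas has transition maps with positive Jacobian determinant.\<close>

definition orientable_surface :: "(real^3) set \<Rightarrow> bool" where
  "orientable_surface M \<longleftrightarrow>
     (\<exists>\<A>. (\<forall>(D, f)\<in>\<A>. local_parametrization M D f) \<and>
          M = (\<Union>(D, f)\<in>\<A>. f ` D) \<and>
          (\<forall>(D, f)\<in>\<A>. \<forall>(E, g)\<in>\<A>. \<forall>u\<in>D. f u \<in> g ` E \<longrightarrow>
             det (matrix (frechet_derivative (inv_into E g \<circ> f) (at u))) > 0))"

definition tangent_space :: "(real^3) set \<Rightarrow> real^3 \<Rightarrow> (real^3) set" where
  "tangent_space M p =
     {v. \<exists>\<gamma> \<epsilon>. \<epsilon> > 0 \<and> (\<forall>t\<in>{-\<epsilon><..<\<epsilon>}. \<gamma> t \<in> M) \<and> \<gamma> 0 = p \<and>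
         (\<gamma> has_vector_derivative v) (at 0)}"

section \<open>Mean curvature and Willmore energy\<close>

definition unit_normal_field_on :: "(real^3) set \<Rightarrow> (real^3) set \<Rightarrow> (real^3 \<Rightarrow> real^3) \<Rightarrow> bool" where
  "unit_normal_field_on M U \<nu> \<longleftrightarrow>
     continuous_on (M \<inter> U) \<nu> \<and>
     (\<forall>x\<in>M \<inter> U. norm (\<nu> x) = 1 \<and> (\<forall>v\<in>tangent_space M x. \<nu> x \<bullet> v = 0))"

text \<open>The differential at \<open>p\<close> of the Gauss map \<open>\<nu>\<close> is the restriction to the tangent space of any
  derivative \<open>L\<close> of \<open>\<nu>\<close> at \<open>p\<close> within \<open>M\<close> (in the normal direction \<open>L\<close> is not determined). The
  principal curvatures are the eigenvalues of the shape operator \<open>-L\<close> on the tangent plane, taken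
  with multiplicity by means of an orthonormal eigenbasis.\<close>

definition principal_curvatures ::
  "(real^3) set \<Rightarrow> (real^3 \<Rightarrow> real^3) \<Rightarrow> real^3 \<Rightarrow> real \<Rightarrow> real \<Rightarrow> bool" where
  "principal_curvatures M \<nu> p \<kappa>\<^sub>1 \<kappa>\<^sub>2 \<longleftrightarrow>
     (\<exists>L e\<^sub>1 e\<^sub>2. (\<nu> has_derivative L) (at p within M) \<and>
        e\<^sub>1 \<in> tangent_space M p \<and> e\<^sub>2 \<in> tangent_space M p \<and>
        norm e\<^sub>1 = 1 \<and> norm e\<^sub>2 = 1 \<and> e\<^sub>1 \<bullet> e\<^sub>2 = 0 \<and>
        - L e\<^sub>1 = \<kappa>\<^sub>1 *\<^sub>R e\<^sub>1 \<and> - L e\<^sub>2 = \<kappa>\<^sub>2 *\<^sub>R e\<^sub>2)"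

text \<open>The sign depends on the choice of one of the two unit normals at \<open>p\<close>, so the value is determined
  only up to sign; only its square is used below.\<close>

definition mean_curvature :: "(real^3) set \<Rightarrow> real^3 \<Rightarrow> real" where
  "mean_curvature M p =
     (SOME h. \<exists>U \<nu> \<kappa>\<^sub>1 \<kappa>\<^sub>2. open U \<and> p \<in> U \<and> unit_normal_field_on M U \<nu> \<and>
        principal_curvatures M \<nu> p \<kappa>\<^sub>1 \<kappa>\<^sub>2 \<and> h = \<kappa>\<^sub>1 + \<kappa>\<^sub>2)"

definition willmore_energy :: "(real^3) set \<Rightarrow> ennreal" where
  "willmore_energy M = (\<integral>\<^sup>+x\<in>M. ennreal ((mean_curvature M x)\<^sup>2) \<partial>hausdorff2)"

section \<open>Two-dimensional varifolds in three-space\<close>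

text \<open>A plane through the origin is identified with the matrix of the orthogonal projection onto it
  (\<^const>\<open>closest_point\<close>); this gives the Grassmannian its topology.\<close>

definition plane_matrix :: "(real^3) set \<Rightarrow> real^3^3" where
  "plane_matrix S = matrix (closest_point S)"

definition grassmannian2 :: "(real^3^3) set" where
  "grassmannian2 = plane_matrix ` {S. subspace S \<and> dim S = 2}"

definition grassmann_bundle :: "((real^3) \<times> (real^3^3)) set" where
  "grassmann_bundle = UNIV \<times> grassmannian2"

definition varifold :: "((real^3) \<times> (real^3^3)) measure \<Rightarrow> bool" where
  "varifold V \<longleftrightarrow>
     sets V = sets (restrict_space borel grassmann_bundle) \<and>
     (\<forall>K. compact K \<and> K \<subseteq> grassmann_bundle \<longrightarrow> emeasure V K < \<infinity>)"

text \<open>The varifold \<open>B \<mapsto> \<H>\<^sup>2 {x \<in> M. (x, T\<^sub>x M) \<in> B}\<close> of multiplicity one.\<close>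

definition induced_varifold :: "(real^3) set \<Rightarrow> ((real^3) \<times> (real^3^3)) measure" where
  "induced_varifold M =
     distr (restrict_space hausdorff2 M) (restrict_space borel grassmann_bundle)
       (\<lambda>x. (x, plane_matrix (tangent_space M x)))"

definition mass_measure :: "((real^3) \<times> (real^3^3)) measure \<Rightarrow> (real^3) measure" where
  "mass_measure V = distr V borel fst"

definition measure_support :: "(real^3) measure \<Rightarrow> (real^3) set" where
  "measure_support \<mu> = {x. \<forall>U. open U \<and> x \<in> U \<longrightarrow> emeasure \<mu> U > 0}"

definition varifold_converges ::
  "(nat \<Rightarrow> ((real^3) \<times> (real^3^3)) measure) \<Rightarrow> ((real^3) \<times> (real^3^3)) measure \<Rightarrow> bool" where
  "varifold_converges Vs V \<longleftrightarrow>
     (\<forall>\<phi> :: (real^3) \<times> (real^3^3) \<Rightarrow> real.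
        continuous_on grassmann_bundle \<phi> \<and> compact (closure {z\<in>grassmann_bundle. \<phi> z \<noteq> 0}) \<longrightarrow>
        (\<lambda>k. integral\<^sup>L (Vs k) \<phi>) \<longlonglongrightarrow> integral\<^sup>L V \<phi>)"

end

theory Submission
  imports Defs
begin

text \<open>
  The reason why connectedness survives is a lower bound for what a surface must spend to pass
  through a point: if \<open>x\<close> lies on \<open>M\<close>, then the integral of \<open>1 / R\<^sup>2 + H\<^sup>2\<close> over the part of \<open>M\<close> in
  the ball of radius \<open>2 R\<close> around \<open>x\<close> is at least a universal constant (\<open>density_lower_bound\<close>). A connected
  surface on which a 1-Lipschitz function \<open>g\<close> takes a value below and a value above a slab of width
  \<open>4 R N\<close> meets \<open>N\<close> disjoint such balls in the slab, so it pays \<open>N\<close> times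
  (\<open>connected_slab_lower_bound\<close>). For \<open>R = 1\<close> and \<open>g\<close> the distance to a point of the support, this and
  the bound on area and energy show that the support of the limit is bounded. If the support were a
  disjoint union of two nonempty closed sets \<open>A\<close> and \<open>B\<close>, these would thus be compact and at a positive
  distance \<open>d\<close>. Taking for \<open>g\<close> the distance to \<open>A\<close>, the surfaces \<open>M k\<close>, which come close to both \<open>A\<close>
  and \<open>B\<close>, cross a slab that is disjoint from the support and in which their area therefore tends to
  zero. With \<open>N\<close> large and \<open>R = d / (8 N)\<close> fixed, the area part \<open>1 / R\<^sup>2\<close> becomes negligible as \<open>k\<close> grows,
  and the Willmore energy would exceed its bound.

  The density estimate is proved by a touching argument, in place of the monotonicity formula for
  the first variation. A point \<open>\<xi>\<close> of the ball of radius \<open>R\<close> around \<open>x\<close> has a nearest point \<open>y\<close>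
  on \<open>M\<close>, and \<open>\<xi> = y + z \<nu> y\<close> with \<open>\<bar>z\<bar> < R\<close>. At a nearest point \<open>1 - z \<kappa>\<^sub>1\<close> and \<open>1 - z \<kappa>\<^sub>2\<close> are
  nonnegative, hence both are at most their sum \<open>2 - z H\<close> (\<open>nearest_point_normal\<close>). So the map
  \<open>y \<mapsto> y + z \<nu> y\<close> is Lipschitz near such points with a constant of order \<open>2 + R \<bar>H\<bar>\<close>
  (\<open>nearest_point_lipschitz\<close>), and covering \<open>M\<close> by small sets bounds the volume of the normal tube,
  which contains the ball of radius \<open>R\<close>, by \<open>R\<close> times the integral of \<open>1 + R\<^sup>2 H\<^sup>2\<close>
  (\<open>tube_volume\<close>).

  Two facts connect this with the definitions. The Hausdorff outer measure is a metric outer measure,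
  so it is a measure on the Borel sets (\<open>emeasure_hausdorff2\<close>). In charts the tangent space is the
  range of the derivative of the parametrization, and the squared mean curvature and the tangent plane
  depend continuously on the point; this makes the integrals of \<open>H\<^sup>2\<close> additive and the induced
  varifold a push-forward under a measurable map.
\<close>

section \<open>The Hausdorff measure on Borel sets\<close>

lemma hausdorff2_preI:
  assumes "A \<subseteq> (\<Union>i. C i)" "\<And>i. bounded (C i)" "\<And>i. diameter (C i) \<le> \<delta>"
  shows "hausdorff2_pre \<delta> A \<le> (\<Sum>i. ennreal (pi * (diameter (C i) / 2)\<^sup>2))"
  unfolding hausdorff2_pre_def using assms by (intro INF_lower) auto

lemma hausdorff2_pre_cover:
  assumes "hausdorff2_pre \<delta> A < t"
  obtains C :: "nat \<Rightarrow> (real^3) set" where "A \<subseteq> (\<Union>i. C i)" "\<And>i. bounded (C i)"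
    "\<And>i. diameter (C i) \<le> \<delta>" "(\<Sum>i. ennreal (pi * (diameter (C i) / 2)\<^sup>2)) < t"
  using assms unfolding hausdorff2_pre_def INF_less_iff by blast

lemma hausdorff2_pre_le_outer: "0 < \<delta> \<Longrightarrow> hausdorff2_pre \<delta> A \<le> hausdorff2_outer A"
  unfolding hausdorff2_outer_def by (intro SUP_upper) auto

lemma hausdorff2_pre_antimono: "\<delta> \<le> \<epsilon> \<Longrightarrow> hausdorff2_pre \<epsilon> A \<le> hausdorff2_pre \<delta> A"
  unfolding hausdorff2_pre_def by (intro INF_superset_mono) (auto intro: order_trans)

lemma hausdorff2_outer_empty: "hausdorff2_outer {} = 0"
proof -
  have "hausdorff2_pre \<delta> {} \<le> 0" if "\<delta> > 0" for \<delta>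
    using hausdorff2_preI[of "{}" "\<lambda>_. {}" \<delta>] that by simp
  then have "hausdorff2_outer {} \<le> 0"
    unfolding hausdorff2_outer_def by (intro SUP_least) auto
  then show ?thesis by simp
qed

lemma hausdorff2_pre_mono: "A \<subseteq> B \<Longrightarrow> hausdorff2_pre \<delta> A \<le> hausdorff2_pre \<delta> B"
  unfolding hausdorff2_pre_def by (intro INF_superset_mono) (auto intro: order_trans)

lemma hausdorff2_outer_mono: "A \<subseteq> B \<Longrightarrow> hausdorff2_outer A \<le> hausdorff2_outer B"
  unfolding hausdorff2_outer_def by (intro SUP_mono) (auto intro: hausdorff2_pre_mono)

lemma hausdorff2_pre_countably_subadditive:
  "hausdorff2_pre \<delta> (\<Union>n. A n) \<le> (\<Sum>n. hausdorff2_pre \<delta> (A n))"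
proof (cases "(\<Sum>n. hausdorff2_pre \<delta> (A n)) = \<infinity>")
  case False
  show ?thesis
  proof (rule ennreal_le_epsilon)
    fix e :: real assume e: "0 < e"
    define h where "h = (\<lambda>C :: (real^3) set. ennreal (pi * (diameter C / 2)\<^sup>2))"
    have fin: "hausdorff2_pre \<delta> (A n) < \<infinity>" for n
      using False by (metis ennreal_suminf_lessD infinity_ennreal_def less_top)
    have "\<exists>C. A n \<subseteq> (\<Union>i. C i) \<and> (\<forall>i. bounded (C i) \<and> diameter (C i) \<le> \<delta>) \<and>
        (\<Sum>i. h (C i)) \<le> hausdorff2_pre \<delta> (A n) + e * (1/2) ^ Suc n" for n
    proof -
      have "0 < ennreal (e * (1/2) ^ Suc n)" using e by simp
      then have "hausdorff2_pre \<delta> (A n) < hausdorff2_pre \<delta> (A n) + ennreal (e * (1/2) ^ Suc n)"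
        using fin[of n] ennreal_add_left_cancel_less[of "hausdorff2_pre \<delta> (A n)" 0 "ennreal (e * (1/2) ^ Suc n)"]
        by (auto simp: less_top)
      from hausdorff2_pre_cover[OF this] obtain C where "A n \<subseteq> (\<Union>i. C i)" "\<And>i. bounded (C i)"
        "\<And>i. diameter (C i) \<le> \<delta>"
        "(\<Sum>i. h (C i)) < hausdorff2_pre \<delta> (A n) + ennreal (e * (1/2) ^ Suc n)"
        unfolding h_def by blast
      then show ?thesis by (intro exI[of _ C]) (auto intro: less_imp_le)
    qed
    then obtain C where C: "\<And>n. A n \<subseteq> (\<Union>i. C n i)" "\<And>n i. bounded (C n i)"
      "\<And>n i. diameter (C n i) \<le> \<delta>"
      "\<And>n. (\<Sum>i. h (C n i)) \<le> hausdorff2_pre \<delta> (A n) + e * (1/2) ^ Suc n"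
      by metis
    define D where "D = (\<lambda>k. case prod_decode k of (n, i) \<Rightarrow> C n i)"
    have "(\<Union>n. A n) \<subseteq> (\<Union>k. D k)"
    proof
      fix x assume "x \<in> (\<Union>n. A n)"
      then obtain n i where "x \<in> C n i" using C(1) by blast
      then have "x \<in> D (prod_encode (n, i))" by (simp add: D_def)
      then show "x \<in> (\<Union>k. D k)" by blast
    qed
    then have "hausdorff2_pre \<delta> (\<Union>n. A n) \<le> (\<Sum>k. h (D k))"
      unfolding h_def by (rule hausdorff2_preI) (auto simp: D_def C(2,3) split: prod.splits)
    also have "\<dots> = (\<Sum>k. (\<lambda>(n, i). h (C n i)) (prod_decode k))"
      by (intro arg_cong[where f=suminf]) (auto simp: D_def split: prod.splits)
    also have "\<dots> = (\<Sum>n. \<Sum>i. h (C n i))"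
      by (rule suminf_ennreal_2dimen) auto
    also have "\<dots> \<le> (\<Sum>n. hausdorff2_pre \<delta> (A n) + ennreal e * ennreal ((1/2) ^ Suc n))"
      using C(4) e by (intro suminf_le) (auto simp: ennreal_mult[symmetric])
    also have "\<dots> = (\<Sum>n. hausdorff2_pre \<delta> (A n)) + (\<Sum>n. ennreal e * ennreal ((1/2) ^ Suc n))"
      by (subst suminf_add[symmetric]) auto
    also have "(\<Sum>n. ennreal e * ennreal ((1/2) ^ Suc n)) = ennreal e"
      unfolding ennreal_suminf_cmult
      by (subst suminf_ennreal_eq[OF zero_le_power power_half_series]) auto
    finally show "hausdorff2_pre \<delta> (\<Union>n. A n) \<le> (\<Sum>n. hausdorff2_pre \<delta> (A n)) + ennreal e" .
  qed
qed simp

lemma hausdorff2_outer_countably_subadditive: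
  "hausdorff2_outer (\<Union>n. A n) \<le> (\<Sum>n. hausdorff2_outer (A n))"
proof -
  have "hausdorff2_pre \<delta> (\<Union>n. A n) \<le> (\<Sum>n. hausdorff2_outer (A n))" if "\<delta> > 0" for \<delta>
    by (rule order_trans[OF hausdorff2_pre_countably_subadditive suminf_le])
      (auto intro: hausdorff2_pre_le_outer that)
  then show ?thesis unfolding hausdorff2_outer_def by (intro SUP_least) auto
qed

lemma hausdorff2_outer_subadditive:
  "hausdorff2_outer (A \<union> B) \<le> hausdorff2_outer A + hausdorff2_outer B"
proof -
  define S where "S = (\<lambda>n::nat. if n = 0 then A else if n = 1 then B else {})"
  have "A \<union> B = (\<Union>n. S n)" by (auto simp: S_def split: if_splits)
  moreover have "(\<Sum>n. hausdorff2_outer (S n)) = (\<Sum>n\<in>{0,1}. hausdorff2_outer (S n))"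
    by (rule suminf_finite) (auto simp: S_def hausdorff2_outer_empty)
  ultimately show ?thesis
    using hausdorff2_outer_countably_subadditive[of S] by (simp add: S_def)
qed

lemma outer_measure_space_hausdorff2_outer: "outer_measure_space (Pow UNIV) hausdorff2_outer"
  unfolding outer_measure_space_def positive_def increasing_def countably_subadditive_def
  by (auto simp: hausdorff2_outer_empty hausdorff2_outer_mono hausdorff2_outer_countably_subadditive)

text \<open>The metric property: once the covering sets are smaller than the distance of the two sets,
  none of them can meet both, so a cover of the union splits into two separate covers.\<close>

lemma hausdorff2_outer_separated:
  assumes d: "d > 0" and sep: "\<And>x y. x \<in> A \<Longrightarrow> y \<in> B \<Longrightarrow> d \<le> dist x y"
  shows "hausdorff2_outer A + hausdorff2_outer B \<le> hausdorff2_outer (A \<union> B)"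
proof -
  define h where "h = (\<lambda>C :: (real^3) set. ennreal (pi * (diameter C / 2)\<^sup>2))"
  have h0: "h {} = 0" by (simp add: h_def)
  have main: "hausdorff2_pre \<delta> A + hausdorff2_pre \<delta> B \<le> hausdorff2_outer (A \<union> B)"
    if \<delta>: "0 < \<delta>" "\<delta> < d" for \<delta>
  proof -
    have "hausdorff2_pre \<delta> A + hausdorff2_pre \<delta> B \<le> hausdorff2_pre \<delta> (A \<union> B)"
      unfolding hausdorff2_pre_def[of _ "A \<union> B"]
    proof (rule INF_greatest)
      fix C :: "nat \<Rightarrow> (real^3) set"
      assume "C \<in> {C. A \<union> B \<subseteq> (\<Union>i. C i) \<and> (\<forall>i. bounded (C i) \<and> diameter (C i) \<le> \<delta>)}"
      then have C: "A \<union> B \<subseteq> (\<Union>i. C i)" "\<And>i. bounded (C i)" "\<And>i. diameter (C i) \<le> \<delta>" by auto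
      define P where "P = (\<lambda>S i. if C i \<inter> S = {} then {} else C i)"
      have P: "hausdorff2_pre \<delta> S \<le> (\<Sum>i. h (P S i))" if "S \<subseteq> (\<Union>i. C i)" for S
        unfolding h_def using that C(2,3) \<delta>
        by (intro hausdorff2_preI) (force simp: P_def)+
      have "hausdorff2_pre \<delta> A + hausdorff2_pre \<delta> B \<le> (\<Sum>i. h (P A i)) + (\<Sum>i. h (P B i))"
        using C(1) by (intro add_mono P) auto
      also have "\<dots> = (\<Sum>i. h (P A i) + h (P B i))"
        by (rule suminf_add) auto
      also have "\<dots> \<le> (\<Sum>i. h (C i))"
      proof (intro suminf_le)
        fix i
        have "C i \<inter> A = {} \<or> C i \<inter> B = {}"
        proof (rule ccontr)
          assume "\<not> ?thesis"
          then obtain x y where xy: "x \<in> C i" "x \<in> A" "y \<in> C i" "y \<in> B" by blast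
          then have "dist x y \<le> \<delta>"
            using diameter_bounded_bound[OF C(2)[of i] xy(1,3)] C(3)[of i] by simp
          then show False using sep[OF xy(2,4)] \<delta> by simp
        qed
        then show "h (P A i) + h (P B i) \<le> h (C i)"
          by (auto simp: P_def h0)
      qed auto
      finally show "hausdorff2_pre \<delta> A + hausdorff2_pre \<delta> B
          \<le> (\<Sum>i. ennreal (pi * (diameter (C i) / 2)\<^sup>2))"
        by (simp add: h_def)
    qed
    then show ?thesis using hausdorff2_pre_le_outer[OF \<delta>(1)] order_trans by blast
  qed
  have "hausdorff2_outer A + hausdorff2_outer B
      = (SUP \<delta>\<in>{0<..}. hausdorff2_pre \<delta> A + hausdorff2_pre \<delta> B)"
    unfolding hausdorff2_outer_def
  proof (rule SUP_add_directed_ennreal[symmetric])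
    fix i j :: real assume "i \<in> {0<..}" "j \<in> {0<..}"
    then show "\<exists>k\<in>{0<..}. hausdorff2_pre i A + hausdorff2_pre j B
        \<le> hausdorff2_pre k A + hausdorff2_pre k B"
      by (intro bexI[of _ "min i j"] add_mono hausdorff2_pre_antimono) auto
  qed
  also have "\<dots> \<le> hausdorff2_outer (A \<union> B)"
  proof (rule SUP_least)
    fix \<delta> :: real assume \<delta>: "\<delta> \<in> {0<..}"
    have "hausdorff2_pre \<delta> A + hausdorff2_pre \<delta> B
        \<le> hausdorff2_pre (min \<delta> (d/2)) A + hausdorff2_pre (min \<delta> (d/2)) B"
      by (intro add_mono hausdorff2_pre_antimono) auto
    also have "\<dots> \<le> hausdorff2_outer (A \<union> B)"
      using \<delta> d by (intro main) auto
    finally show "hausdorff2_pre \<delta> A + hausdorff2_pre \<delta> B \<le> hausdorff2_outer (A \<union> B)" .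
  qed
  finally show ?thesis .
qed

lemma hausdorff2_outer_separated_sequence:
  fixes S :: "nat \<Rightarrow> (real^3) set"
  assumes "\<And>m. \<exists>d>0. \<forall>x\<in>S m. \<forall>k<m. \<forall>y\<in>S k. d \<le> dist x y"
  shows "(\<Sum>k<n. hausdorff2_outer (S k)) \<le> hausdorff2_outer (\<Union>k<n. S k)"
proof (induction n)
  case (Suc n)
  obtain d where d: "d > 0" "\<forall>x\<in>S n. \<forall>k<n. \<forall>y\<in>S k. d \<le> dist x y" using assms by blast
  have "(\<Sum>k<Suc n. hausdorff2_outer (S k)) \<le> hausdorff2_outer (\<Union>k<n. S k) + hausdorff2_outer (S n)"
    using Suc by (simp add: add_right_mono)
  also have "\<dots> \<le> hausdorff2_outer ((\<Union>k<n. S k) \<union> S n)"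
    using d by (intro hausdorff2_outer_separated[of d]) (metis UN_E dist_commute lessThan_iff)+
  finally show ?case by (simp add: lessThan_Suc Un_commute)
qed simp

text \<open>The points of \<open>A\<close> outside a closed set \<open>F\<close> are exhausted by the sets \<open>E n\<close> of points at
  distance at least \<open>1/(n+1)\<close>. These have positive distance to \<open>F\<close>, so additivity holds for them, and
  the error tends to zero since every second one of the shells \<open>R k\<close> between them is separated from
  the others, which makes the sum of their measures finite.\<close>

lemma closed_caratheodory_hausdorff2:
  assumes F: "closed F"
  shows "F \<in> lambda_system UNIV (Pow UNIV) hausdorff2_outer"
proof -
  interpret algebra UNIV "Pow UNIV :: (real^3) set set"
    by (rule algebra_Pow)
  have "hausdorff2_outer (A \<inter> F) + hausdorff2_outer (A - F) \<le> hausdorff2_outer A" for A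
  proof (cases "F = {} \<or> hausdorff2_outer A = \<infinity>")
    case True
    then show ?thesis by (auto simp: hausdorff2_outer_empty)
  next
    case False
    then have F0: "F \<noteq> {}" and fin: "hausdorff2_outer A < \<infinity>" by (auto simp: less_top)
    define g where "g = (\<lambda>x. infdist x F)"
    define E where "E = (\<lambda>n::nat. {x\<in>A. 1 / (real n + 1) \<le> g x})"
    define R where "R = (\<lambda>k::nat. {x\<in>A. 1 / (real k + 2) \<le> g x \<and> g x < 1 / (real k + 1)})"
    have lip: "\<bar>g x - g y\<bar> \<le> dist x y" for x y
      unfolding g_def by (metis infdist_triangle_abs)
    have g0: "g x = 0 \<longleftrightarrow> x \<in> F" for x
      unfolding g_def using F F0 by (simp add: in_closed_iff_infdist_zero)
    have g_nn: "g x \<ge> 0" for x by (simp add: g_def infdist_nonneg)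
    have bnd: "(\<Sum>k<n. hausdorff2_outer (R (2 * k + j))) \<le> hausdorff2_outer A" for n j
    proof -
      have "(\<Sum>k<n. hausdorff2_outer (R (2 * k + j))) \<le> hausdorff2_outer (\<Union>k<n. R (2 * k + j))"
      proof (rule hausdorff2_outer_separated_sequence)
        fix m :: nat
        show "\<exists>d>0. \<forall>x\<in>R (2 * m + j). \<forall>k<m. \<forall>y\<in>R (2 * k + j). d \<le> dist x y"
        proof (cases "m = 0")
          case True
          then show ?thesis by (intro exI[of _ 1]) auto
        next
          case False
          show ?thesis
          proof (intro exI conjI ballI allI impI)
            show "0 < 1 / real (2 * m + j) - 1 / (real (2 * m + j) + 1)"
              using False by (auto intro!: divide_strict_left_mono)
            fix x k y assume x: "x \<in> R (2 * m + j)" and k: "k < m" and y: "y \<in> R (2 * k + j)"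
            have "1 / real (2 * m + j) \<le> 1 / (real (2 * k + j) + 2)"
              using k by (intro divide_left_mono) auto
            then have "1 / real (2 * m + j) \<le> g y" using y by (auto simp: R_def)
            moreover have "g x \<le> 1 / (real (2 * m + j) + 1)" using x by (auto simp: R_def)
            ultimately show "1 / real (2 * m + j) - 1 / (real (2 * m + j) + 1) \<le> dist x y"
              using lip[of x y] by linarith
          qed
        qed
      qed
      also have "\<dots> \<le> hausdorff2_outer A" by (rule hausdorff2_outer_mono) (auto simp: R_def)
      finally show ?thesis .
    qed
    have sm: "(\<Sum>k. hausdorff2_outer (R k)) < \<infinity>"
    proof -
      have "(\<Sum>k<n. hausdorff2_outer (R k)) \<le> hausdorff2_outer A + hausdorff2_outer A" for n
      proof -
        have "(\<Sum>k<n. hausdorff2_outer (R k)) \<le> (\<Sum>k<2*n. hausdorff2_outer (R k))"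
          by (intro sum_mono2) auto
        also have "\<dots> = (\<Sum>k<n. hausdorff2_outer (R (2 * k))) + (\<Sum>k<n. hausdorff2_outer (R (2 * k + 1)))"
          by (induction n) (auto simp: algebra_simps)
        also have "\<dots> \<le> hausdorff2_outer A + hausdorff2_outer A"
          using bnd[where j=0] bnd[where j=1] by (intro add_mono) auto
        finally show ?thesis .
      qed
      then have "(\<Sum>k. hausdorff2_outer (R k)) \<le> hausdorff2_outer A + hausdorff2_outer A"
        by (intro suminf_le_const) auto
      also have "\<dots> < \<infinity>" using fin by (simp add: ennreal_add_less_top)
      finally show ?thesis .
    qed
    have tail: "(\<lambda>n. \<Sum>k. hausdorff2_outer (R (k + n))) \<longlonglongrightarrow> 0"
    proof -
      define a where "a = (\<lambda>k. enn2real (hausdorff2_outer (R k)))"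
      have "hausdorff2_outer (R k) < \<infinity>" for k
        using sm by (metis ennreal_suminf_lessD infinity_ennreal_def)
      then have a: "hausdorff2_outer (R k) = ennreal (a k)" for k by (simp add: a_def)
      have a0: "a k \<ge> 0" for k by (simp add: a_def)
      have s: "summable a" using sm unfolding a by (intro summable_suminf_not_top) (auto simp: a0)
      have "(\<lambda>n. \<Sum>k. a (k + n)) \<longlonglongrightarrow> 0"
        by (rule suminf_exist_split2[OF s])
      moreover have "(\<Sum>k. hausdorff2_outer (R (k + n))) = ennreal (\<Sum>k. a (k + n))" for n
        unfolding a using s by (intro suminf_ennreal2) (auto simp: a0 summable_ignore_initial_segment)
      ultimately show ?thesis by (auto intro: tendsto_ennrealI[of _ 0, simplified])
    qed
    have "hausdorff2_outer (A \<inter> F) + hausdorff2_outer (A - F)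
        \<le> hausdorff2_outer A + (\<Sum>k. hausdorff2_outer (R (k + n)))" for n
    proof -
      have "A - F \<subseteq> E n \<union> (\<Union>k. R (k + n))"
      proof
        fix x assume x: "x \<in> A - F"
        then have pos: "g x > 0" using g0 g_nn by (metis DiffD2 less_eq_real_def)
        show "x \<in> E n \<union> (\<Union>k. R (k + n))"
        proof (cases "1 / (real n + 1) \<le> g x")
          case False
          define l where "l = (LEAST l. 1 / (real l + 1) \<le> g x)"
          obtain l0 :: nat where "1 / g x \<le> real l0" using real_arch_simple by blast
          then have "1 / (real l0 + 1) \<le> g x" using pos by (simp add: field_simps add_pos_nonneg)
          then have l: "1 / (real l + 1) \<le> g x" unfolding l_def by (rule LeastI)
          have "n < l"
          proof (rule ccontr)
            assume "\<not> n < l"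
            then have "1 / (real n + 1) \<le> 1 / (real l + 1)" by (intro divide_left_mono) auto
            then show False using l False by linarith
          qed
          moreover then have "\<not> 1 / (real (l - 1) + 1) \<le> g x"
            unfolding l_def by (intro not_less_Least) auto
          moreover have "real (l - 1) = real l - 1" using \<open>n < l\<close> by (simp add: of_nat_diff)
          ultimately have "x \<in> R (l - 1)" using x l by (simp add: R_def add.commute)
          moreover have "l - 1 = (l - 1 - n) + n" using \<open>n < l\<close> by simp
          ultimately show ?thesis by (metis UN_iff UNIV_I UnCI)
        qed (use x in \<open>auto simp: E_def\<close>)
      qed
      then have "hausdorff2_outer (A - F) \<le> hausdorff2_outer (E n \<union> (\<Union>k. R (k + n)))"
        by (rule hausdorff2_outer_mono)
      also have "\<dots> \<le> hausdorff2_outer (E n) + (\<Sum>k. hausdorff2_outer (R (k + n)))"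
        by (rule order_trans[OF hausdorff2_outer_subadditive])
          (intro add_left_mono hausdorff2_outer_countably_subadditive)
      finally have "hausdorff2_outer (A \<inter> F) + hausdorff2_outer (A - F)
         \<le> (hausdorff2_outer (A \<inter> F) + hausdorff2_outer (E n)) + (\<Sum>k. hausdorff2_outer (R (k + n)))"
        by (simp add: add_left_mono add.assoc)
      also have "hausdorff2_outer (A \<inter> F) + hausdorff2_outer (E n) \<le> hausdorff2_outer (A \<inter> F \<union> E n)"
      proof (rule hausdorff2_outer_separated)
        fix x y assume "x \<in> A \<inter> F" "y \<in> E n"
        then have "g x = 0" "1 / (real n + 1) \<le> g y" using g0 by (auto simp: E_def)
        then show "1 / (real n + 1) \<le> dist x y" using lip[of x y] by linarith
      qed auto
      also have "hausdorff2_outer (A \<inter> F \<union> E n) \<le> hausdorff2_outer A"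
        by (rule hausdorff2_outer_mono) (auto simp: E_def)
      finally show ?thesis by (simp add: add_right_mono)
    qed
    moreover have "(\<lambda>n. hausdorff2_outer A + (\<Sum>k. hausdorff2_outer (R (k + n))))
        \<longlonglongrightarrow> hausdorff2_outer A + 0"
      by (intro tendsto_add tendsto_const tail)
    ultimately have "hausdorff2_outer (A \<inter> F) + hausdorff2_outer (A - F) \<le> hausdorff2_outer A + 0"
      by (intro LIMSEQ_le_const) auto
    then show ?thesis by simp
  qed
  moreover have "hausdorff2_outer A \<le> hausdorff2_outer (A \<inter> F) + hausdorff2_outer (A - F)" for A
    using hausdorff2_outer_subadditive[of "A \<inter> F" "A - F"] by (simp add: Int_Diff_Un)
  ultimately show ?thesis unfolding lambda_system_eq by (auto intro: antisym)
qed

lemma sets_hausdorff2 [simp, measurable_cong]: "sets hausdorff2 = sets borel"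
  unfolding hausdorff2_def using sets.space_closed[of "borel :: (real^3) measure"]
  by (simp add: sets_measure_of sets.sigma_sets_eq[of "borel :: (real^3) measure", simplified])

lemma space_hausdorff2 [simp]: "space hausdorff2 = UNIV"
  unfolding hausdorff2_def by (simp add: space_measure_of)

lemma emeasure_hausdorff2:
  assumes "B \<in> sets borel"
  shows "emeasure hausdorff2 B = hausdorff2_outer B"
proof -
  define L where "L = lambda_system UNIV (Pow UNIV) hausdorff2_outer"
  have L: "measure_space UNIV L hausdorff2_outer"
    unfolding L_def
    using sigma_algebra.caratheodory_lemma[OF sigma_algebra_Pow outer_measure_space_hausdorff2_outer]
    by simp
  then interpret L: sigma_algebra UNIV L by (simp add: measure_space_def)
  have "sigma_sets UNIV (Collect closed) \<subseteq> L"
    using closed_caratheodory_hausdorff2 unfolding L_def[symmetric]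
    by (intro L.sigma_sets_subset) blast
  then have *: "sets borel \<subseteq> L"
    by (simp add: borel_eq_closed)
  have "sigma_algebra UNIV (sets (borel :: (real^3) measure))"
    using sets.sigma_algebra_axioms[of "borel :: (real^3) measure"] by (simp only: space_borel)
  then have "measure_space UNIV (sets borel) hausdorff2_outer"
    by (rule measure_down[OF L _ *])
  then show ?thesis
    unfolding hausdorff2_def measure_space_def using assms
    by (elim conjE) (rule emeasure_measure_of_sigma)
qed

section \<open>Calculus and linear algebra\<close>

text \<open>The second difference \<open>f (u + t a + t b) - f (u + t a) - f (u + t b) + f u\<close> is symmetric in
  \<open>a\<close> and \<open>b\<close>, and divided by \<open>t\<^sup>2\<close> it tends to \<open>F b a\<close>, by the mean value theorem in the
  direction \<open>a\<close>.\<close>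

lemma second_derivative_symmetric:
  fixes f :: "'a::real_normed_vector \<Rightarrow> 'b::real_normed_vector"
    and f' :: "'a \<Rightarrow> 'a \<Rightarrow>\<^sub>L 'b" and F :: "'a \<Rightarrow>\<^sub>L 'a \<Rightarrow>\<^sub>L 'b"
  assumes S: "open S" "u \<in> S"
    and f: "\<And>x. x \<in> S \<Longrightarrow> (f has_derivative blinfun_apply (f' x)) (at x)"
    and F: "(f' has_derivative blinfun_apply F) (at u)"
  shows "F a b = F b a"
proof -
  define \<Delta> where "\<Delta> = (\<lambda>a b t. f (u + t *\<^sub>R a + t *\<^sub>R b) - f (u + t *\<^sub>R a) - f (u + t *\<^sub>R b) + f u)"
  have claim: "\<exists>d>0. \<forall>t. 0 < t \<and> t < d \<longrightarrow> norm (\<Delta> a b t - t\<^sup>2 *\<^sub>R F b a) \<le> \<epsilon> * t\<^sup>2"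
    if \<epsilon>: "\<epsilon> > 0" for a b \<epsilon>
  proof -
    define m where "m = norm a + norm b + 1"
    have m: "m > 0" "norm a \<le> m" "norm b \<le> m" by (auto simp: m_def add_nonneg_pos)
    define e where "e = \<epsilon> / (2 * m\<^sup>2)"
    have e: "e > 0" using \<epsilon> m by (simp add: e_def)
    obtain d1 where d1: "d1 > 0"
      "\<And>x. norm (x - u) < d1 \<Longrightarrow> norm (f' x - f' u - F (x - u)) \<le> e * norm (x - u)"
      using F e unfolding has_derivative_at_alt by blast
    obtain d2 where d2: "d2 > 0" "ball u d2 \<subseteq> S" using S open_contains_ball by blast
    define d where "d = min d1 d2 / m"
    have d: "d > 0" using d1 d2 m by (simp add: d_def)
    show ?thesis
    proof (intro exI[of _ d] conjI allI impI d)
      fix t :: real assume t: "0 < t \<and> t < d"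
      have tm: "t * m < d1" "t * m < d2" using t m by (auto simp: d_def field_simps)
      have small: "norm (s *\<^sub>R a + r *\<^sub>R b) \<le> t * m" if "0 \<le> s" "s \<le> t" "0 \<le> r" "r \<le> t" for s r
      proof -
        have "norm (s *\<^sub>R a + r *\<^sub>R b) \<le> s * norm a + r * norm b"
          using norm_triangle_ineq[of "s *\<^sub>R a" "r *\<^sub>R b"] that by simp
        also have "\<dots> \<le> t * norm a + t * norm b" using that by (intro add_mono mult_right_mono) auto
        also have "\<dots> \<le> t * m" using t by (simp add: m_def algebra_simps)
        finally show ?thesis .
      qed
      define h where "h = (\<lambda>s. f (u + s *\<^sub>R a + t *\<^sub>R b) - f (u + s *\<^sub>R a) - (s * t) *\<^sub>R F b a)"
      define h' where "h' = (\<lambda>s x. x *\<^sub>R (f' (u + s *\<^sub>R a + t *\<^sub>R b) a - f' (u + s *\<^sub>R a) a - t *\<^sub>R F b a))"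
      have inS: "u + s *\<^sub>R a + r *\<^sub>R b \<in> S" if "0 \<le> s" "s \<le> t" "0 \<le> r" "r \<le> t" for s r
      proof -
        have "dist u (u + s *\<^sub>R a + r *\<^sub>R b) = norm (s *\<^sub>R a + r *\<^sub>R b)"
          by (simp add: dist_norm norm_minus_commute algebra_simps)
        then show ?thesis using small[OF that] tm d2 by auto
      qed
      have "norm (h t - h 0) \<le> e * 2 * t * m\<^sup>2 * norm (t - 0)"
      proof (rule differentiable_bound[where S="{0..t}" and f'=h'])
        fix s assume s: "s \<in> {0..t}"
        have 1: "(f has_derivative f' (u + s *\<^sub>R a + t *\<^sub>R b)) (at (u + s *\<^sub>R a + t *\<^sub>R b))"
          using s t by (intro f inS) auto
        have "(f has_derivative f' (u + s *\<^sub>R a + 0 *\<^sub>R b)) (at (u + s *\<^sub>R a + 0 *\<^sub>R b))"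
          using s t by (intro f inS) auto
        then have 2: "(f has_derivative f' (u + s *\<^sub>R a)) (at (u + s *\<^sub>R a))" by simp
        have A: "((\<lambda>s. u + s *\<^sub>R a + t *\<^sub>R b) has_derivative (\<lambda>x. x *\<^sub>R a)) (at s within {0..t})"
          by (auto intro!: derivative_eq_intros)
        have B: "((\<lambda>s. u + s *\<^sub>R a) has_derivative (\<lambda>x. x *\<^sub>R a)) (at s within {0..t})"
          by (auto intro!: derivative_eq_intros)
        have "(h has_derivative (\<lambda>x. f' (u + s *\<^sub>R a + t *\<^sub>R b) (x *\<^sub>R a) - f' (u + s *\<^sub>R a) (x *\<^sub>R a)
            - (x * t) *\<^sub>R F b a)) (at s within {0..t})"
          unfolding h_def
          by (intro has_derivative_diff has_derivative_compose[OF A 1] has_derivative_compose[OF B 2])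
            (auto intro!: derivative_eq_intros)
        then show "(h has_derivative h' s) (at s within {0..t})"
          by (simp add: h'_def blinfun.scaleR_right scaleR_diff_right)
        let ?x = "u + s *\<^sub>R a + t *\<^sub>R b" and ?y = "u + s *\<^sub>R a"
        have x: "norm (?x - u) \<le> t * m" using small[of s t] s t by (simp add: algebra_simps)
        have y: "norm (?y - u) \<le> t * m" using small[of s 0] s t by (simp add: algebra_simps)
        have "f' ?x a - f' ?y a - t *\<^sub>R F b a
            = (f' ?x - f' u - F (?x - u)) a - (f' ?y - f' u - F (?y - u)) a"
          by (simp add: blinfun.bilinear_simps algebra_simps)
        also have "norm \<dots> \<le> norm (f' ?x - f' u - F (?x - u)) * norm a
            + norm (f' ?y - f' u - F (?y - u)) * norm a"
          by (intro order_trans[OF norm_triangle_ineq4] add_mono norm_blinfun)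
        also have "\<dots> \<le> (e * (t * m)) * m + (e * (t * m)) * m"
          using d1(2)[of ?x] d1(2)[of ?y] x y tm e m t
          by (intro add_mono mult_mono) (auto intro: order_trans mult_left_mono)
        finally have *: "norm (f' ?x a - f' ?y a - t *\<^sub>R F b a) \<le> e * 2 * t * m\<^sup>2"
          by (simp add: power2_eq_square algebra_simps)
        show "onorm (h' s) \<le> e * 2 * t * m\<^sup>2"
          using * by (intro onorm_le) (simp add: h'_def mult.commute mult_left_mono)
      qed (use t in auto)
      moreover have "h t - h 0 = \<Delta> a b t - t\<^sup>2 *\<^sub>R F b a"
        by (simp add: h_def \<Delta>_def power2_eq_square)
      moreover have "e * 2 * t * m\<^sup>2 * norm (t - 0) = \<epsilon> * t\<^sup>2"
        using t m by (simp add: e_def power2_eq_square)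
      ultimately show "norm (\<Delta> a b t - t\<^sup>2 *\<^sub>R F b a) \<le> \<epsilon> * t\<^sup>2" by simp
    qed
  qed
  have "norm (F b a - F a b) \<le> 0 + \<epsilon>" if \<epsilon>: "\<epsilon> > 0" for \<epsilon>
  proof -
    obtain d where d: "d > 0" "\<And>t. 0 < t \<and> t < d \<longrightarrow> norm (\<Delta> a b t - t\<^sup>2 *\<^sub>R F b a) \<le> \<epsilon>/2 * t\<^sup>2"
      using claim[of "\<epsilon>/2" a b] \<epsilon> by auto
    obtain d' where d': "d' > 0" "\<And>t. 0 < t \<and> t < d' \<longrightarrow> norm (\<Delta> b a t - t\<^sup>2 *\<^sub>R F a b) \<le> \<epsilon>/2 * t\<^sup>2"
      using claim[of "\<epsilon>/2" b a] \<epsilon> by auto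
    define t where "t = min d d' / 2"
    have t: "0 < t" "t < d" "t < d'" using d d' by (auto simp: t_def)
    have sym: "\<Delta> a b t = \<Delta> b a t" by (simp add: \<Delta>_def algebra_simps)
    have "norm (t\<^sup>2 *\<^sub>R (F b a - F a b)) = norm ((\<Delta> b a t - t\<^sup>2 *\<^sub>R F a b) - (\<Delta> a b t - t\<^sup>2 *\<^sub>R F b a))"
      unfolding sym by (simp add: scaleR_diff_right)
    also have "\<dots> \<le> \<epsilon>/2 * t\<^sup>2 + \<epsilon>/2 * t\<^sup>2"
      using d(2)[of t] d'(2)[of t] t
      norm_triangle_ineq4[of "\<Delta> b a t - t\<^sup>2 *\<^sub>R F a b" "\<Delta> a b t - t\<^sup>2 *\<^sub>R F b a"] by linarith
    finally have "t\<^sup>2 * norm (F b a - F a b) \<le> t\<^sup>2 * \<epsilon>"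
      by (simp add: mult.commute)
    then show ?thesis using t by simp
  qed
  then have "norm (F b a - F a b) \<le> 0" by (rule field_le_epsilon)
  then show ?thesis by simp
qed

text \<open>By the mean value inequality on a ball on which the derivative varies by at most \<open>\<eta>\<close>. The estimate
  is uniform in both points, which a derivative at a single point does not give; it is what yields
  Lipschitz constants for the map \<open>y \<mapsto> y + z \<nu> y\<close> near a given point of the surface.\<close>

lemma C1_strict_derivative:
  fixes G :: "'a::euclidean_space \<Rightarrow> 'b::real_normed_vector"
  assumes D: "open D" "u\<^sub>0 \<in> D" and \<eta>: "\<eta> > 0"
    and G: "\<And>u. u \<in> D \<Longrightarrow> (G has_derivative G' u) (at u)"
    and cont: "\<And>w. continuous_on D (\<lambda>u. G' u w)"
  obtains \<delta> where "\<delta> > 0" "ball u\<^sub>0 \<delta> \<subseteq> D"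
    "\<And>u w. u \<in> ball u\<^sub>0 \<delta> \<Longrightarrow> norm (G' u w - G' u\<^sub>0 w) \<le> \<eta> * norm w"
    "\<And>u v. u \<in> ball u\<^sub>0 \<delta> \<Longrightarrow> v \<in> ball u\<^sub>0 \<delta> \<Longrightarrow> norm (G v - G u - G' u\<^sub>0 (v - u)) \<le> \<eta> * norm (v - u)"
proof -
  have lin: "bounded_linear (G' u)" if "u \<in> D" for u using G[OF that] by (rule has_derivative_bounded_linear)
  have "\<forall>i\<in>Basis. eventually (\<lambda>u. dist (G' u i) (G' u\<^sub>0 i) < \<eta> / DIM('a)) (at u\<^sub>0)"
  proof
    fix i :: 'a
    have "isCont (\<lambda>u. G' u i) u\<^sub>0" using cont D by (simp add: continuous_on_eq_continuous_at)
    then show "eventually (\<lambda>u. dist (G' u i) (G' u\<^sub>0 i) < \<eta> / DIM('a)) (at u\<^sub>0)"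
      unfolding isCont_def using \<eta> by (intro tendstoD) auto
  qed
  then have "eventually (\<lambda>u. \<forall>i\<in>Basis. dist (G' u i) (G' u\<^sub>0 i) < \<eta> / DIM('a)) (at u\<^sub>0)"
    by (simp add: eventually_ball_finite)
  then obtain d1 where d1: "d1 > 0"
    "\<And>u i. u \<noteq> u\<^sub>0 \<Longrightarrow> dist u u\<^sub>0 < d1 \<Longrightarrow> i \<in> Basis \<Longrightarrow> dist (G' u i) (G' u\<^sub>0 i) < \<eta> / DIM('a)"
    unfolding eventually_at by auto
  obtain d2 where d2: "d2 > 0" "ball u\<^sub>0 d2 \<subseteq> D" using D open_contains_ball by blast
  define \<delta> where "\<delta> = min d1 d2"
  have \<delta>: "\<delta> > 0" "ball u\<^sub>0 \<delta> \<subseteq> D" using d1 d2 by (auto simp: \<delta>_def)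
  have near: "norm (G' u w - G' u\<^sub>0 w) \<le> \<eta> * norm w" if u: "u \<in> ball u\<^sub>0 \<delta>" for u w
  proof -
    interpret L: bounded_linear "\<lambda>w. G' u w - G' u\<^sub>0 w"
      using lin u \<delta> D by (intro bounded_linear_sub) auto
    have "G' u w - G' u\<^sub>0 w = (\<lambda>w. G' u w - G' u\<^sub>0 w) (\<Sum>i\<in>Basis. (w \<bullet> i) *\<^sub>R i)"
      by (simp only: euclidean_representation)
    also have "\<dots> = (\<Sum>i\<in>Basis. (w \<bullet> i) *\<^sub>R (G' u i - G' u\<^sub>0 i))"
      by (simp only: L.sum L.scaleR)
    also have "norm \<dots> \<le> (\<Sum>i\<in>(Basis::'a set). norm w * (\<eta> / DIM('a)))"
    proof (rule sum_norm_le)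
      fix i :: 'a assume i: "i \<in> Basis"
      have "norm (G' u i - G' u\<^sub>0 i) \<le> \<eta> / DIM('a)"
      proof (cases "u = u\<^sub>0")
        case False
        have "dist u u\<^sub>0 < d1" using u by (simp add: \<delta>_def dist_commute)
        then show ?thesis using d1(2)[OF False _ i] by (simp add: dist_norm less_imp_le)
      qed (use \<eta> in simp)
      then show "norm ((w \<bullet> i) *\<^sub>R (G' u i - G' u\<^sub>0 i)) \<le> norm w * (\<eta> / DIM('a))"
        using Basis_le_norm[OF i, of w] \<eta> by (auto simp del: times_divide_eq_right intro!: mult_mono)
    qed
    also have "\<dots> = \<eta> * norm w" by simp
    finally show ?thesis .
  qed
  show thesis
  proof (rule that[OF \<delta> near])
    fix u v assume uv: "u \<in> ball u\<^sub>0 \<delta>" "v \<in> ball u\<^sub>0 \<delta>"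
    have "norm (G v - G u - G' u\<^sub>0 (v - u)) \<le> norm (v - u) * \<eta>"
    proof (rule differentiable_bound_linearization[where S="ball u\<^sub>0 \<delta>"])
      fix t :: real assume "t \<in> {0..1}"
      then have "(1 - t) *\<^sub>R u + t *\<^sub>R v \<in> ball u\<^sub>0 \<delta>"
        using uv by (intro convexD_alt[OF convex_ball]) auto
      then show "u + t *\<^sub>R (v - u) \<in> ball u\<^sub>0 \<delta>" by (simp add: algebra_simps)
    next
      fix x assume x: "x \<in> ball u\<^sub>0 \<delta>"
      then show "(G has_derivative G' x) (at x within ball u\<^sub>0 \<delta>)"
        using G \<delta> by (meson has_derivative_at_withinI subsetD)
      show "onorm (G' x - G' u\<^sub>0) \<le> \<eta>" using near[OF x] by (intro onorm_le) auto
    qed (use \<delta> in auto)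
    then show "norm (G v - G u - G' u\<^sub>0 (v - u)) \<le> \<eta> * norm (v - u)" by (simp add: mult.commute)
  qed
qed

lemma orthonormal_triple_expand:
  fixes a b c x :: "real^3"
  assumes "norm a = 1" "norm b = 1" "norm c = 1" "a \<bullet> b = 0" "a \<bullet> c = 0" "b \<bullet> c = 0"
  shows "x = (x \<bullet> a) *\<^sub>R a + (x \<bullet> b) *\<^sub>R b + (x \<bullet> c) *\<^sub>R c"
proof -
  have ne: "a \<noteq> b" "a \<noteq> c" "b \<noteq> c" "a \<noteq> 0" "b \<noteq> 0" "c \<noteq> 0"
    using assms by (auto simp: norm_eq_1)
  have orth: "pairwise orthogonal {a, b, c}"
    using assms by (auto simp: pairwise_insert orthogonal_def inner_commute)
  then have "independent {a, b, c}" using ne by (intro pairwise_orthogonal_independent) auto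
  then have "span {a, b, c} = UNIV"
    using ne card_eq_dim[of "{a, b, c}" UNIV] by auto
  then show ?thesis
    using orthonormal_basis_expand[OF orth, of x] assms ne by (fastforce simp: add.assoc)
qed

text \<open>With \<open>V\<close> the matrix of columns \<open>(p, q)\<close> and \<open>(r, s)\<close>, the hypotheses say that the transpose of
  \<open>V\<close> times \<open>A V\<close> is the identity. Hence \<open>V\<close> times its transpose is the inverse of \<open>A\<close>, and the conclusions are
  the entries of this matrix identity, multiplied by the determinant of \<open>A\<close>.\<close>

lemma orthonormal_frame_inverse_metric:
  fixes p q r s :: real
  assumes 1: "p*p*a11 + 2*p*q*a12 + q*q*a22 = 1"
    and 2: "r*r*a11 + 2*r * s * a12 + (s * s)*a22 = 1"
    and 3: "p*r*a11 + (p * s+q*r)*a12 + q * s * a22 = 0"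
  shows "(p*p + r*r) * (a11*a22 - a12*a12) = a22"
    and "(q*q + s * s) * (a11*a22 - a12*a12) = a11"
    and "(p*q + r * s) * (a11*a22 - a12*a12) = - a12"
  using assms by algebra+

section \<open>Charts, unit normal and tangent plane\<close>

lemma bounded_bilinear_cross3: "bounded_bilinear cross3"
  using bilinear_cross by (simp add: bilinear_conv_bounded_bilinear)

text \<open>A regular \<open>C\<^sup>2\<close> parametrization of a relatively open part of \<open>M\<close>, with its first two derivatives as
  parameters so that the normal and the fundamental forms can be defined from them.\<close>

locale surface_chart =
  fixes M :: "(real^3) set" and D :: "(real^2) set" and f :: "real^2 \<Rightarrow> real^3"
    and f' :: "real^2 \<Rightarrow> (real^2) \<Rightarrow>\<^sub>L (real^3)"
    and f'' :: "real^2 \<Rightarrow> (real^2) \<Rightarrow>\<^sub>L (real^2) \<Rightarrow>\<^sub>L (real^3)"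
  assumes open_D: "open D"
    and f: "u \<in> D \<Longrightarrow> (f has_derivative blinfun_apply (f' u)) (at u)"
    and f': "u \<in> D \<Longrightarrow> (f' has_derivative blinfun_apply (f'' u)) (at u)"
    and f''_cont: "continuous_on D f''"
    and inj: "u \<in> D \<Longrightarrow> inj (blinfun_apply (f' u))"
    and openin_image: "openin (top_of_set M) (f ` D)"
    and homeo: "\<exists>g. homeomorphism D (f ` D) f g"

lemma local_parametrization_chart:
  assumes "local_parametrization M D f"
  obtains f' f'' where "surface_chart M D f f' f''"
proof -
  from assms obtain f' f'' where
    d: "\<forall>u\<in>D. (f has_derivative blinfun_apply (f' u)) (at u)"
    "\<forall>u\<in>D. (f' has_derivative blinfun_apply (f'' u)) (at u)" "continuous_on D f''"
    unfolding local_parametrization_def C2_on_def by blast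
  have "frechet_derivative f (at u) = blinfun_apply (f' u)" if "u \<in> D" for u
    using d(1) that by (metis frechet_derivative_at)
  then have "surface_chart M D f f' f''"
    using assms d unfolding local_parametrization_def surface_chart_def by auto
  then show thesis by (rule that)
qed

context surface_chart
begin

lemma image_in: "u \<in> D \<Longrightarrow> f u \<in> M"
  using openin_image openin_subset by fastforce

lemma f_cont: "continuous_on D f"
  using f has_derivative_continuous continuous_at_imp_continuous_on by blast

lemma f'_cont: "continuous_on D f'"
  using f' has_derivative_continuous continuous_at_imp_continuous_on by blast

lemma f'_apply_cont: "continuous_on D (\<lambda>u. f' u w)"
  using f'_cont by (intro continuous_intros)

lemma f''_apply_cont: "continuous_on D (\<lambda>u. f'' u w v)"
  using f''_cont by (intro continuous_intros)

text \<open>This is where embeddedness enters: \<open>f\<close> is a homeomorphism onto a relatively open subset of \<open>M\<close>, so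
  no other sheet of \<open>M\<close> comes close to \<open>f u\<close>.\<close>

lemma image_neighbourhood:
  assumes u: "u \<in> D" and \<delta>: "\<delta> > 0"
  obtains \<rho> where "\<rho> > 0" "\<And>y. y \<in> M \<Longrightarrow> dist y (f u) < \<rho> \<Longrightarrow> \<exists>v\<in>D. dist v u < \<delta> \<and> y = f v"
proof -
  obtain g where g: "homeomorphism D (f ` D) f g" using homeo by blast
  have "openin (top_of_set D) (D \<inter> ball u \<delta>)" by auto
  then have "openin (top_of_set M) (f ` (D \<inter> ball u \<delta>))"
    using homeomorphism_imp_open_map[OF g] openin_image openin_trans by blast
  moreover have "f u \<in> f ` (D \<inter> ball u \<delta>)" using u \<delta> by auto
  ultimately obtain \<rho> where \<rho>: "\<rho> > 0" "\<forall>y\<in>M. dist y (f u) < \<rho> \<longrightarrow> y \<in> f ` (D \<inter> ball u \<delta>)"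
    unfolding openin_euclidean_subtopology_iff by blast
  show thesis
  proof (rule that[OF \<rho>(1)])
    fix y assume "y \<in> M" "dist y (f u) < \<rho>"
    then have "y \<in> f ` (D \<inter> ball u \<delta>)" using \<rho>(2) by blast
    then show "\<exists>v\<in>D. dist v u < \<delta> \<and> y = f v" by (auto simp: dist_commute)
  qed
qed

lemma lower_lipschitz:
  assumes u: "u \<in> D"
  obtains C \<delta> where "C > 0" "\<delta> > 0" "ball u \<delta> \<subseteq> D"
    "\<And>v w. v \<in> ball u \<delta> \<Longrightarrow> w \<in> ball u \<delta> \<Longrightarrow> norm (v - w) \<le> C * norm (f v - f w)"
proof -
  have "linear (f' u)" by (intro bounded_linear.linear blinfun.bounded_linear_right)
  then obtain c where c: "c > 0" "\<And>x. c * norm x \<le> norm (f' u x)"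
    using linear_inj_bounded_below_pos[OF _ inj[OF u]] by blast
  have c2: "c/2 > 0" using c by simp
  obtain \<delta> where \<delta>: "\<delta> > 0" "ball u \<delta> \<subseteq> D"
    "\<And>v w. v \<in> ball u \<delta> \<Longrightarrow> norm (f' v w - f' u w) \<le> c/2 * norm w"
    "\<And>v w. v \<in> ball u \<delta> \<Longrightarrow> w \<in> ball u \<delta> \<Longrightarrow> norm (f w - f v - f' u (w - v)) \<le> c/2 * norm (w - v)"
    using C1_strict_derivative[OF open_D u c2 f f'_apply_cont] by metis
  show thesis
  proof (rule that[of "2/c" \<delta>])
    fix v w assume vw: "v \<in> ball u \<delta>" "w \<in> ball u \<delta>"
    have "c * norm (v - w) \<le> norm (f' u (v - w))" by (rule c)
    also have "\<dots> \<le> norm (f v - f w) + norm (f v - f w - f' u (v - w))"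
      using norm_triangle_ineq4[of "f v - f w" "f v - f w - f' u (v - w)"] by simp
    also have "\<dots> \<le> norm (f v - f w) + c/2 * norm (v - w)" using \<delta>(4)[OF vw(2,1)] by simp
    finally show "norm (v - w) \<le> 2/c * norm (f v - f w)" using c by (simp add: field_simps)
  qed (use c \<delta> in auto)
qed

text \<open>The inverse of the chart is Lipschitz near \<open>f u\<close> by the previous estimate, so it is differentiable
  along \<open>M\<close>. Its derivative is determined on the tangent plane only, where it inverts \<open>f' u\<close>; \<open>B\<close> is some linear
  extension to the whole space.\<close>

lemma inverse_derivative:
  assumes g: "homeomorphism D (f ` D) f g" and u: "u \<in> D"
  obtains B where "bounded_linear B" "\<And>w. B (f' u w) = w" "(g has_derivative B) (at (f u) within M)"
proof -
  have "linear (f' u)" by (intro bounded_linear.linear blinfun.bounded_linear_right)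
  then obtain B where B: "linear B" "B \<circ> f' u = id"
    using linear_injective_left_inverse[OF _ inj[OF u]] by blast
  have Bl: "bounded_linear B" using B(1) by (simp add: linear_conv_bounded_linear)
  have Bf: "B (f' u w) = w" for w using B(2) by (metis comp_apply id_apply)
  obtain K where K: "K > 0" "\<And>x. norm (B x) \<le> norm x * K"
    using bounded_linear.pos_bounded[OF Bl] by blast
  obtain C \<delta> where C: "C > 0" "\<delta> > 0" "ball u \<delta> \<subseteq> D"
    "\<And>v w. v \<in> ball u \<delta> \<Longrightarrow> w \<in> ball u \<delta> \<Longrightarrow> norm (v - w) \<le> C * norm (f v - f w)"
    using lower_lipschitz[OF u] by blast
  have "(g has_derivative B) (at (f u) within M)"
    unfolding has_derivative_within_alt
  proof (intro conjI allI impI Bl)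
    fix e :: real assume e: "0 < e"
    define \<epsilon> where "\<epsilon> = e / (K * C)"
    have \<epsilon>: "\<epsilon> > 0" using e K C by (simp add: \<epsilon>_def)
    obtain d where d: "d > 0" "\<And>v. norm (v - u) < d \<Longrightarrow> norm (f v - f u - f' u (v - u)) \<le> \<epsilon> * norm (v - u)"
      using f[OF u] \<epsilon> unfolding has_derivative_at_alt by blast
    have "min d \<delta> > 0" using d C by simp
    from image_neighbourhood[OF u this] obtain \<rho> where \<rho>: "\<rho> > 0"
      "\<And>y. y \<in> M \<Longrightarrow> dist y (f u) < \<rho> \<Longrightarrow> \<exists>v\<in>D. dist v u < min d \<delta> \<and> y = f v" by blast
    show "\<exists>d>0. \<forall>y\<in>M. norm (y - f u) < d \<longrightarrow>
        norm (g y - g (f u) - B (y - f u)) \<le> e * norm (y - f u)"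
    proof (intro exI[of _ \<rho>] conjI ballI impI \<rho>(1))
      fix y assume "y \<in> M" "norm (y - f u) < \<rho>"
      then obtain v where v: "v \<in> D" "dist v u < min d \<delta>" "y = f v"
        using \<rho>(2)[of y] by (auto simp: dist_norm)
      have gv: "g (f v) = v" "g (f u) = u" using g u v by (auto simp: homeomorphism_apply1)
      interpret B: bounded_linear B by (rule Bl)
      have "g y - g (f u) - B (y - f u) = - B (f v - f u - f' u (v - u))"
        using v gv by (simp add: B.diff Bf)
      then have "norm (g y - g (f u) - B (y - f u)) \<le> norm (f v - f u - f' u (v - u)) * K"
        using K(2) by simp
      also have "\<dots> \<le> (\<epsilon> * norm (v - u)) * K"
        using d(2)[of v] v K by (intro mult_right_mono) (auto simp: dist_norm)
      also have "\<dots> \<le> (\<epsilon> * (C * norm (f v - f u))) * K"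
        using C(4)[of v u] C(2) v \<epsilon> K
        by (intro mult_right_mono mult_left_mono) (auto simp: dist_commute)
      also have "\<dots> = e * norm (y - f u)" using v K C by (simp add: \<epsilon>_def)
      finally show "norm (g y - g (f u) - B (y - f u)) \<le> e * norm (y - f u)" .
    qed
  qed
  then show thesis using that Bl Bf by blast
qed

definition nrm :: "real^2 \<Rightarrow> real^3" where
  "nrm u = cross3 (f' u (axis 1 1)) (f' u (axis 2 1))"

definition dnrm :: "real^2 \<Rightarrow> real^2 \<Rightarrow> real^3" where
  "dnrm u w = cross3 (f' u (axis 1 1)) (f'' u w (axis 2 1)) + cross3 (f'' u w (axis 1 1)) (f' u (axis 2 1))"

definition \<nu> :: "real^2 \<Rightarrow> real^3" where
  "\<nu> u = inverse (norm (nrm u)) *\<^sub>R nrm u"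

text \<open>The derivative of the quotient \<open>\<nu>\<close> is the part of \<open>dnrm\<close> orthogonal to \<open>\<nu>\<close>, divided by the
  length of \<open>nrm\<close>.\<close>

definition d\<nu> :: "real^2 \<Rightarrow> real^2 \<Rightarrow> real^3" where
  "d\<nu> u w = inverse (norm (nrm u)) *\<^sub>R (dnrm u w - (\<nu> u \<bullet> dnrm u w) *\<^sub>R \<nu> u)"

lemma plane_decomp: "w = (w $ 1) *\<^sub>R axis 1 1 + (w $ 2) *\<^sub>R axis 2 1" for w :: "real^2"
  by (simp add: vec_eq_iff forall_2 axis_def)

lemma f'_decomp: "f' u w = (w $ 1) *\<^sub>R f' u (axis 1 1) + (w $ 2) *\<^sub>R f' u (axis 2 1)"
  by (subst plane_decomp[of w]) (simp only: blinfun.add_right blinfun.scaleR_right)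

lemma nrm_nonzero:
  assumes u: "u \<in> D" shows "nrm u \<noteq> 0"
proof
  assume "nrm u = 0"
  then have "collinear {0, f' u (axis 1 1), f' u (axis 2 1)}"
    by (simp add: nrm_def cross_eq_0)
  then consider "f' u (axis 1 1) = 0" | "f' u (axis 2 1) = 0"
    | c where "f' u (axis 2 1) = c *\<^sub>R f' u (axis 1 1)"
    unfolding collinear_lemma by blast
  then show False
  proof cases
    case 1
    then have "f' u (axis 1 1) = f' u 0" by simp
    then have "axis 1 1 = (0 :: real^2)" using inj[OF u] by (metis injD)
    then show False by (simp add: axis_eq_0_iff)
  next
    case 2
    then have "f' u (axis 2 1) = f' u 0" by simp
    then have "axis 2 1 = (0 :: real^2)" using inj[OF u] by (metis injD)
    then show False by (simp add: axis_eq_0_iff)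
  next
    case (3 c)
    then have "f' u (axis 2 1) = f' u (c *\<^sub>R axis 1 1)" by (simp add: blinfun.scaleR_right)
    then have "axis 2 1 = c *\<^sub>R (axis 1 1 :: real^2)" using inj[OF u] by (metis injD)
    then have "(axis 2 1 :: real^2) $ 2 = (c *\<^sub>R (axis 1 1 :: real^2)) $ 2" by simp
    then show False by (simp add: axis_def)
  qed
qed

lemma norm_\<nu>: "u \<in> D \<Longrightarrow> norm (\<nu> u) = 1"
  using nrm_nonzero by (simp add: \<nu>_def)

lemma \<nu>_tangent: "\<nu> u \<bullet> f' u w = 0"
proof -
  have "nrm u \<bullet> f' u w = 0"
    by (subst f'_decomp) (simp add: nrm_def dot_cross_self inner_add_right)
  then show ?thesis by (simp add: \<nu>_def)
qed

lemma tangent_plane_image: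
  assumes u: "u \<in> D" and v: "\<nu> u \<bullet> v = 0"
  obtains w where "v = f' u w"
proof -
  have l: "linear (f' u)" by (intro bounded_linear.linear blinfun.bounded_linear_right)
  have "dim (range (f' u)) = 2"
    using dim_image_eq[OF l, of UNIV] inj[OF u] by simp
  moreover have "dim {x. \<nu> u \<bullet> x = 0} = 2"
    using dim_hyperplane[of "\<nu> u"] norm_\<nu>[OF u] by fastforce
  moreover have "range (f' u) \<subseteq> {x. \<nu> u \<bullet> x = 0}" using \<nu>_tangent by auto
  ultimately have "range (f' u) = {x. \<nu> u \<bullet> x = 0}"
    using l by (intro subspace_dim_equal) (auto simp: subspace_hyperplane linear_subspace_image)
  then show thesis using v that by blast
qed

lemma nrm_derivative: "u \<in> D \<Longrightarrow> (nrm has_derivative dnrm u) (at u)"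
  unfolding nrm_def dnrm_def
  by (rule bounded_bilinear.FDERIV[OF bounded_bilinear_cross3];
      rule bounded_linear.has_derivative[OF blinfun.bounded_linear_left f'])

lemma \<nu>_derivative:
  assumes u: "u \<in> D" shows "(\<nu> has_derivative d\<nu> u) (at u)"
proof -
  have n: "norm (nrm u) > 0" using nrm_nonzero[OF u] by simp
  have "(norm has_derivative (\<lambda>h. h \<bullet> sgn (nrm u))) (at (nrm u))"
    using GDERIV_norm[OF nrm_nonzero[OF u]] by (simp add: gderiv_def)
  from has_derivative_compose[OF nrm_derivative[OF u] this]
  have 1: "((\<lambda>u. norm (nrm u)) has_derivative (\<lambda>h. dnrm u h \<bullet> sgn (nrm u))) (at u)" .
  have "(\<nu> has_derivative (\<lambda>h. inverse (norm (nrm u)) *\<^sub>R dnrm u h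
      + (- (inverse (norm (nrm u)) * (dnrm u h \<bullet> sgn (nrm u)) * inverse (norm (nrm u)))) *\<^sub>R nrm u)) (at u)"
    unfolding \<nu>_def using n
    by (intro has_derivative_scaleR Deriv.has_derivative_inverse 1 nrm_derivative u) auto
  moreover have "(\<lambda>h. inverse (norm (nrm u)) *\<^sub>R dnrm u h
      + (- (inverse (norm (nrm u)) * (dnrm u h \<bullet> sgn (nrm u)) * inverse (norm (nrm u)))) *\<^sub>R nrm u) = d\<nu> u"
    by (rule ext) (simp add: d\<nu>_def \<nu>_def sgn_div_norm scaleR_diff_right inner_commute algebra_simps)
  ultimately show ?thesis by simp
qed

lemma nrm_cont: "continuous_on D nrm"
  unfolding nrm_def by (intro continuous_on_cross f'_apply_cont)

lemma \<nu>_cont: "continuous_on D \<nu>"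
  unfolding \<nu>_def using nrm_nonzero by (intro continuous_intros nrm_cont) auto

lemma d\<nu>_cont: "continuous_on D (\<lambda>u. d\<nu> u w)"
  unfolding d\<nu>_def dnrm_def using nrm_nonzero
  by (intro continuous_intros nrm_cont \<nu>_cont continuous_on_cross f'_apply_cont f''_apply_cont) auto

lemma d\<nu>_tangent: "u \<in> D \<Longrightarrow> \<nu> u \<bullet> d\<nu> u w = 0"
  using norm_\<nu>[of u] by (simp add: d\<nu>_def inner_diff_right norm_eq_1)

lemma d\<nu>_linear: "u \<in> D \<Longrightarrow> bounded_linear (d\<nu> u)"
  using \<nu>_derivative has_derivative_bounded_linear by blast

text \<open>Differentiating \<open>\<nu> \<bullet> f' v = 0\<close>.\<close>

lemma d\<nu>_second_derivative:
  assumes u: "u \<in> D" shows "d\<nu> u w \<bullet> f' u v = - (\<nu> u \<bullet> f'' u w v)"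
proof -
  have "((\<lambda>u. \<nu> u \<bullet> f' u v) has_derivative (\<lambda>w. \<nu> u \<bullet> f'' u w v + d\<nu> u w \<bullet> f' u v)) (at u)"
    by (rule has_derivative_inner[OF \<nu>_derivative[OF u]
          bounded_linear.has_derivative[OF blinfun.bounded_linear_left f'[OF u]]])
  moreover have "((\<lambda>u. \<nu> u \<bullet> f' u v) has_derivative (\<lambda>w. 0)) (at u)"
    by (simp add: \<nu>_tangent)
  ultimately have "(\<lambda>w. \<nu> u \<bullet> f'' u w v + d\<nu> u w \<bullet> f' u v) = (\<lambda>w. 0)"
    by (rule has_derivative_unique)
  from fun_cong[OF this, of w] show ?thesis by simp
qed

lemma shape_operator_symmetric:
  assumes u: "u \<in> D" shows "d\<nu> u w \<bullet> f' u v = d\<nu> u v \<bullet> f' u w"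
  using second_derivative_symmetric[OF open_D u f f'[OF u], of v w]
  by (simp add: d\<nu>_second_derivative[OF u])

text \<open>A differentiable curve in \<open>M\<close> through \<open>f u\<close> is, for small times, \<open>f\<close> applied to a curve in the
  parameter plane, which is differentiable because the inverse of the chart is differentiable along
  \<open>M\<close>. So its velocity lies in the range of \<open>f' u\<close>.\<close>

lemma tangent_space_eq:
  assumes u: "u \<in> D" shows "tangent_space M (f u) = {v. \<nu> u \<bullet> v = 0}"
proof (intro equalityI subsetI)
  fix v assume "v \<in> {v. \<nu> u \<bullet> v = 0}"
  then obtain w where w: "v = f' u w" using tangent_plane_image[OF u] by blast
  obtain d where d: "d > 0" "ball u d \<subseteq> D" using open_D u open_contains_ball by blast
  define \<epsilon> where "\<epsilon> = d / (norm w + 1)"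
  have \<epsilon>: "\<epsilon> > 0" using d by (simp add: \<epsilon>_def add_nonneg_pos)
  have "f (u + t *\<^sub>R w) \<in> M" if t: "t \<in> {-\<epsilon><..<\<epsilon>}" for t
  proof -
    have pos: "norm w + 1 > 0" by (simp add: add_nonneg_pos)
    have "\<bar>t\<bar> * norm w \<le> \<bar>t\<bar> * (norm w + 1)" by (intro mult_left_mono) simp_all
    also have "\<dots> < \<epsilon> * (norm w + 1)"
      using t pos by (intro mult_strict_right_mono) (simp_all add: abs_less_iff)
    also have "\<dots> = d" using pos by (simp add: \<epsilon>_def)
    finally have "u + t *\<^sub>R w \<in> ball u d" by (simp add: dist_norm)
    then show ?thesis using d image_in by blast
  qed
  moreover have "((\<lambda>t. f (u + t *\<^sub>R w)) has_vector_derivative v) (at 0)"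
  proof -
    have 1: "((\<lambda>t. u + t *\<^sub>R w) has_derivative (\<lambda>t. t *\<^sub>R w)) (at (0::real))"
      by (auto intro!: derivative_eq_intros)
    have 2: "(f has_derivative f' u) (at (u + 0 *\<^sub>R w))" using f[OF u] by simp
    show ?thesis
      using has_derivative_compose[OF 1 2]
      by (simp add: has_vector_derivative_def w blinfun.scaleR_right)
  qed
  ultimately show "v \<in> tangent_space M (f u)"
    unfolding tangent_space_def using \<epsilon> by (auto intro!: exI[of _ "\<lambda>t. f (u + t *\<^sub>R w)"])
next
  fix v assume "v \<in> tangent_space M (f u)"
  then obtain \<gamma> \<epsilon> where \<gamma>: "\<epsilon> > 0" "\<And>t. t \<in> {-\<epsilon><..<\<epsilon>} \<Longrightarrow> \<gamma> t \<in> M" "\<gamma> 0 = f u"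
    "(\<gamma> has_vector_derivative v) (at 0)"
    unfolding tangent_space_def by blast
  obtain g where g: "homeomorphism D (f ` D) f g" using homeo by blast
  obtain B where B: "bounded_linear B" "\<And>w. B (f' u w) = w" "(g has_derivative B) (at (f u) within M)"
    using inverse_derivative[OF g u] by blast
  have fg: "f (g y) = y" if "y \<in> f ` D" for y using g that by (auto simp: homeomorphism_apply2)
  have gu: "g (f u) = u" using g u by (auto simp: homeomorphism_apply1)
  let ?I = "{-\<epsilon><..<\<epsilon>}"
  have d\<gamma>: "(\<gamma> has_derivative (\<lambda>t. t *\<^sub>R v)) (at 0 within ?I)"
    using \<gamma>(4) by (auto simp: has_vector_derivative_def intro: has_derivative_at_withinI)
  have "(g has_derivative B) (at (\<gamma> 0) within \<gamma> ` ?I)"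
    using B(3) \<gamma>(2,3) by (auto intro: has_derivative_subset)
  from has_derivative_in_compose[OF d\<gamma> this]
  have 1: "((\<lambda>t. g (\<gamma> t)) has_derivative (\<lambda>t. B (t *\<^sub>R v))) (at 0 within ?I)" .
  have 2: "(f has_derivative f' u) (at (g (\<gamma> 0)))" using f[OF u] by (simp add: \<gamma>(3) gu)
  have 3: "((\<lambda>t. f (g (\<gamma> t))) has_derivative (\<lambda>t. f' u (B (t *\<^sub>R v)))) (at 0 within ?I)"
    using has_derivative_compose[OF 1 2] .
  obtain \<rho> where \<rho>: "\<rho> > 0" "\<And>y. y \<in> M \<Longrightarrow> dist y (f u) < \<rho> \<Longrightarrow> \<exists>v\<in>D. dist v u < 1 \<and> y = f v"
    using image_neighbourhood[OF u zero_less_one] by blast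
  have "\<exists>d>0. \<forall>t. dist t 0 < d \<longrightarrow> dist (\<gamma> t) (\<gamma> 0) < \<rho>"
    using has_vector_derivative_continuous[OF \<gamma>(4)] \<rho> unfolding continuous_at_eps_delta by blast
  then obtain d where d: "d > 0" "\<And>t. dist t 0 < d \<Longrightarrow> dist (\<gamma> t) (f u) < \<rho>"
    using \<gamma>(3) by auto
  have "((\<lambda>t. \<gamma> t) has_derivative (\<lambda>t. f' u (B (t *\<^sub>R v)))) (at 0 within ?I)"
  proof (rule has_derivative_transform_within[OF 3 d(1)])
    show "0 \<in> ?I" using \<gamma>(1) by simp
    fix t assume t: "t \<in> ?I" "dist t 0 < d"
    then have "\<gamma> t \<in> f ` D" using \<rho>(2)[OF \<gamma>(2) d(2)] by blast
    then show "f (g (\<gamma> t)) = \<gamma> t" by (rule fg)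
  qed
  then have "((\<lambda>t. \<gamma> t) has_derivative (\<lambda>t. f' u (B (t *\<^sub>R v)))) (at 0)"
    using \<gamma>(1) by (simp add: at_within_open[of 0 ?I])
  moreover have "(\<gamma> has_derivative (\<lambda>t. t *\<^sub>R v)) (at 0)"
    using \<gamma>(4) by (simp add: has_vector_derivative_def)
  ultimately have "(\<lambda>t. f' u (B (t *\<^sub>R v))) = (\<lambda>t. t *\<^sub>R v)" by (rule has_derivative_unique)
  then have "f' u (B (1 *\<^sub>R v)) = 1 *\<^sub>R v" by metis
  then have "v = f' u (B v)" by simp
  then show "v \<in> {v. \<nu> u \<bullet> v = 0}" using \<nu>_tangent by (metis mem_Collect_eq)
qed

end

section \<open>Principal curvatures and mean curvature in a chart\<close>

text \<open>With \<open>x = cos \<theta>\<close> and \<open>y = sin \<theta>\<close>, the expression is the off-diagonal entry of the symmetric matrix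
  with entries \<open>a, b, b, c\<close> after a rotation by \<open>\<theta>\<close>; it is linear in \<open>cos (2 \<theta>)\<close> and \<open>sin (2 \<theta>)\<close>.\<close>

lemma rotation_diagonalises:
  fixes a b c :: real
  obtains x y where "x\<^sup>2 + y\<^sup>2 = 1" "b * (x\<^sup>2 - y\<^sup>2) + (c - a) * (x * y) = 0"
proof -
  define X where "X = (c - a) / 2"
  define r where "r = sqrt (X\<^sup>2 + b\<^sup>2)"
  obtain C S where CS: "C\<^sup>2 + S\<^sup>2 = 1" "b * C + X * S = 0"
  proof (cases "r = 0")
    case True
    then have "X = 0 \<and> b = 0" by (simp add: r_def sum_power2_eq_zero_iff)
    then show thesis using that[of 1 0] by simp
  next
    case False
    have r2: "r\<^sup>2 = X\<^sup>2 + b\<^sup>2" by (simp add: r_def)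
    show thesis
    proof (rule that[of "X / r" "- b / r"])
      have "(X / r)\<^sup>2 + (- b / r)\<^sup>2 = (X\<^sup>2 + b\<^sup>2) / r\<^sup>2" by (simp add: power_divide add_divide_distrib)
      then show "(X / r)\<^sup>2 + (- b / r)\<^sup>2 = 1" unfolding r2[symmetric] using False by simp
    qed simp
  qed
  obtain t where t: "C = cos t" "S = sin t" using sincos_total_2pi[OF CS(1)] by metis
  define \<theta> where "\<theta> = t / 2"
  have "C = (cos \<theta>)\<^sup>2 - (sin \<theta>)\<^sup>2" "S = 2 * (sin \<theta> * cos \<theta>)"
    using cos_double[of \<theta>] sin_double[of \<theta>] by (simp_all add: t \<theta>_def)
  with CS(2) have "b * ((cos \<theta>)\<^sup>2 - (sin \<theta>)\<^sup>2) + X * (2 * (sin \<theta> * cos \<theta>)) = 0" by simp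
  moreover have "X * (2 * (sin \<theta> * cos \<theta>)) = (c - a) * (cos \<theta> * sin \<theta>)" by (simp add: X_def)
  ultimately show thesis by (intro that[of "cos \<theta>" "sin \<theta>"]) simp_all
qed

context surface_chart
begin

text \<open>Principal curvatures for the normal \<open>\<nu>\<close> together with orthonormal principal directions, the latter
  represented by vectors in the parameter plane.\<close>

definition frame :: "real^2 \<Rightarrow> real \<Rightarrow> real \<Rightarrow> real^2 \<Rightarrow> real^2 \<Rightarrow> bool" where
  "frame u \<kappa>\<^sub>1 \<kappa>\<^sub>2 v\<^sub>1 v\<^sub>2 \<longleftrightarrow> norm (f' u v\<^sub>1) = 1 \<and> norm (f' u v\<^sub>2) = 1 \<and> f' u v\<^sub>1 \<bullet> f' u v\<^sub>2 = 0 \<and>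
     d\<nu> u v\<^sub>1 = - (\<kappa>\<^sub>1 *\<^sub>R f' u v\<^sub>1) \<and> d\<nu> u v\<^sub>2 = - (\<kappa>\<^sub>2 *\<^sub>R f' u v\<^sub>2)"

lemma tangent_expand:
  assumes u: "u \<in> D" and "norm a = 1" "norm b = 1" "a \<bullet> b = 0" "\<nu> u \<bullet> a = 0" "\<nu> u \<bullet> b = 0" "\<nu> u \<bullet> x = 0"
  shows "x = (x \<bullet> a) *\<^sub>R a + (x \<bullet> b) *\<^sub>R b"
  using orthonormal_triple_expand[of a b "\<nu> u" x] norm_\<nu>[OF u] assms by (simp add: inner_commute)

lemma frame_exists:
  assumes u: "u \<in> D"
  obtains \<kappa>\<^sub>1 \<kappa>\<^sub>2 v\<^sub>1 v\<^sub>2 where "frame u \<kappa>\<^sub>1 \<kappa>\<^sub>2 v\<^sub>1 v\<^sub>2"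
proof -
  interpret N: bounded_linear "d\<nu> u" by (rule d\<nu>_linear[OF u])
  have ne: "f' u (axis 1 1) \<noteq> 0"
  proof
    assume "f' u (axis 1 1) = 0"
    then have "nrm u = 0" by (simp add: nrm_def)
    then show False using nrm_nonzero[OF u] by simp
  qed
  define w\<^sub>1 where "w\<^sub>1 = inverse (norm (f' u (axis 1 1))) *\<^sub>R (axis 1 1 :: real^2)"
  define t\<^sub>1 where "t\<^sub>1 = f' u w\<^sub>1"
  define t\<^sub>2 where "t\<^sub>2 = cross3 (\<nu> u) t\<^sub>1"
  have t1: "norm t\<^sub>1 = 1" using ne by (simp add: t\<^sub>1_def w\<^sub>1_def blinfun.scaleR_right)
  have \<nu>1: "\<nu> u \<bullet> t\<^sub>1 = 0" by (simp add: t\<^sub>1_def \<nu>_tangent)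
  have "(norm t\<^sub>2)\<^sup>2 = 1"
    using norm_cross_dot[of "\<nu> u" t\<^sub>1] norm_\<nu>[OF u] t1 \<nu>1 by (simp add: t\<^sub>2_def)
  then have t2: "norm t\<^sub>2 = 1" by (simp add: power2_eq_1_iff) (metis norm_ge_zero not_one_le_zero neg_0_le_iff_le)
  have \<nu>2: "\<nu> u \<bullet> t\<^sub>2 = 0" and t12: "t\<^sub>1 \<bullet> t\<^sub>2 = 0" by (simp_all add: t\<^sub>2_def dot_cross_self)
  obtain w\<^sub>2 where w2: "t\<^sub>2 = f' u w\<^sub>2" using tangent_plane_image[OF u \<nu>2] by blast
  define a where "a = d\<nu> u w\<^sub>1 \<bullet> t\<^sub>1"
  define b where "b = d\<nu> u w\<^sub>1 \<bullet> t\<^sub>2"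
  define c where "c = d\<nu> u w\<^sub>2 \<bullet> t\<^sub>2"
  have b': "d\<nu> u w\<^sub>2 \<bullet> t\<^sub>1 = b"
    unfolding b_def t\<^sub>1_def w2 by (rule shape_operator_symmetric[OF u])
  obtain x y where xy: "x\<^sup>2 + y\<^sup>2 = 1" "b * (x\<^sup>2 - y\<^sup>2) + (c - a) * (x * y) = 0"
    using rotation_diagonalises by blast
  define v\<^sub>1 where "v\<^sub>1 = x *\<^sub>R w\<^sub>1 + y *\<^sub>R w\<^sub>2"
  define v\<^sub>2 where "v\<^sub>2 = (- y) *\<^sub>R w\<^sub>1 + x *\<^sub>R w\<^sub>2"
  have e1: "f' u v\<^sub>1 = x *\<^sub>R t\<^sub>1 + y *\<^sub>R t\<^sub>2" and e2: "f' u v\<^sub>2 = (- y) *\<^sub>R t\<^sub>1 + x *\<^sub>R t\<^sub>2"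
    by (simp_all add: v\<^sub>1_def v\<^sub>2_def w2 t\<^sub>1_def blinfun.bilinear_simps)
  have sq: "t\<^sub>1 \<bullet> t\<^sub>1 = 1" "t\<^sub>2 \<bullet> t\<^sub>2 = 1" "t\<^sub>2 \<bullet> t\<^sub>1 = 0"
    using t1 t2 t12 by (simp_all add: norm_eq_1 inner_commute)
  have n1: "norm (f' u v\<^sub>1) = 1" and n2: "norm (f' u v\<^sub>2) = 1"
    using xy(1) unfolding norm_eq_1 e1 e2
    by (simp_all add: inner_add_left inner_add_right sq t12 power2_eq_square inner_diff_left inner_diff_right algebra_simps)
  have o: "f' u v\<^sub>1 \<bullet> f' u v\<^sub>2 = 0"
    unfolding e1 e2 by (simp add: inner_add_left inner_add_right inner_diff_right sq t12)
  have mixed: "d\<nu> u v\<^sub>1 \<bullet> f' u v\<^sub>2 = 0"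
  proof -
    have "d\<nu> u v\<^sub>1 \<bullet> f' u v\<^sub>2 = b * (x\<^sup>2 - y\<^sup>2) + (c - a) * (x * y)"
      unfolding e2 v\<^sub>1_def N.add N.scaleR
      by (simp add: inner_add_left inner_add_right inner_diff_right b' a_def[symmetric] b_def[symmetric]
          c_def[symmetric] power2_eq_square algebra_simps)
    then show ?thesis using xy(2) by simp
  qed
  have mixed': "d\<nu> u v\<^sub>2 \<bullet> f' u v\<^sub>1 = 0"
    using mixed shape_operator_symmetric[OF u, of v\<^sub>1 v\<^sub>2] by simp
  have "frame u (- (d\<nu> u v\<^sub>1 \<bullet> f' u v\<^sub>1)) (- (d\<nu> u v\<^sub>2 \<bullet> f' u v\<^sub>2)) v\<^sub>1 v\<^sub>2"
    using tangent_expand[OF u n1 n2 o \<nu>_tangent \<nu>_tangent d\<nu>_tangent[OF u], of v\<^sub>1]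
      tangent_expand[OF u n1 n2 o \<nu>_tangent \<nu>_tangent d\<nu>_tangent[OF u], of v\<^sub>2] mixed mixed' n1 n2 o
    unfolding frame_def by simp
  then show thesis by (rule that)
qed

text \<open>The value chosen in \<^const>\<open>mean_curvature\<close> comes from some unit normal field. It exists because the
  normal of the chart is one, and near \<open>f u\<close> any other one is \<open>\<nu>\<close> or \<open>-\<nu>\<close>, so that it has the principal
  curvatures of \<open>\<nu>\<close> up to a common sign.\<close>

lemma mean_curvature_frame:
  assumes u: "u \<in> D"
  obtains \<kappa>\<^sub>1 \<kappa>\<^sub>2 v\<^sub>1 v\<^sub>2 where "frame u \<kappa>\<^sub>1 \<kappa>\<^sub>2 v\<^sub>1 v\<^sub>2" "\<bar>mean_curvature M (f u)\<bar> = \<bar>\<kappa>\<^sub>1 + \<kappa>\<^sub>2\<bar>"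
proof -
  define P where "P = (\<lambda>h. \<exists>U n \<kappa>\<^sub>1 \<kappa>\<^sub>2. open U \<and> f u \<in> U \<and> unit_normal_field_on M U n \<and>
        principal_curvatures M n (f u) \<kappa>\<^sub>1 \<kappa>\<^sub>2 \<and> h = \<kappa>\<^sub>1 + \<kappa>\<^sub>2)"
  have "\<exists>h. P h"
  proof -
    obtain \<kappa>\<^sub>1 \<kappa>\<^sub>2 v\<^sub>1 v\<^sub>2 where fr: "frame u \<kappa>\<^sub>1 \<kappa>\<^sub>2 v\<^sub>1 v\<^sub>2" using frame_exists[OF u] by blast
    obtain g where g: "homeomorphism D (f ` D) f g" using homeo by blast
    obtain B where B: "bounded_linear B" "\<And>w. B (f' u w) = w" "(g has_derivative B) (at (f u) within M)"
      using inverse_derivative[OF g u] by blast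
    obtain U where U: "open U" "f ` D = M \<inter> U" using openin_image by (auto simp: openin_open)
    have gf: "g (f v) = v" if "v \<in> D" for v using g that by (simp add: homeomorphism_apply1)
    have "unit_normal_field_on M U (\<lambda>y. \<nu> (g y))"
      unfolding unit_normal_field_on_def U(2)[symmetric]
    proof (intro conjI ballI)
      show "continuous_on (f ` D) (\<lambda>y. \<nu> (g y))"
        using g \<nu>_cont by (intro continuous_on_compose2[OF \<nu>_cont]) (auto simp: homeomorphism_def)
      fix y assume "y \<in> f ` D"
      then obtain v where v: "v \<in> D" "y = f v" by blast
      then show "norm (\<nu> (g y)) = 1" using gf norm_\<nu> by simp
      fix x assume "x \<in> tangent_space M y"
      then show "\<nu> (g y) \<bullet> x = 0" using v gf tangent_space_eq by simp
    qed
    moreover have "principal_curvatures M (\<lambda>y. \<nu> (g y)) (f u) \<kappa>\<^sub>1 \<kappa>\<^sub>2"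
      unfolding principal_curvatures_def
    proof (intro exI conjI)
      have "(\<nu> has_derivative d\<nu> u) (at (g (f u)))" using gf[OF u] \<nu>_derivative[OF u] by simp
      from has_derivative_compose[OF B(3) this]
      show "((\<lambda>y. \<nu> (g y)) has_derivative (\<lambda>x. d\<nu> u (B x))) (at (f u) within M)" .
      show "f' u v\<^sub>1 \<in> tangent_space M (f u)" "f' u v\<^sub>2 \<in> tangent_space M (f u)"
        using tangent_space_eq[OF u] \<nu>_tangent by auto
      show "- d\<nu> u (B (f' u v\<^sub>1)) = \<kappa>\<^sub>1 *\<^sub>R f' u v\<^sub>1" "- d\<nu> u (B (f' u v\<^sub>2)) = \<kappa>\<^sub>2 *\<^sub>R f' u v\<^sub>2"
        using fr by (simp_all add: B(2) frame_def)
    qed (use fr in \<open>auto simp: frame_def\<close>)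
    moreover have "f u \<in> U" using u U by blast
    ultimately show ?thesis unfolding P_def using U(1) by blast
  qed
  then have "P (mean_curvature M (f u))"
    unfolding mean_curvature_def P_def[symmetric] by (rule someI_ex)
  then obtain U n \<kappa>\<^sub>1 \<kappa>\<^sub>2 where U: "open U" "f u \<in> U" and n: "unit_normal_field_on M U n"
    and pc: "principal_curvatures M n (f u) \<kappa>\<^sub>1 \<kappa>\<^sub>2" and H: "mean_curvature M (f u) = \<kappa>\<^sub>1 + \<kappa>\<^sub>2"
    unfolding P_def by blast
  obtain L e\<^sub>1 e\<^sub>2 where L: "(n has_derivative L) (at (f u) within M)"
    and e: "e\<^sub>1 \<in> tangent_space M (f u)" "e\<^sub>2 \<in> tangent_space M (f u)" "norm e\<^sub>1 = 1" "norm e\<^sub>2 = 1" "e\<^sub>1 \<bullet> e\<^sub>2 = 0"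
      "- L e\<^sub>1 = \<kappa>\<^sub>1 *\<^sub>R e\<^sub>1" "- L e\<^sub>2 = \<kappa>\<^sub>2 *\<^sub>R e\<^sub>2"
    using pc unfolding principal_curvatures_def by blast
  obtain v\<^sub>1 where v1: "e\<^sub>1 = f' u v\<^sub>1" using e(1) tangent_plane_image[OF u] tangent_space_eq[OF u] by blast
  obtain v\<^sub>2 where v2: "e\<^sub>2 = f' u v\<^sub>2" using e(2) tangent_plane_image[OF u] tangent_space_eq[OF u] by blast
  \<comment> \<open>Two continuous unit normal fields agree up to a locally constant sign.\<close>
  define s where "s = (\<lambda>v. n (f v) \<bullet> \<nu> v)"
  define E where "E = {v\<in>D. f v \<in> U}"
  have E: "open E" "u \<in> E" "E \<subseteq> D"
  proof -
    have "E = D \<inter> f -` U" by (auto simp: E_def)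
    then show "open E" using continuous_open_preimage[OF f_cont open_D U(1)] by simp
  qed (use u U in \<open>auto simp: E_def\<close>)
  have nf: "n (f v) = s v *\<^sub>R \<nu> v \<and> \<bar>s v\<bar> = 1" if "v \<in> E" for v
  proof -
    have v: "v \<in> D" "f v \<in> M \<inter> U" using that image_in by (auto simp: E_def)
    then have n1: "norm (n (f v)) = 1" and n2: "\<And>x. \<nu> v \<bullet> x = 0 \<Longrightarrow> n (f v) \<bullet> x = 0"
      using n tangent_space_eq[OF v(1)] by (auto simp: unit_normal_field_on_def)
    define x where "x = n (f v) - s v *\<^sub>R \<nu> v"
    have x0: "\<nu> v \<bullet> x = 0" using norm_\<nu>[OF v(1)]
      by (simp add: x_def s_def inner_diff_right norm_eq_1 inner_commute)
    have "x \<bullet> x = n (f v) \<bullet> x - s v * (\<nu> v \<bullet> x)" by (simp add: x_def inner_diff_left)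
    then have "x = 0" using x0 n2[OF x0] by simp
    then have eq: "n (f v) = s v *\<^sub>R \<nu> v" by (simp add: x_def)
    have "norm (n (f v)) = \<bar>s v\<bar> * norm (\<nu> v)" by (subst eq) simp
    then have "\<bar>s v\<bar> = 1" using norm_\<nu>[OF v(1)] n1 by simp
    with eq show ?thesis ..
  qed
  have "continuous_on E s"
    unfolding s_def using n E
    by (intro continuous_on_inner continuous_on_subset[OF \<nu>_cont]
        continuous_on_compose2[of "M \<inter> U" n E f] continuous_on_subset[OF f_cont])
      (auto simp: unit_normal_field_on_def E_def image_in)
  then have "isCont s u" using E by (simp add: continuous_on_eq_continuous_at)
  then obtain d1 where d1: "d1 > 0" "\<And>v. dist v u < d1 \<Longrightarrow> dist (s v) (s u) < 1"
    unfolding continuous_at_eps_delta by (metis zero_less_one)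
  obtain d2 where d2: "d2 > 0" "ball u d2 \<subseteq> E" using E open_contains_ball by blast
  have "s v = s u" if "dist v u < min d1 d2" for v
  proof -
    have "v \<in> E" using d2 that by (auto simp: dist_commute)
    then have "\<bar>s v\<bar> = 1" "\<bar>s u\<bar> = 1" "\<bar>s v - s u\<bar> < 1"
      using nf E d1(2)[of v] that by (auto simp: dist_real_def)
    then show ?thesis by linarith
  qed
  then have nu: "n (f v) = s u *\<^sub>R \<nu> v" if "dist v u < min d1 d2" for v
    using nf d2 that by (metis dist_commute mem_ball min_less_iff_conj subsetD)
  have su: "\<bar>s u\<bar> = 1" using nf E by blast
  have "(n has_derivative L) (at (f u) within f ` D)"
    using L openin_image openin_subset by (intro has_derivative_subset[OF L]) fastforce
  from has_derivative_in_compose[OF has_derivative_at_withinI[OF f[OF u]] this]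
  have "((\<lambda>v. n (f v)) has_derivative (\<lambda>w. L (f' u w))) (at u within D)" .
  then have 1: "((\<lambda>v. n (f v)) has_derivative (\<lambda>w. L (f' u w))) (at u)"
    unfolding at_within_open[OF u open_D] .
  have "((\<lambda>v. s u *\<^sub>R \<nu> v) has_derivative (\<lambda>w. s u *\<^sub>R d\<nu> u w)) (at u)"
    by (rule has_derivative_scaleR_right[OF \<nu>_derivative[OF u]])
  then have 2: "((\<lambda>v. n (f v)) has_derivative (\<lambda>w. s u *\<^sub>R d\<nu> u w)) (at u)"
    by (rule has_derivative_transform_within[of _ _ _ _ "min d1 d2"]) (use d1 d2 nu in auto)
  have Leq: "L (f' u w) = s u *\<^sub>R d\<nu> u w" for w
    using fun_cong[OF has_derivative_unique[OF 1 2], of w] by simp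
  have ss: "s u * s u = 1" using su by (metis abs_mult_self_eq mult_1)
  have dn: "d\<nu> u w = s u *\<^sub>R L (f' u w)" for w
    by (simp add: Leq ss)
  have "L e\<^sub>1 = - (\<kappa>\<^sub>1 *\<^sub>R e\<^sub>1)" "L e\<^sub>2 = - (\<kappa>\<^sub>2 *\<^sub>R e\<^sub>2)" using e(6,7) by (metis minus_minus)+
  then have "frame u (s u * \<kappa>\<^sub>1) (s u * \<kappa>\<^sub>2) v\<^sub>1 v\<^sub>2"
    using e unfolding frame_def v1 v2 dn by simp
  moreover have "\<bar>mean_curvature M (f u)\<bar> = \<bar>s u * \<kappa>\<^sub>1 + s u * \<kappa>\<^sub>2\<bar>"
    using su by (simp add: H distrib_left[symmetric] abs_mult)
  ultimately show thesis by (rule that)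
qed

text \<open>The first and second fundamental form, and the classical expression of the mean curvature by
  them. As its coefficients are continuous, it shows that the squared mean curvature is continuous on
  the surface, hence measurable.\<close>

definition metric :: "real^2 \<Rightarrow> 2 \<Rightarrow> 2 \<Rightarrow> real" where
  "metric u i j = f' u (axis i 1) \<bullet> f' u (axis j 1)"

definition second_form :: "real^2 \<Rightarrow> 2 \<Rightarrow> 2 \<Rightarrow> real" where
  "second_form u i j = - (d\<nu> u (axis i 1) \<bullet> f' u (axis j 1))"

definition mean_curv :: "real^2 \<Rightarrow> real" where
  "mean_curv u = (metric u 2 2 * second_form u 1 1 - 2 * metric u 1 2 * second_form u 1 2
     + metric u 1 1 * second_form u 2 2) / (metric u 1 1 * metric u 2 2 - metric u 1 2 * metric u 1 2)"

lemma metric_det: "metric u 1 1 * metric u 2 2 - metric u 1 2 * metric u 1 2 = (norm (nrm u))\<^sup>2"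
  using norm_cross_dot[of "f' u (axis 1 1)" "f' u (axis 2 1)"]
  by (simp add: metric_def nrm_def power_mult_distrib power2_norm_eq_inner) (simp add: power2_eq_square)

lemma frame_mean_curv:
  assumes u: "u \<in> D" and fr: "frame u \<kappa>\<^sub>1 \<kappa>\<^sub>2 v\<^sub>1 v\<^sub>2"
  shows "\<kappa>\<^sub>1 + \<kappa>\<^sub>2 = mean_curv u"
proof -
  interpret N: bounded_linear "d\<nu> u" by (rule d\<nu>_linear[OF u])
  have N_decomp: "d\<nu> u w = (w $ 1) *\<^sub>R d\<nu> u (axis 1 1) + (w $ 2) *\<^sub>R d\<nu> u (axis 2 1)" for w
    by (subst plane_decomp[of w]) (simp only: N.add N.scaleR)
  have sym: "second_form u 2 1 = second_form u 1 2"
    unfolding second_form_def by (simp add: shape_operator_symmetric[OF u])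
  have m: "metric u 2 1 = metric u 1 2" by (simp add: metric_def inner_commute)
  have gg: "f' u v \<bullet> f' u w = v $ 1 * w $ 1 * metric u 1 1 + (v $ 1 * w $ 2 + v $ 2 * w $ 1) * metric u 1 2 + v $ 2 * w $ 2 * metric u 2 2"
    for v w
    unfolding f'_decomp[of u v] f'_decomp[of u w]
    using m by (simp add: inner_add_left inner_add_right metric_def algebra_simps)
  have hh: "- (d\<nu> u v \<bullet> f' u v) = v $ 1 * v $ 1 * second_form u 1 1 + 2 * v $ 1 * v $ 2 * second_form u 1 2 + v $ 2 * v $ 2 * second_form u 2 2"
    for v
    unfolding f'_decomp[of u v] N_decomp[of v]
    using sym by (simp add: inner_add_left inner_add_right second_form_def algebra_simps)
  have k: "\<kappa>\<^sub>1 = - (d\<nu> u v\<^sub>1 \<bullet> f' u v\<^sub>1)" "\<kappa>\<^sub>2 = - (d\<nu> u v\<^sub>2 \<bullet> f' u v\<^sub>2)"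
    using fr by (simp_all add: frame_def norm_eq_1)
  define p q r s a11 a12 a22 where
    "p = v\<^sub>1$1" "q = v\<^sub>1$2" "r = v\<^sub>2$1" "s = v\<^sub>2$2"
    "a11 = metric u 1 1" "a12 = metric u 1 2" "a22 = metric u 2 2"
  note defs = this
  have 1: "p*p*a11 + 2*p*q*a12 + q*q*a22 = 1"
    and 2: "r*r*a11 + 2*r * s * a12 + (s * s)*a22 = 1"
    and 3: "p*r*a11 + (p * s+q*r)*a12 + q * s * a22 = 0"
    using fr gg[of v\<^sub>1 v\<^sub>1] gg[of v\<^sub>2 v\<^sub>2] gg[of v\<^sub>1 v\<^sub>2]
    by (simp_all add: frame_def norm_eq_1 defs algebra_simps)
  note inv = orthonormal_frame_inverse_metric[OF 1 2 3]
  define d where "d = a11*a22 - a12*a12"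
  have d: "d \<noteq> 0" using metric_det[of u] nrm_nonzero[OF u] by (simp add: d_def defs)
  have "(\<kappa>\<^sub>1 + \<kappa>\<^sub>2) * d = ((p*p + r*r)*d) * second_form u 1 1 + 2*((p*q + r * s)*d) * second_form u 1 2
      + ((q*q + s * s)*d) * second_form u 2 2"
    unfolding k hh by (simp add: defs algebra_simps)
  also have "\<dots> = a22 * second_form u 1 1 - 2 * a12 * second_form u 1 2 + a11 * second_form u 2 2"
    unfolding d_def inv by simp
  finally show ?thesis
    unfolding mean_curv_def using d by (simp add: d_def defs field_simps)
qed

lemma mean_curvature_sq: "u \<in> D \<Longrightarrow> (mean_curvature M (f u))\<^sup>2 = (mean_curv u)\<^sup>2"
  using mean_curvature_frame frame_mean_curv by (metis power2_abs)

lemma mean_curv_cont: "continuous_on D mean_curv"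
proof -
  have 1: "continuous_on D (\<lambda>u. metric u i j)" "continuous_on D (\<lambda>u. second_form u i j)" for i j
    unfolding metric_def second_form_def
    by (intro continuous_on_inner continuous_on_minus f'_apply_cont d\<nu>_cont)+
  show ?thesis
    unfolding mean_curv_def using nrm_nonzero
    by (intro continuous_on_divide continuous_on_add continuous_on_diff continuous_on_mult
        continuous_on_const 1) (simp add: metric_det)
qed

end

section \<open>Nearest points on a surface\<close>

context surface_chart
begin

text \<open>First and second order conditions for the minimum at \<open>0\<close> of the squared distance from \<open>\<xi>\<close> to
  \<open>f (u + t w)\<close>.\<close>

lemma nearest_point_second_order:
  assumes u: "u \<in> D" and min: "\<And>y. y \<in> M \<Longrightarrow> dist \<xi> (f u) \<le> dist \<xi> y"
  shows "(f u - \<xi>) \<bullet> f' u w = 0" and "0 \<le> f' u w \<bullet> f' u w + (f u - \<xi>) \<bullet> f'' u w w"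
proof -
  define \<phi> where "\<phi> = (\<lambda>t::real. (f (u + t *\<^sub>R w) - \<xi>) \<bullet> (f (u + t *\<^sub>R w) - \<xi>))"
  define \<psi> where "\<psi> = (\<lambda>t::real. (f (u + t *\<^sub>R w) - \<xi>) \<bullet> f' (u + t *\<^sub>R w) w)"
  define m where "m = f' u w \<bullet> f' u w + (f u - \<xi>) \<bullet> f'' u w w"
  have "open ((\<lambda>t::real. u + t *\<^sub>R w) -` D)"
    by (intro continuous_open_vimage open_D continuous_intros)
  moreover have "0 \<in> (\<lambda>t::real. u + t *\<^sub>R w) -` D" using u by simp
  ultimately obtain d where d: "d > 0" "ball 0 d \<subseteq> (\<lambda>t::real. u + t *\<^sub>R w) -` D"
    using open_contains_ball by blast
  have inD: "u + t *\<^sub>R w \<in> D" if "\<bar>t\<bar> < d" for t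
    using d that by (auto simp: dist_norm subset_iff)
  have line: "((\<lambda>t. u + t *\<^sub>R w) has_derivative (\<lambda>t. t *\<^sub>R w)) (at t)" for t :: real
    by (auto intro!: derivative_eq_intros)
  have df: "((\<lambda>t. f (u + t *\<^sub>R w) - \<xi>) has_derivative (\<lambda>x. f' (u + t *\<^sub>R w) (x *\<^sub>R w))) (at t)"
    if "\<bar>t\<bar> < d" for t
    using has_derivative_diff[OF has_derivative_compose[OF line f[OF inD[OF that]]] has_derivative_const[of \<xi>]]
    by simp
  have d\<phi>: "(\<phi> has_field_derivative 2 * \<psi> t) (at t)" if "\<bar>t\<bar> < d" for t
    unfolding has_field_derivative_def \<phi>_def \<psi>_def
    using has_derivative_inner[OF df[OF that] df[OF that]]
    by (rule has_derivative_eq_rhs) (auto simp: blinfun.scaleR_right inner_commute algebra_simps)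
  have d\<psi>: "(\<psi> has_field_derivative m) (at 0)"
  proof -
    have 0: "\<bar>0\<bar> < d" using d by simp
    have "(f' has_derivative f'' u) (at (u + 0 *\<^sub>R w))" using f'[OF u] by simp
    from bounded_linear.has_derivative[OF blinfun.bounded_linear_left has_derivative_compose[OF line this], of w]
    have "((\<lambda>t. f' (u + t *\<^sub>R w) w) has_derivative (\<lambda>t. f'' u (t *\<^sub>R w) w)) (at 0)" .
    from has_derivative_inner[OF df[OF 0] this]
    show ?thesis
      unfolding has_field_derivative_def \<psi>_def m_def
      by (rule has_derivative_eq_rhs)
        (auto simp: blinfun.bilinear_simps inner_commute algebra_simps fun_eq_iff)
  qed
  have \<phi>min: "\<phi> 0 \<le> \<phi> t" if "\<bar>t\<bar> < d" for t
  proof -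
    have "norm (f u - \<xi>) \<le> norm (f (u + t *\<^sub>R w) - \<xi>)"
      using min[OF image_in[OF inD[OF that]]] by (simp add: dist_norm norm_minus_commute)
    then show ?thesis by (simp add: \<phi>_def norm_le)
  qed
  have "2 * \<psi> 0 = 0"
    using DERIV_local_min[OF d\<phi>[of 0] d(1)] \<phi>min d by simp
  then have \<psi>0: "\<psi> 0 = 0" by simp
  then show "(f u - \<xi>) \<bullet> f' u w = 0" by (simp add: \<psi>_def)
  have "0 \<le> m"
  proof (rule ccontr)
    assume "\<not> 0 \<le> m"
    then obtain e where e: "e > 0" "\<And>h. h > 0 \<Longrightarrow> h < e \<Longrightarrow> \<psi> (0 + h) < \<psi> 0"
      using DERIV_neg_dec_right[OF d\<psi>] by auto
    define h where "h = min d e / 2"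
    have h: "0 < h" "h < d" "h < e" using d e by (auto simp: h_def)
    obtain z where z: "0 < z" "z < h" "\<phi> h - \<phi> 0 = (h - 0) * (2 * \<psi> z)"
      using MVT2[of 0 h \<phi> "\<lambda>t. 2 * \<psi> t"] d\<phi> h by auto
    have "\<psi> z < 0" using e(2)[of z] z h \<psi>0 by simp
    then have "(h - 0) * (2 * \<psi> z) < 0" using h by (intro mult_pos_neg) auto
    then have "\<phi> h < \<phi> 0" using z(3) by linarith
    then show False using \<phi>min[of h] h by simp
  qed
  then show "0 \<le> f' u w \<bullet> f' u w + (f u - \<xi>) \<bullet> f'' u w w" by (simp add: m_def)
qed

text \<open>At a nearest point \<open>y\<close> the ball around \<open>\<xi>\<close> touches the surface from one side, so that
  \<open>1 - z \<kappa>\<^sub>i \<ge> 0\<close> for both principal curvatures. Hence each of the two eigenvalues of the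
  derivative of \<open>y \<mapsto> y + z \<nu> y\<close> is at most their sum \<open>2 - z (\<kappa>\<^sub>1 + \<kappa>\<^sub>2)\<close>: the mean curvature alone
  controls this derivative, although it does not control the two principal curvatures.\<close>

lemma nearest_point_normal:
  assumes u: "u \<in> D" and min: "\<And>y. y \<in> M \<Longrightarrow> dist \<xi> (f u) \<le> dist \<xi> y"
  obtains z where "\<xi> = f u + z *\<^sub>R \<nu> u" "\<bar>z\<bar> = dist \<xi> (f u)"
    "\<And>w. norm (f' u w + z *\<^sub>R d\<nu> u w) \<le> (2 + \<bar>z\<bar> * \<bar>mean_curv u\<bar>) * norm (f' u w)"
proof -
  interpret N: bounded_linear "d\<nu> u" by (rule d\<nu>_linear[OF u])
  define z where "z = (\<xi> - f u) \<bullet> \<nu> u"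
  define x where "x = \<xi> - f u - z *\<^sub>R \<nu> u"
  have \<nu>1: "\<nu> u \<bullet> \<nu> u = 1" using norm_\<nu>[OF u] by (simp add: norm_eq_1)
  have "\<nu> u \<bullet> x = 0" by (simp add: x_def z_def inner_diff_right \<nu>1 inner_commute)
  then obtain w where w: "x = f' u w" using tangent_plane_image[OF u] by blast
  have "(f u - \<xi>) \<bullet> x = 0" unfolding w by (rule nearest_point_second_order(1)[OF u min])
  then have "x \<bullet> x = 0" using \<open>\<nu> u \<bullet> x = 0\<close>
    by (subst (1) x_def) (simp add: inner_diff_left)
  then have "\<xi> - f u - z *\<^sub>R \<nu> u = 0" by (simp add: x_def)
  then have \<xi>: "\<xi> = f u + z *\<^sub>R \<nu> u" by (metis add.commute diff_add_cancel eq_iff_diff_eq_0)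
  have psd: "0 \<le> f' u w \<bullet> f' u w + z * (d\<nu> u w \<bullet> f' u w)" for w
    using nearest_point_second_order(2)[OF u min, of w] by (simp add: \<xi> d\<nu>_second_derivative[OF u])
  obtain \<kappa>\<^sub>1 \<kappa>\<^sub>2 v\<^sub>1 v\<^sub>2 where fr: "frame u \<kappa>\<^sub>1 \<kappa>\<^sub>2 v\<^sub>1 v\<^sub>2" using frame_exists[OF u] by blast
  define e\<^sub>1 e\<^sub>2 where "e\<^sub>1 = f' u v\<^sub>1" "e\<^sub>2 = f' u v\<^sub>2"
  have e: "norm e\<^sub>1 = 1" "norm e\<^sub>2 = 1" "e\<^sub>1 \<bullet> e\<^sub>2 = 0" "\<nu> u \<bullet> e\<^sub>1 = 0" "\<nu> u \<bullet> e\<^sub>2 = 0"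
    and dn: "d\<nu> u v\<^sub>1 = - (\<kappa>\<^sub>1 *\<^sub>R e\<^sub>1)" "d\<nu> u v\<^sub>2 = - (\<kappa>\<^sub>2 *\<^sub>R e\<^sub>2)"
    using fr \<nu>_tangent by (simp_all add: frame_def e\<^sub>1_e\<^sub>2_def)
  have ee: "e\<^sub>1 \<bullet> e\<^sub>1 = 1" "e\<^sub>2 \<bullet> e\<^sub>2 = 1" "e\<^sub>2 \<bullet> e\<^sub>1 = 0" using e by (simp_all add: norm_eq_1 inner_commute)
  define q\<^sub>1 q\<^sub>2 where "q\<^sub>1 = 1 - z * \<kappa>\<^sub>1" "q\<^sub>2 = 1 - z * \<kappa>\<^sub>2"
  have q: "0 \<le> q\<^sub>1" "0 \<le> q\<^sub>2"
    using psd[of v\<^sub>1] psd[of v\<^sub>2] by (simp_all add: dn e\<^sub>1_e\<^sub>2_def[symmetric] ee q\<^sub>1_q\<^sub>2_def)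
  have sumq: "q\<^sub>1 + q\<^sub>2 \<le> 2 + \<bar>z\<bar> * \<bar>mean_curv u\<bar>"
  proof -
    have "q\<^sub>1 + q\<^sub>2 = 2 - z * mean_curv u"
      unfolding frame_mean_curv[OF u fr, symmetric] by (simp add: q\<^sub>1_q\<^sub>2_def algebra_simps)
    also have "\<dots> \<le> 2 + \<bar>z * mean_curv u\<bar>" by linarith
    finally show ?thesis by (simp add: abs_mult)
  qed
  show thesis
  proof (rule that[OF \<xi>])
    show "\<bar>z\<bar> = dist \<xi> (f u)" using norm_\<nu>[OF u] by (simp add: \<xi> dist_norm)
    fix w
    define \<alpha> \<beta> where "\<alpha> = f' u w \<bullet> e\<^sub>1" "\<beta> = f' u w \<bullet> e\<^sub>2"
    have fw: "f' u w = \<alpha> *\<^sub>R e\<^sub>1 + \<beta> *\<^sub>R e\<^sub>2"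
      unfolding \<alpha>_\<beta>_def by (rule tangent_expand[OF u e \<nu>_tangent])
    then have "f' u w = f' u (\<alpha> *\<^sub>R v\<^sub>1 + \<beta> *\<^sub>R v\<^sub>2)"
      by (simp add: e\<^sub>1_e\<^sub>2_def blinfun.bilinear_simps)
    then have w: "w = \<alpha> *\<^sub>R v\<^sub>1 + \<beta> *\<^sub>R v\<^sub>2" using inj[OF u] by (metis injD)
    have nw: "d\<nu> u w = - (\<alpha> * \<kappa>\<^sub>1) *\<^sub>R e\<^sub>1 - (\<beta> * \<kappa>\<^sub>2) *\<^sub>R e\<^sub>2"
      by (subst w) (simp add: N.add N.scaleR dn)
    have sum: "f' u w + z *\<^sub>R d\<nu> u w = (\<alpha> * q\<^sub>1) *\<^sub>R e\<^sub>1 + (\<beta> * q\<^sub>2) *\<^sub>R e\<^sub>2"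
      unfolding fw nw by (simp add: q\<^sub>1_q\<^sub>2_def algebra_simps)
    have nrm2: "(norm (a *\<^sub>R e\<^sub>1 + b *\<^sub>R e\<^sub>2))\<^sup>2 = a\<^sup>2 + b\<^sup>2" for a b
      unfolding power2_norm_eq_inner
      by (simp add: inner_add_left inner_add_right ee e power2_eq_square)
    have "(norm (f' u w + z *\<^sub>R d\<nu> u w))\<^sup>2 = (\<alpha> * q\<^sub>1)\<^sup>2 + (\<beta> * q\<^sub>2)\<^sup>2" unfolding sum nrm2 ..
    also have "\<dots> \<le> \<alpha>\<^sup>2 * (q\<^sub>1 + q\<^sub>2)\<^sup>2 + \<beta>\<^sup>2 * (q\<^sub>1 + q\<^sub>2)\<^sup>2"
      using q unfolding power_mult_distrib by (intro add_mono mult_left_mono power_mono) auto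
    also have "\<dots> = (q\<^sub>1 + q\<^sub>2)\<^sup>2 * (\<alpha>\<^sup>2 + \<beta>\<^sup>2)" by (simp only: distrib_left mult.commute)
    also have "\<dots> = ((q\<^sub>1 + q\<^sub>2) * norm (f' u w))\<^sup>2"
      unfolding power_mult_distrib fw nrm2 ..
    finally have "norm (f' u w + z *\<^sub>R d\<nu> u w) \<le> (q\<^sub>1 + q\<^sub>2) * norm (f' u w)"
      by (rule power2_le_imp_le) (use q in simp)
    also have "\<dots> \<le> (2 + \<bar>z\<bar> * \<bar>mean_curv u\<bar>) * norm (f' u w)"
      using sumq by (intro mult_right_mono) auto
    finally show "norm (f' u w + z *\<^sub>R d\<nu> u w) \<le> (2 + \<bar>z\<bar> * \<bar>mean_curv u\<bar>) * norm (f' u w)" .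
  qed
qed

end

text \<open>The infinitesimal estimate, integrated over a small piece of the surface. Here \<open>n\<close> is the unit normal
  of a chart, \<open>\<xi> = y + z n y\<close> for some \<open>z\<close> with \<open>\<bar>z\<bar> \<le> R\<close>, and this is compared with \<open>y' + z n y'\<close>. Only \<open>y\<close>
  has to be a nearest point, so that a whole piece can be compared with one of its points \<open>y'\<close>.\<close>

lemma nearest_point_lipschitz:
  assumes M: "embedded_C2_surface M" and p: "p \<in> M" and R: "R > 0"
  obtains \<delta> L n where "\<delta> > 0" "L > 0" "\<And>y. y \<in> M \<Longrightarrow> dist y p < \<delta> \<Longrightarrow> norm (n y) = 1"
    "\<And>y. y \<in> M \<Longrightarrow> dist y p < \<delta> \<Longrightarrow> L \<le> 5 + R * \<bar>mean_curvature M y\<bar>"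
    "\<And>y y' \<xi>. y \<in> M \<Longrightarrow> dist y p < \<delta> \<Longrightarrow> y' \<in> M \<Longrightarrow> dist y' p < \<delta> \<Longrightarrow>
       (\<And>x. x \<in> M \<Longrightarrow> dist \<xi> y \<le> dist \<xi> x) \<Longrightarrow> dist \<xi> y \<le> R \<Longrightarrow>
       \<exists>z. \<bar>z\<bar> \<le> R \<and> dist \<xi> (y' + z *\<^sub>R n y') \<le> L * dist y y'"
proof -
  obtain D f where "local_parametrization M D f" "p \<in> f ` D"
    using M p unfolding embedded_C2_surface_def by blast
  then obtain f' f'' u\<^sub>0 where "surface_chart M D f f' f''" and u0: "u\<^sub>0 \<in> D" "p = f u\<^sub>0"
    using local_parametrization_chart by blast
  then interpret surface_chart M D f f' f'' by blast
  obtain g where g: "homeomorphism D (f ` D) f g" using homeo by blast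
  have gf: "g (f v) = v" if "v \<in> D" for v using g that by (simp add: homeomorphism_apply1)
  define h where "h = \<bar>mean_curv u\<^sub>0\<bar>"
  define K where "K = 3 + R * h"
  have K: "K > 0" using R by (simp add: K_def h_def add_pos_nonneg)
  obtain C d1 where C: "C > 0" "d1 > 0" "ball u\<^sub>0 d1 \<subseteq> D"
    "\<And>v w. v \<in> ball u\<^sub>0 d1 \<Longrightarrow> w \<in> ball u\<^sub>0 d1 \<Longrightarrow> norm (v - w) \<le> C * norm (f v - f w)"
    using lower_lipschitz[OF u0(1)] by blast
  \<comment> \<open>\<open>K\<close> bounds the derivative of \<open>y \<mapsto> y + z n y\<close> at nearest points; \<open>\<eta>\<close> makes all errors of
    linearization sum up to at most the distance of the two points.\<close>
  define \<eta> where "\<eta> = 1 / (2 * C * (K + 1 + R))"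
  have \<eta>: "\<eta> > 0" using C K R by (simp add: \<eta>_def)
  obtain d2 where d2: "d2 > 0" "ball u\<^sub>0 d2 \<subseteq> D"
    "\<And>u w. u \<in> ball u\<^sub>0 d2 \<Longrightarrow> norm (f' u w - f' u\<^sub>0 w) \<le> \<eta> * norm w"
    "\<And>u v. u \<in> ball u\<^sub>0 d2 \<Longrightarrow> v \<in> ball u\<^sub>0 d2 \<Longrightarrow> norm (f v - f u - f' u\<^sub>0 (v - u)) \<le> \<eta> * norm (v - u)"
    using C1_strict_derivative[OF open_D u0(1) \<eta> f f'_apply_cont] by metis
  obtain d3 where d3: "d3 > 0" "ball u\<^sub>0 d3 \<subseteq> D"
    "\<And>u w. u \<in> ball u\<^sub>0 d3 \<Longrightarrow> norm (d\<nu> u w - d\<nu> u\<^sub>0 w) \<le> \<eta> * norm w"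
    "\<And>u v. u \<in> ball u\<^sub>0 d3 \<Longrightarrow> v \<in> ball u\<^sub>0 d3 \<Longrightarrow> norm (\<nu> v - \<nu> u - d\<nu> u\<^sub>0 (v - u)) \<le> \<eta> * norm (v - u)"
    using C1_strict_derivative[OF open_D u0(1) \<eta> \<nu>_derivative d\<nu>_cont] by metis
  have "isCont mean_curv u\<^sub>0" using mean_curv_cont u0 open_D by (simp add: continuous_on_eq_continuous_at)
  moreover have "1 / R > 0" using R by simp
  ultimately obtain d4 where d4: "d4 > 0" "\<And>v. dist v u\<^sub>0 < d4 \<Longrightarrow> dist (mean_curv v) (mean_curv u\<^sub>0) < 1 / R"
    unfolding continuous_at_eps_delta by blast
  define d where "d = min (min d1 d2) (min d3 d4)"
  have d: "d > 0" using C d2 d3 d4 by (simp add: d_def)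
  obtain \<delta> where \<delta>: "\<delta> > 0"
    "\<And>y. y \<in> M \<Longrightarrow> dist y (f u\<^sub>0) < \<delta> \<Longrightarrow> \<exists>v\<in>D. dist v u\<^sub>0 < d \<and> y = f v"
    using image_neighbourhood[OF u0(1) d] by blast
  have curv: "R * \<bar>mean_curv v\<bar> \<le> R * h + 1" "R * h \<le> R * \<bar>mean_curv v\<bar> + 1" if "dist v u\<^sub>0 < d" for v
  proof -
    have "\<bar>mean_curv v - mean_curv u\<^sub>0\<bar> < 1 / R" using d4(2)[of v] that by (simp add: d_def dist_real_def)
    then have "R * \<bar>mean_curv v - mean_curv u\<^sub>0\<bar> \<le> 1" using R by (simp add: field_simps)
    moreover have "\<bar>\<bar>mean_curv v\<bar> - h\<bar> \<le> \<bar>mean_curv v - mean_curv u\<^sub>0\<bar>"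
      unfolding h_def by (rule abs_triangle_ineq3)
    from mult_left_mono[OF this, of R]
    have "R * \<bar>\<bar>mean_curv v\<bar> - h\<bar> \<le> R * \<bar>mean_curv v - mean_curv u\<^sub>0\<bar>" using R by simp
    ultimately have "R * \<bar>\<bar>mean_curv v\<bar> - h\<bar> \<le> 1" by linarith
    then have "\<bar>R * (\<bar>mean_curv v\<bar> - h)\<bar> \<le> 1" using R by (simp add: abs_mult)
    then show "R * \<bar>mean_curv v\<bar> \<le> R * h + 1" "R * h \<le> R * \<bar>mean_curv v\<bar> + 1"
      by (simp_all add: algebra_simps)
  qed
  show thesis
  proof (rule that[of \<delta> "K + 1" "\<lambda>y. \<nu> (g y)"])
    show "K + 1 > 0" using K by simp
    fix y assume "y \<in> M" "dist y p < \<delta>"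
    then obtain v where v: "v \<in> D" "dist v u\<^sub>0 < d" "y = f v" using \<delta>(2)[of y] u0 by blast
    then show "norm (\<nu> (g y)) = 1" by (simp add: gf norm_\<nu>)
    have "\<bar>mean_curvature M y\<bar> = \<bar>mean_curv v\<bar>"
      using mean_curvature_sq[OF v(1)] v(3) by (simp add: power2_eq_iff abs_eq_iff)
    then show "K + 1 \<le> 5 + R * \<bar>mean_curvature M y\<bar>" using curv(2)[OF v(2)] by (simp add: K_def)
  next
    fix y y' \<xi>
    assume y: "y \<in> M" "dist y p < \<delta>" and y': "y' \<in> M" "dist y' p < \<delta>"
      and near: "\<And>x. x \<in> M \<Longrightarrow> dist \<xi> y \<le> dist \<xi> x" and le: "dist \<xi> y \<le> R"
    obtain u where u: "u \<in> D" "dist u u\<^sub>0 < d" "y = f u" using \<delta>(2)[of y] u0 y by blast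
    obtain v where v: "v \<in> D" "dist v u\<^sub>0 < d" "y' = f v" using \<delta>(2)[of y'] u0 y' by blast
    have ub: "u \<in> ball u\<^sub>0 d1" "u \<in> ball u\<^sub>0 d2" "u \<in> ball u\<^sub>0 d3"
      and vb: "v \<in> ball u\<^sub>0 d1" "v \<in> ball u\<^sub>0 d2" "v \<in> ball u\<^sub>0 d3"
      using u v by (auto simp: d_def dist_commute)
    have near': "\<And>x. x \<in> M \<Longrightarrow> dist \<xi> (f u) \<le> dist \<xi> x" using near u(3) by simp
    obtain z where z: "\<xi> = f u + z *\<^sub>R \<nu> u" "\<bar>z\<bar> = dist \<xi> (f u)"
      "\<And>w. norm (f' u w + z *\<^sub>R d\<nu> u w) \<le> (2 + \<bar>z\<bar> * \<bar>mean_curv u\<bar>) * norm (f' u w)"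
      using nearest_point_normal[OF u(1) near'] by blast
    have zR: "\<bar>z\<bar> \<le> R" using z(2) le u(3) by simp
    define w where "w = v - u"
    have wC: "norm w \<le> C * dist y y'"
      using C(4)[OF ub(1) vb(1)] by (simp add: w_def u v dist_norm norm_minus_commute)
    have strict: "norm (G v - G u - G' u w) \<le> 2 * \<eta> * norm w"
      if "norm (G v - G u - G' u\<^sub>0 w) \<le> \<eta> * norm w" "norm (G' u w - G' u\<^sub>0 w) \<le> \<eta> * norm w"
      for G :: "real^2 \<Rightarrow> real^3" and G'
    proof -
      have "norm (G v - G u - G' u w) = norm ((G v - G u - G' u\<^sub>0 w) - (G' u w - G' u\<^sub>0 w))"
        by (intro arg_cong[where f = norm]) simp
      also have "\<dots> \<le> \<eta> * norm w + \<eta> * norm w"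
        by (rule order_trans[OF norm_triangle_ineq4 add_mono[OF that]])
      finally show ?thesis by simp
    qed
    have sf: "norm (f v - f u - f' u w) \<le> 2 * \<eta> * norm w"
      using strict[of f "\<lambda>u. blinfun_apply (f' u)"] d2(3)[OF ub(2), of w] d2(4)[OF ub(2) vb(2)] by (simp add: w_def)
    have s\<nu>: "norm (\<nu> v - \<nu> u - d\<nu> u w) \<le> 2 * \<eta> * norm w"
      using strict[of \<nu> d\<nu>] d3(3)[OF ub(3), of w] d3(4)[OF ub(3) vb(3)] by (simp add: w_def)
    have "\<bar>z\<bar> * \<bar>mean_curv u\<bar> \<le> R * \<bar>mean_curv u\<bar>" using zR by (intro mult_right_mono) auto
    then have K1: "2 + \<bar>z\<bar> * \<bar>mean_curv u\<bar> \<le> K" using curv(1)[OF u(2)] by (simp add: K_def)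
    have fw: "norm (f' u w) \<le> dist y y' + 2 * \<eta> * norm w"
      using sf norm_triangle_ineq4[of "f v - f u" "f v - f u - f' u w"]
      by (simp add: u v dist_norm norm_minus_commute)
    have "dist \<xi> (y' + z *\<^sub>R \<nu> v)
        = norm ((f' u w + z *\<^sub>R d\<nu> u w) + ((f v - f u - f' u w) + z *\<^sub>R (\<nu> v - \<nu> u - d\<nu> u w)))"
      by (simp add: z(1) v dist_norm norm_minus_commute algebra_simps)
    also have "\<dots> \<le> norm (f' u w + z *\<^sub>R d\<nu> u w)
        + (norm (f v - f u - f' u w) + norm (z *\<^sub>R (\<nu> v - \<nu> u - d\<nu> u w)))"
      by (intro order_trans[OF norm_triangle_ineq] add_left_mono norm_triangle_ineq)
    also have "\<dots> \<le> K * norm (f' u w) + (2 * \<eta> * norm w + R * (2 * \<eta> * norm w))"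
    proof (intro add_mono)
      show "norm (f' u w + z *\<^sub>R d\<nu> u w) \<le> K * norm (f' u w)"
        using z(3)[of w] K1 by (meson mult_right_mono norm_ge_zero order_trans)
      show "norm (z *\<^sub>R (\<nu> v - \<nu> u - d\<nu> u w)) \<le> R * (2 * \<eta> * norm w)"
        unfolding norm_scaleR using zR s\<nu> R by (intro mult_mono) auto
    qed (rule sf)
    also have "\<dots> \<le> K * (dist y y' + 2 * \<eta> * norm w) + (2 * \<eta> * norm w + R * (2 * \<eta> * norm w))"
      using fw K by (intro add_right_mono mult_left_mono) auto
    also have "\<dots> = K * dist y y' + 2 * \<eta> * (K + 1 + R) * norm w" by (simp add: algebra_simps)
    also have "\<dots> \<le> K * dist y y' + 2 * \<eta> * (K + 1 + R) * (C * dist y y')"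
      using wC \<eta> K R by (intro add_left_mono mult_left_mono) auto
    also have "2 * \<eta> * (K + 1 + R) * (C * dist y y') = dist y y'"
    proof -
      have "2 * C * (K + 1 + R) \<noteq> 0" using C K R by simp
      then have "\<eta> * (2 * C * (K + 1 + R)) = 1" by (simp add: \<eta>_def)
      moreover have "2 * \<eta> * (K + 1 + R) * (C * dist y y') = \<eta> * (2 * C * (K + 1 + R)) * dist y y'"
        by (simp only: mult_ac)
      ultimately show ?thesis by simp
    qed
    finally have "dist \<xi> (y' + z *\<^sub>R \<nu> v) \<le> (K + 1) * dist y y'" by (simp add: algebra_simps)
    moreover have "\<nu> (g y') = \<nu> v" using v gf by simp
    ultimately show "\<exists>z. \<bar>z\<bar> \<le> R \<and> dist \<xi> (y' + z *\<^sub>R \<nu> (g y')) \<le> (K + 1) * dist y y'"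
      using zR by auto
  qed (rule \<delta>(1))
qed

section \<open>Continuity of the curvature and of the tangent plane\<close>

text \<open>Continuity of a function on \<open>M\<close> may be tested in charts, since their images are relatively
  open and their inverses continuous.\<close>

lemma continuous_on_surface:
  fixes k :: "real^3 \<Rightarrow> 'b::topological_space"
  assumes M: "embedded_C2_surface M"
    and k: "\<And>D f f' f''. surface_chart M D f f' f'' \<Longrightarrow> continuous_on D (\<lambda>u. k (f u))"
  shows "continuous_on M k"
  unfolding continuous_on_eq_continuous_within
proof
  fix p assume p: "p \<in> M"
  then obtain D f where "local_parametrization M D f" and pf: "p \<in> f ` D"
    using M unfolding embedded_C2_surface_def by blast
  then obtain f' f'' where chart: "surface_chart M D f f' f''"
    using local_parametrization_chart by blast
  interpret surface_chart M D f f' f'' by (rule chart)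
  obtain g where g: "homeomorphism D (f ` D) f g" using homeo by blast
  obtain U where U: "open U" "f ` D = M \<inter> U" using openin_image by (auto simp: openin_open)
  have "continuous_on (f ` D) (\<lambda>y. k (f (g y)))"
    using g by (intro continuous_on_compose2[OF k[OF chart]]) (auto simp: homeomorphism_def)
  then have "continuous_on (M \<inter> U) k"
    unfolding U(2)[symmetric] using g
    by (subst continuous_on_cong[OF refl, of _ _ "\<lambda>y. k (f (g y))"]) (auto simp: homeomorphism_apply2)
  then have "continuous (at p within M \<inter> U) k"
    using p pf U by (auto simp: continuous_on_eq_continuous_within)
  moreover have "at p within M = at p within M \<inter> U"
    using pf U by (intro at_within_nhd[of _ U]) auto
  ultimately show "continuous (at p within M) k" by simp
qed

lemma continuous_on_mean_curvature_sq:
  assumes "embedded_C2_surface M" shows "continuous_on M (\<lambda>x. (mean_curvature M x)\<^sup>2)"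
proof (rule continuous_on_surface[OF assms])
  fix D f f' f'' assume "surface_chart M D f f' f''"
  then interpret surface_chart M D f f' f'' .
  show "continuous_on D (\<lambda>u. (mean_curvature M (f u))\<^sup>2)"
    by (subst continuous_on_cong[OF refl mean_curvature_sq]) (auto intro!: continuous_intros mean_curv_cont)
qed

text \<open>The orthogonal projection along a unit vector \<open>n\<close>.\<close>

definition perp_matrix :: "real^3 \<Rightarrow> real^3^3" where
  "perp_matrix n = (\<chi> i j. (if i = j then 1 else 0) - n $ i * n $ j)"

lemma plane_matrix_perp:
  assumes "norm n = 1" shows "plane_matrix {v. n \<bullet> v = 0} = perp_matrix n"
proof -
  have nn: "n \<bullet> n = 1" using assms by (simp add: norm_eq_1)
  have cp: "closest_point {v. n \<bullet> v = 0} x = x - (n \<bullet> x) *\<^sub>R n" for x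
  proof (rule closest_point_unique[symmetric])
    show "convex {v. n \<bullet> v = 0}" by (intro subspace_imp_convex subspace_hyperplane)
    show "closed {v. n \<bullet> v = 0}" by (rule closed_hyperplane)
    show "x - (n \<bullet> x) *\<^sub>R n \<in> {v. n \<bullet> v = 0}" by (simp add: inner_diff_right nn)
    show "\<forall>z\<in>{v. n \<bullet> v = 0}. dist x (x - (n \<bullet> x) *\<^sub>R n) \<le> dist x z"
    proof
      fix z assume "z \<in> {v. n \<bullet> v = 0}"
      then have "n \<bullet> x = n \<bullet> (x - z)" by (simp add: inner_diff_right)
      also have "\<bar>\<dots>\<bar> \<le> norm n * norm (x - z)" by (rule Cauchy_Schwarz_ineq2)
      finally show "dist x (x - (n \<bullet> x) *\<^sub>R n) \<le> dist x z" using assms by (simp add: dist_norm)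
    qed
  qed
  show ?thesis
    unfolding plane_matrix_def matrix_def perp_matrix_def
    by (simp add: vec_eq_iff cp inner_axis mult.commute) (simp add: axis_def)
qed

lemma continuous_on_perp_matrix: "continuous_on S n \<Longrightarrow> continuous_on S (\<lambda>x. perp_matrix (n x))"
  unfolding perp_matrix_def by (intro continuous_intros)

text \<open>Every plane is orthogonal to a unit vector, so the Grassmannian is a continuous image of the sphere.\<close>

lemma compact_grassmannian2: "compact grassmannian2"
proof -
  have "{S. subspace S \<and> dim S = 2} = (\<lambda>n. {v. n \<bullet> v = 0}) ` sphere (0 :: real^3) 1"
  proof (intro equalityI subsetI)
    fix S :: "(real^3) set" assume "S \<in> {S. subspace S \<and> dim S = 2}"
    then have S: "subspace S" "dim S = 2" by auto
    then obtain a where "a \<noteq> 0" "span S = {x. a \<bullet> x = 0}"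
      using dim_eq_hyperplane[of S] by auto
    then have a: "a \<noteq> 0" "S = {x. a \<bullet> x = 0}" using S(1) span_eq_iff by blast+
    then have "S = {v. (inverse (norm a) *\<^sub>R a) \<bullet> v = 0}" by simp
    moreover have "inverse (norm a) *\<^sub>R a \<in> sphere 0 1" using a by simp
    ultimately show "S \<in> (\<lambda>n. {v. n \<bullet> v = 0}) ` sphere 0 1" by blast
  next
    fix S assume "S \<in> (\<lambda>n. {v. n \<bullet> v = 0}) ` sphere (0 :: real^3) 1"
    then show "S \<in> {S. subspace S \<and> dim S = 2}"
      by (auto simp: subspace_hyperplane intro!: dim_hyperplane[THEN trans])
  qed
  then have "grassmannian2 = perp_matrix ` sphere 0 1"
    unfolding grassmannian2_def image_image by (auto simp: image_image plane_matrix_perp)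
  then show ?thesis
    using compact_continuous_image[OF continuous_on_perp_matrix[OF continuous_on_id] compact_sphere]
    by metis
qed

lemma continuous_on_plane_matrix_tangent_space:
  assumes "embedded_C2_surface M" shows "continuous_on M (\<lambda>x. plane_matrix (tangent_space M x))"
proof (rule continuous_on_surface[OF assms])
  fix D f f' f'' assume "surface_chart M D f f' f''"
  then interpret surface_chart M D f f' f'' .
  have "plane_matrix (tangent_space M (f u)) = perp_matrix (\<nu> u)" if "u \<in> D" for u
    using that by (simp add: tangent_space_eq plane_matrix_perp norm_\<nu>)
  then show "continuous_on D (\<lambda>u. plane_matrix (tangent_space M (f u)))"
    by (subst continuous_on_cong[OF refl]) (auto intro!: continuous_on_perp_matrix \<nu>_cont)
qed

lemma plane_matrix_tangent_space_in:
  assumes M: "embedded_C2_surface M" and p: "p \<in> M"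
  shows "plane_matrix (tangent_space M p) \<in> grassmannian2"
proof -
  obtain D f where "local_parametrization M D f" "p \<in> f ` D"
    using M p unfolding embedded_C2_surface_def by blast
  then obtain f' f'' u where "surface_chart M D f f' f''" and u: "u \<in> D" "p = f u"
    using local_parametrization_chart by blast
  then interpret surface_chart M D f f' f'' by blast
  have "\<nu> u \<noteq> 0" using norm_\<nu>[OF u(1)] by auto
  then show ?thesis
    unfolding grassmannian2_def using u
    by (auto simp: tangent_space_eq subspace_hyperplane dim_hyperplane)
qed

section \<open>Volume of normal tubes and the density estimate\<close>

text \<open>The segment is covered by balls of radius \<open>2 \<rho>\<close> around points spaced by \<open>\<rho>\<close>, of which at most
  \<open>5 R / \<rho>\<close> are needed.\<close>

lemma segment_neighbourhood_volume:
  fixes a n :: "real^3"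
  assumes n: "norm n = 1" and \<rho>: "0 < \<rho>" "\<rho> \<le> R"
  obtains S where "S \<in> sets borel" "{\<xi>. \<exists>z. \<bar>z\<bar> \<le> R \<and> dist \<xi> (a + z *\<^sub>R n) \<le> \<rho>} \<subseteq> S"
    "emeasure lborel S \<le> ennreal (40 * unit_ball_vol 3 * R * \<rho>\<^sup>2)"
proof -
  define N where "N = \<lceil>R / \<rho>\<rceil>"
  define S where "S = (\<Union>k\<in>{-N..N}. cball (a + (of_int k * \<rho>) *\<^sub>R n) (2 * \<rho>))"
  have "0 \<le> R / \<rho>" using \<rho> by simp
  then have N: "0 \<le> N" "of_int N \<le> R / \<rho> + 1" unfolding N_def by linarith+
  have V: "unit_ball_vol 3 \<ge> (0::real)" by simp
  show thesis
  proof (rule that[of S])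
    show "S \<in> sets borel" unfolding S_def by (intro borel_closed closed_UN) auto
    show "{\<xi>. \<exists>z. \<bar>z\<bar> \<le> R \<and> dist \<xi> (a + z *\<^sub>R n) \<le> \<rho>} \<subseteq> S"
    proof safe
      fix \<xi> z assume z: "\<bar>z\<bar> \<le> R" and d: "dist \<xi> (a + z *\<^sub>R n) \<le> \<rho>"
      define k where "k = \<lfloor>z / \<rho>\<rfloor>"
      have "\<bar>z / \<rho>\<bar> \<le> R / \<rho>" using z \<rho> by (simp add: divide_right_mono)
      then have zN: "\<bar>z / \<rho>\<bar> \<le> of_int N" unfolding N_def by linarith
      then have k: "k \<in> {-N..N}" unfolding k_def by (simp, linarith)
      have "\<bar>z / \<rho> - of_int k\<bar> \<le> 1" unfolding k_def by linarith
      then have "\<bar>z / \<rho> - of_int k\<bar> * \<rho> \<le> 1 * \<rho>" using \<rho> by (intro mult_right_mono) auto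
      also have "\<bar>z / \<rho> - of_int k\<bar> * \<rho> = \<bar>(z / \<rho> - of_int k) * \<rho>\<bar>" using \<rho> by (simp add: abs_mult)
      also have "(z / \<rho> - of_int k) * \<rho> = z - of_int k * \<rho>" using \<rho> by (simp add: field_simps)
      finally have "dist (a + z *\<^sub>R n) (a + (of_int k * \<rho>) *\<^sub>R n) \<le> \<rho>"
        using n by (simp add: dist_norm flip: scaleR_left_diff_distrib)
      then have "dist \<xi> (a + (of_int k * \<rho>) *\<^sub>R n) \<le> 2 * \<rho>"
        using d dist_triangle[of \<xi> "a + (of_int k * \<rho>) *\<^sub>R n" "a + z *\<^sub>R n"] by linarith
      then show "\<xi> \<in> S" unfolding S_def using k by (auto simp: dist_commute)
    qed
    have "emeasure lborel S \<le> (\<Sum>k\<in>{-N..N}. emeasure lborel (cball (a + (of_int k * \<rho>) *\<^sub>R n) (2 * \<rho>)))"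
      unfolding S_def by (intro emeasure_subadditive_finite) auto
    also have "\<dots> = (\<Sum>k\<in>{-N..N}. ennreal (unit_ball_vol 3 * (2 * \<rho>) ^ 3))"
      using \<rho> by (intro sum.cong refl) (simp add: emeasure_cball)
    also have "\<dots> = ennreal (of_int (2 * N + 1) * (unit_ball_vol 3 * (2 * \<rho>) ^ 3))"
    proof -
      have "real (card {-N..N}) = of_int (2 * N + 1)" using N by simp
      then show ?thesis
        using \<rho> by (simp only: sum_constant ennreal_of_nat_eq_real_of_nat) (simp add: ennreal_mult)
    qed
    also have "\<dots> \<le> ennreal (40 * unit_ball_vol 3 * R * \<rho>\<^sup>2)"
    proof (rule ennreal_leI)
      have "1 \<le> R / \<rho>" using \<rho> by simp
      then have "of_int (2 * N + 1) \<le> 5 * (R / \<rho>)" using N(2) by simp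
      then have "of_int (2 * N + 1) * (unit_ball_vol 3 * (2 * \<rho>) ^ 3)
          \<le> 5 * (R / \<rho>) * (unit_ball_vol 3 * (2 * \<rho>) ^ 3)"
        using \<rho> V by (intro mult_right_mono) auto
      also have "\<dots> = 40 * unit_ball_vol 3 * R * \<rho>\<^sup>2"
        using \<rho> by (simp add: power3_eq_cube power2_eq_square)
      finally show "of_int (2 * N + 1) * (unit_ball_vol 3 * (2 * \<rho>) ^ 3) \<le> 40 * unit_ball_vol 3 * R * \<rho>\<^sup>2" .
    qed
    finally show "emeasure lborel S \<le> ennreal (40 * unit_ball_vol 3 * R * \<rho>\<^sup>2)" .
  qed
qed

text \<open>A cover of \<open>E\<close> by small sets of diameters \<open>d\<^sub>i\<close> gives a cover of \<open>T\<close> by neighbourhoods of radii \<open>L d\<^sub>i\<close>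
  of segments of length \<open>2 R\<close>. Their volumes are of order \<open>R L\<^sup>2 d\<^sub>i\<^sup>2\<close>, and the sum of the \<open>d\<^sub>i\<^sup>2\<close> is controlled
  by the Hausdorff measure.\<close>

lemma tube_volume:
  assumes R: "R > 0" and L: "L > 0"
    and n: "\<And>y. y \<in> E \<Longrightarrow> norm (n y) = 1"
    and T: "\<And>y \<xi>. \<xi> \<in> T \<Longrightarrow> \<exists>y\<in>E. \<forall>y'\<in>E. \<exists>z. \<bar>z\<bar> \<le> R \<and> dist \<xi> (y' + z *\<^sub>R n y') \<le> L * dist y y'"
    and fin: "hausdorff2_outer E < \<infinity>" and \<epsilon>: "\<epsilon> > 0"
  obtains S where "S \<in> sets borel" "T \<subseteq> S"
    "emeasure lborel S \<le> ennreal (160 * unit_ball_vol 3 * R * L\<^sup>2) * hausdorff2_outer E + ennreal \<epsilon>"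
proof -
  define A where "A = 160 * unit_ball_vol 3 * R * L\<^sup>2"
  have A: "A > 0" using R L by (simp add: A_def)
  define e where "e = \<epsilon> / (2 * A)"
  have e: "e > 0" using \<epsilon> A by (simp add: e_def)
  define \<tau> where "\<tau> = min (R / (2 * L)) (sqrt e)"
  have \<tau>: "\<tau> > 0" "\<tau> \<le> R / (2 * L)" "\<tau>\<^sup>2 \<le> e"
  proof -
    show "\<tau> > 0" "\<tau> \<le> R / (2 * L)" using R L e by (auto simp: \<tau>_def)
    have "\<tau>\<^sup>2 \<le> (sqrt e)\<^sup>2" using \<open>\<tau> > 0\<close> by (intro power_mono) (auto simp: \<tau>_def)
    then show "\<tau>\<^sup>2 \<le> e" using e by simp
  qed
  define h where "h = (\<lambda>C :: (real^3) set. ennreal (pi * (diameter C / 2)\<^sup>2))"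
  have "hausdorff2_pre (R / (2 * L)) E \<le> hausdorff2_outer E"
    using R L by (intro hausdorff2_pre_le_outer) auto
  also have "\<dots> < hausdorff2_outer E + ennreal e"
    using fin e ennreal_add_left_cancel_less[of "hausdorff2_outer E" 0 "ennreal e"] by (auto simp: less_top)
  finally obtain C where C: "E \<subseteq> (\<Union>i. C i)" "\<And>i. bounded (C i)" "\<And>i. diameter (C i) \<le> R / (2 * L)"
    "(\<Sum>i. h (C i)) < hausdorff2_outer E + ennreal e"
    using hausdorff2_pre_cover unfolding h_def by metis
  \<comment> \<open>The summable term keeps the radius positive for covering sets that are single points.\<close>
  define \<rho> where "\<rho> = (\<lambda>i. L * (diameter (C i) + \<tau> * (1/2) ^ i))"
  have dC: "0 \<le> diameter (C i)" for i using C(2) by (rule diameter_ge_0)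
  have \<rho>: "0 < \<rho> i" "\<rho> i \<le> R" for i
  proof -
    show "0 < \<rho> i" unfolding \<rho>_def using L \<tau> dC[of i] by (intro mult_pos_pos add_nonneg_pos) auto
    have "\<tau> * (1/2) ^ i \<le> \<tau> * 1" using \<tau> by (intro mult_left_mono power_le_one) auto
    then have "\<tau> * (1/2) ^ i \<le> R / (2 * L)" using \<tau>(2) by linarith
    then have "\<rho> i \<le> L * (R / (2 * L) + R / (2 * L))"
      unfolding \<rho>_def using C(3)[of i] L by (intro mult_left_mono add_mono) auto
    also have "\<dots> = R" using L by simp
    finally show "\<rho> i \<le> R" .
  qed
  have "\<exists>S. S \<in> sets borel \<and> emeasure lborel S \<le> ennreal (40 * unit_ball_vol 3 * R * (\<rho> i)\<^sup>2) \<and>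
      (\<forall>\<xi>\<in>T. \<forall>y\<in>E \<inter> C i. (\<forall>y'\<in>E. \<exists>z. \<bar>z\<bar> \<le> R \<and> dist \<xi> (y' + z *\<^sub>R n y') \<le> L * dist y y') \<longrightarrow> \<xi> \<in> S)" for i
  proof (cases "E \<inter> C i = {}")
    case False
    then obtain a where a: "a \<in> E" "a \<in> C i" by blast
    obtain S where S: "S \<in> sets borel" "{\<xi>. \<exists>z. \<bar>z\<bar> \<le> R \<and> dist \<xi> (a + z *\<^sub>R n a) \<le> \<rho> i} \<subseteq> S"
      "emeasure lborel S \<le> ennreal (40 * unit_ball_vol 3 * R * (\<rho> i)\<^sup>2)"
      by (rule segment_neighbourhood_volume[OF n[OF a(1)] \<rho>(1)[of i] \<rho>(2)[of i], of a]) blast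
    have "\<xi> \<in> S" if y: "y \<in> E \<inter> C i" "\<forall>y'\<in>E. \<exists>z. \<bar>z\<bar> \<le> R \<and> dist \<xi> (y' + z *\<^sub>R n y') \<le> L * dist y y'" for \<xi> y
    proof -
      obtain z where z: "\<bar>z\<bar> \<le> R" "dist \<xi> (a + z *\<^sub>R n a) \<le> L * dist y a" using y a by blast
      have "dist y a \<le> diameter (C i)" using y a C(2) by (intro diameter_bounded_bound) auto
      then have "dist y a \<le> diameter (C i) + \<tau> * (1/2) ^ i" using \<tau> by (simp add: add_increasing2)
      then have "L * dist y a \<le> \<rho> i" unfolding \<rho>_def using L by (intro mult_left_mono) auto
      then show ?thesis using z S(2) by (auto intro!: subsetD[OF S(2)])
    qed
    then show ?thesis using S by blast
  qed (intro exI[of _ "{}"], auto)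
  then obtain S where S: "\<And>i. S i \<in> sets borel"
    "\<And>i. emeasure lborel (S i) \<le> ennreal (40 * unit_ball_vol 3 * R * (\<rho> i)\<^sup>2)"
    "\<And>i \<xi> y. \<xi> \<in> T \<Longrightarrow> y \<in> E \<inter> C i \<Longrightarrow>
      (\<forall>y'\<in>E. \<exists>z. \<bar>z\<bar> \<le> R \<and> dist \<xi> (y' + z *\<^sub>R n y') \<le> L * dist y y') \<Longrightarrow> \<xi> \<in> S i"
    by metis
  show thesis
  proof (rule that[of "\<Union>i. S i"])
    show "(\<Union>i. S i) \<in> sets borel" using S(1) by auto
    show "T \<subseteq> (\<Union>i. S i)"
    proof
      fix \<xi> assume \<xi>: "\<xi> \<in> T"
      then obtain y where y: "y \<in> E" "\<forall>y'\<in>E. \<exists>z. \<bar>z\<bar> \<le> R \<and> dist \<xi> (y' + z *\<^sub>R n y') \<le> L * dist y y'"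
        using T by blast
      then obtain i where "y \<in> C i" using C(1) by blast
      then show "\<xi> \<in> (\<Union>i. S i)" using S(3)[OF \<xi> _ y(2), of i] y(1) by blast
    qed
    have cterm: "ennreal (40 * unit_ball_vol 3 * R * (\<rho> i)\<^sup>2)
        \<le> ennreal A * h (C i) + ennreal (A * \<tau>\<^sup>2) * ennreal ((1/2) ^ Suc i)" for i
    proof -
      let ?d = "diameter (C i)" and ?t = "\<tau> * (1/2) ^ i"
      have "(\<rho> i)\<^sup>2 = L\<^sup>2 * (?d + ?t)\<^sup>2" by (simp add: \<rho>_def power_mult_distrib)
      also have "(?d + ?t)\<^sup>2 \<le> 2 * ?d\<^sup>2 + 2 * ?t\<^sup>2"
        using sum_squares_bound[of ?d ?t] by (simp add: power2_sum)
      also have "?t\<^sup>2 \<le> \<tau>\<^sup>2 * (1/2) ^ i"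
      proof -
        have "((1/2::real) ^ i)\<^sup>2 \<le> (1/2) ^ i * 1"
          unfolding power2_eq_square by (intro mult_left_mono power_le_one) auto
        then show ?thesis unfolding power_mult_distrib by (intro mult_left_mono) auto
      qed
      also have "?d\<^sup>2 \<le> 2 * (pi * (?d / 2)\<^sup>2)"
      proof -
        have "2 * ?d\<^sup>2 \<le> pi * ?d\<^sup>2" using pi_gt3 by (intro mult_right_mono) auto
        then show ?thesis by (simp add: power_divide)
      qed
      finally have "(\<rho> i)\<^sup>2 \<le> L\<^sup>2 * (2 * (2 * (pi * (?d / 2)\<^sup>2)) + 2 * (\<tau>\<^sup>2 * (1/2) ^ i))"
        using L by (simp add: mult_left_mono)
      then have "40 * unit_ball_vol 3 * R * (\<rho> i)\<^sup>2
          \<le> 40 * unit_ball_vol 3 * R * (L\<^sup>2 * (2 * (2 * (pi * (?d / 2)\<^sup>2)) + 2 * (\<tau>\<^sup>2 * (1/2) ^ i)))"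
        using R by (intro mult_left_mono) auto
      also have "\<dots> = A * (pi * (?d / 2)\<^sup>2) + A * \<tau>\<^sup>2 * (1/2) ^ Suc i"
        by (simp add: A_def algebra_simps)
      finally have "ennreal (40 * unit_ball_vol 3 * R * (\<rho> i)\<^sup>2)
          \<le> ennreal (A * (pi * (?d / 2)\<^sup>2) + A * \<tau>\<^sup>2 * (1/2) ^ Suc i)" by (rule ennreal_leI)
      also have "\<dots> = ennreal A * h (C i) + ennreal (A * \<tau>\<^sup>2) * ennreal ((1/2) ^ Suc i)"
        using A by (simp add: h_def ennreal_plus ennreal_mult'[symmetric] del: power_Suc)
      finally show ?thesis .
    qed
    have "emeasure lborel (\<Union>i. S i) \<le> (\<Sum>i. emeasure lborel (S i))"
      using S(1) by (intro emeasure_subadditive_countably) auto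
    also have "\<dots> \<le> (\<Sum>i. ennreal A * h (C i) + ennreal (A * \<tau>\<^sup>2) * ennreal ((1/2) ^ Suc i))"
      by (intro suminf_le order_trans[OF S(2) cterm]) auto
    also have "\<dots> = (\<Sum>i. ennreal A * h (C i)) + (\<Sum>i. ennreal (A * \<tau>\<^sup>2) * ennreal ((1/2) ^ Suc i))"
      by (rule suminf_add[symmetric]) auto
    also have "\<dots> = ennreal A * (\<Sum>i. h (C i)) + ennreal (A * \<tau>\<^sup>2)"
      unfolding ennreal_suminf_cmult
      by (subst suminf_ennreal_eq[OF zero_le_power power_half_series]) auto
    also have "\<dots> \<le> ennreal A * (hausdorff2_outer E + ennreal e) + ennreal (A * e)"
      using C(4) \<tau>(3) A by (intro add_mono mult_left_mono ennreal_leI) auto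
    also have "\<dots> = ennreal A * hausdorff2_outer E + (ennreal (A * e) + ennreal (A * e))"
      using A e by (simp add: distrib_left ennreal_mult'[symmetric] add.assoc)
    also have "ennreal (A * e) + ennreal (A * e) = ennreal \<epsilon>"
      using A e \<epsilon> by (subst ennreal_plus[symmetric]) (auto simp: e_def)
    finally show "emeasure lborel (\<Union>i. S i)
        \<le> ennreal (160 * unit_ball_vol 3 * R * L\<^sup>2) * hausdorff2_outer E + ennreal \<epsilon>"
      unfolding A_def .
  qed
qed

lemma mean_curvature_sq_measurable:
  assumes M: "embedded_C2_surface M" "compact M"
  shows "(\<lambda>x. ennreal (a + b * (mean_curvature M x)\<^sup>2) * indicator M x) \<in> borel_measurable hausdorff2"
proof -
  have "continuous_on M (\<lambda>x. a + b * (mean_curvature M x)\<^sup>2)"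
    using M by (intro continuous_intros continuous_on_mean_curvature_sq)
  then have "(\<lambda>x. indicator M x *\<^sub>R (a + b * (mean_curvature M x)\<^sup>2)) \<in> borel_measurable borel"
    using M by (intro borel_measurable_continuous_on_indicator) (auto simp: compact_imp_closed borel_closed)
  then have "(\<lambda>x. ennreal (indicator M x *\<^sub>R (a + b * (mean_curvature M x)\<^sup>2))) \<in> borel_measurable borel"
    by measurable
  moreover have "ennreal (indicator M x *\<^sub>R (a + b * (mean_curvature M x)\<^sup>2))
      = ennreal (a + b * (mean_curvature M x)\<^sup>2) * indicator M x" for x
    by (simp add: indicator_def)
  ultimately show ?thesis by (simp add: measurable_cong_sets[OF sets_hausdorff2 refl])
qed

text \<open>A compact surface through \<open>x\<close> cannot have both little area and little Willmore energy in a ball around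
  \<open>x\<close>. Every \<open>\<xi>\<close> in the ball of radius \<open>R\<close> has a nearest point on \<open>M\<close>, at distance less than \<open>R\<close> because \<open>x\<close>
  itself lies on \<open>M\<close>, hence inside the ball of radius \<open>2 R\<close>. So the ball is covered by the normal tubes over
  finitely many pieces of \<open>M\<close>, on each of which the Lipschitz constant is comparable to \<open>1 + R \<bar>H\<bar>\<close>. Comparing
  volumes gives \<open>R\<^sup>3 \<le> c R \<integral> (1 + R\<^sup>2 H\<^sup>2)\<close>.\<close>

lemma density_lower_bound:
  assumes M: "embedded_C2_surface M" "compact M" and fin: "emeasure hausdorff2 M < \<infinity>"
    and x: "x \<in> M" and R: "R > 0"
  shows "ennreal (1/8000)
    \<le> (\<integral>\<^sup>+y\<in>M \<inter> ball x (2 * R). ennreal (1 / R\<^sup>2 + (mean_curvature M y)\<^sup>2) \<partial>hausdorff2)"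
proof -
  define V where "V = (unit_ball_vol 3 :: real)"
  have V: "V > 0" by (simp add: V_def)
  have Mb: "M \<in> sets borel" using M by (simp add: compact_imp_closed borel_closed)
  \<comment> \<open>The conclusion of \<open>nearest_point_lipschitz\<close> at \<open>p\<close>, as a predicate from which its data can be chosen for
    all \<open>p\<close> at once.\<close>
  define good where "good = (\<lambda>p \<delta> L n. \<delta> > 0 \<and> L > 0 \<and>
     (\<forall>y. y \<in> M \<longrightarrow> dist y p < \<delta> \<longrightarrow> norm (n y) = (1::real)) \<and>
     (\<forall>y. y \<in> M \<longrightarrow> dist y p < \<delta> \<longrightarrow> L \<le> 5 + R * \<bar>mean_curvature M y\<bar>) \<and>
     (\<forall>y y' \<xi>. y \<in> M \<longrightarrow> dist y p < \<delta> \<longrightarrow> y' \<in> M \<longrightarrow> dist y' p < \<delta> \<longrightarrow>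
       (\<forall>x. x \<in> M \<longrightarrow> dist \<xi> y \<le> dist \<xi> x) \<longrightarrow> dist \<xi> y \<le> R \<longrightarrow>
       (\<exists>z. \<bar>z\<bar> \<le> R \<and> dist \<xi> (y' + z *\<^sub>R n y') \<le> L * dist y y')))"
  have "\<exists>\<delta> L n. good p \<delta> L n" if p: "p \<in> M" for p
  proof -
    obtain \<delta> L n where "\<delta> > 0" "L > 0" "\<And>y. y \<in> M \<Longrightarrow> dist y p < \<delta> \<Longrightarrow> norm (n y) = 1"
      "\<And>y. y \<in> M \<Longrightarrow> dist y p < \<delta> \<Longrightarrow> L \<le> 5 + R * \<bar>mean_curvature M y\<bar>"
      "\<And>y y' \<xi>. y \<in> M \<Longrightarrow> dist y p < \<delta> \<Longrightarrow> y' \<in> M \<Longrightarrow> dist y' p < \<delta> \<Longrightarrow>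
         (\<And>x. x \<in> M \<Longrightarrow> dist \<xi> y \<le> dist \<xi> x) \<Longrightarrow> dist \<xi> y \<le> R \<Longrightarrow>
         \<exists>z. \<bar>z\<bar> \<le> R \<and> dist \<xi> (y' + z *\<^sub>R n y') \<le> L * dist y y'"
      by (rule nearest_point_lipschitz[OF M(1) p R]) blast
    then have "good p \<delta> L n" unfolding good_def by blast
    then show ?thesis by blast
  qed
  then obtain \<delta> L n where good: "\<And>p. p \<in> M \<Longrightarrow> good p (\<delta> p) (L p) (n p)" by metis
  have \<delta>: "\<delta> p > 0" and Lpos: "L p > 0" if "p \<in> M" for p using good[OF that] by (auto simp: good_def)
  \<comment> \<open>Finitely many charts, and a Borel partition of the part of \<open>M\<close> in the ball subordinate to them.\<close>
  have "M \<subseteq> (\<Union>p\<in>M. ball p (\<delta> p))" using \<delta> by force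
  then obtain F where F: "F \<subseteq> M" "finite F" "M \<subseteq> (\<Union>p\<in>F. ball p (\<delta> p))"
    using compactE_image[OF M(2), of M "\<lambda>p. ball p (\<delta> p)"] by blast
  obtain e where e: "bij_betw e {..<card F} F"
    using ex_bij_betw_nat_finite[OF F(2)] by (auto simp: atLeast0LessThan)
  define N where "N = card F"
  have eM: "e i \<in> M" if "i < N" for i using e that F(1) by (auto simp: bij_betw_def N_def)
  define E where "E = (\<lambda>i. M \<inter> ball x (2 * R) \<inter> (ball (e i) (\<delta> (e i)) - (\<Union>j<i. ball (e j) (\<delta> (e j)))))"
  have Eb: "E i \<in> sets borel" for i
    unfolding E_def by (intro sets.Int sets.Diff Mb borel_open open_UN) auto
  have disj: "disjoint_family_on E {..<N}"
  proof -
    have "E i \<inter> E j = {}" if "i < j" for i j using that by (auto simp: E_def)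
    then show ?thesis unfolding disjoint_family_on_def by (metis Int_commute nat_neq_iff)
  qed
  have cover: "M \<inter> ball x (2 * R) = (\<Union>i<N. E i)"
  proof (intro equalityI subsetI)
    fix y assume y: "y \<in> M \<inter> ball x (2 * R)"
    have "\<exists>i. i < N \<and> y \<in> ball (e i) (\<delta> (e i))"
      using y F(3) e by (force simp: bij_betw_def N_def)
    from exists_least_iff[THEN iffD1, OF this]
    obtain i where "i < N" "y \<in> ball (e i) (\<delta> (e i))"
      "\<And>j. j < i \<Longrightarrow> \<not> (j < N \<and> y \<in> ball (e j) (\<delta> (e j)))" by blast
    then show "y \<in> (\<Union>i<N. E i)" using y by (auto simp: E_def intro!: bexI[of _ i])
  qed (auto simp: E_def)
  define g where "g = (\<lambda>y. ennreal (50 + 2 * R\<^sup>2 * (mean_curvature M y)\<^sup>2) * indicator M y)"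
  have g: "g \<in> borel_measurable hausdorff2"
    unfolding g_def using mean_curvature_sq_measurable[OF M] by blast
  define T where "T = (\<lambda>E. {\<xi>. \<exists>y\<in>E. (\<forall>x\<in>M. dist \<xi> y \<le> dist \<xi> x) \<and> dist \<xi> y \<le> R})"
  have finE: "hausdorff2_outer (E i) < \<infinity>" for i
  proof -
    have "emeasure hausdorff2 (E i) \<le> emeasure hausdorff2 M"
      using Mb by (intro emeasure_mono) (auto simp: E_def)
    then show ?thesis using fin emeasure_hausdorff2[OF Eb] by (metis le_less_trans)
  qed
  have piece: "\<exists>S. S \<in> sets borel \<and> T (E i) \<subseteq> S \<and>
      emeasure lborel S \<le> ennreal (160 * V * R) * (\<integral>\<^sup>+y. g y * indicator (E i) y \<partial>hausdorff2) + ennreal \<epsilon>"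
    if i: "i < N" and \<epsilon>: "\<epsilon> > 0" for i \<epsilon>
  proof -
    let ?p = "e i"
    have gd: "good ?p (\<delta> ?p) (L ?p) (n ?p)" by (rule good[OF eM[OF i]])
    have E: "y \<in> M" "dist y ?p < \<delta> ?p" if "y \<in> E i" for y using that by (auto simp: E_def dist_commute)
    have 1: "norm (n ?p y) = 1" if "y \<in> E i" for y using gd E[OF that] by (auto simp: good_def)
    have 2: "\<exists>y\<in>E i. \<forall>y'\<in>E i. \<exists>z. \<bar>z\<bar> \<le> R \<and> dist \<xi> (y' + z *\<^sub>R n ?p y') \<le> L ?p * dist y y'"
      if \<xi>: "\<xi> \<in> T (E i)" for \<xi>
    proof -
      obtain y where y: "y \<in> E i" "\<forall>x\<in>M. dist \<xi> y \<le> dist \<xi> x" "dist \<xi> y \<le> R"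
        using \<xi> by (auto simp: T_def)
      have lip: "\<And>y y' \<xi>. y \<in> M \<Longrightarrow> dist y ?p < \<delta> ?p \<Longrightarrow> y' \<in> M \<Longrightarrow> dist y' ?p < \<delta> ?p \<Longrightarrow>
          \<forall>x. x \<in> M \<longrightarrow> dist \<xi> y \<le> dist \<xi> x \<Longrightarrow> dist \<xi> y \<le> R \<Longrightarrow>
          \<exists>z. \<bar>z\<bar> \<le> R \<and> dist \<xi> (y' + z *\<^sub>R n ?p y') \<le> L ?p * dist y y'"
        using gd unfolding good_def by blast
      show ?thesis
      proof (intro bexI[OF _ y(1)] ballI)
        fix y' assume "y' \<in> E i"
        with y E show "\<exists>z. \<bar>z\<bar> \<le> R \<and> dist \<xi> (y' + z *\<^sub>R n ?p y') \<le> L ?p * dist y y'"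
          by (intro lip) auto
      qed
    qed
    obtain S where S: "S \<in> sets borel" "T (E i) \<subseteq> S"
      "emeasure lborel S \<le> ennreal (160 * V * R * (L ?p)\<^sup>2) * hausdorff2_outer (E i) + ennreal \<epsilon>"
      using tube_volume[OF R Lpos[OF eM[OF i]] 1 2 finE \<epsilon>] unfolding V_def by metis
    have "ennreal ((L ?p)\<^sup>2) * hausdorff2_outer (E i) = (\<integral>\<^sup>+y. ennreal ((L ?p)\<^sup>2) * indicator (E i) y \<partial>hausdorff2)"
      using Eb by (subst nn_integral_cmult_indicator) (auto simp: emeasure_hausdorff2)
    also have "\<dots> \<le> (\<integral>\<^sup>+y. g y * indicator (E i) y \<partial>hausdorff2)"
    proof (intro nn_integral_mono)
      fix y
      have "(L ?p)\<^sup>2 \<le> 50 + 2 * R\<^sup>2 * (mean_curvature M y)\<^sup>2" if "y \<in> E i"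
      proof -
        have "L ?p \<le> 5 + R * \<bar>mean_curvature M y\<bar>" using gd E[OF that] by (auto simp: good_def)
        then have "(L ?p)\<^sup>2 \<le> (5 + R * \<bar>mean_curvature M y\<bar>)\<^sup>2"
          using Lpos[OF eM[OF i]] by (intro power_mono) auto
        also have "\<dots> \<le> 2 * 5\<^sup>2 + 2 * (R * \<bar>mean_curvature M y\<bar>)\<^sup>2"
          using sum_squares_bound[of 5 "R * \<bar>mean_curvature M y\<bar>"] unfolding power2_sum by linarith
        finally show ?thesis by (simp add: power_mult_distrib)
      qed
      then show "ennreal ((L ?p)\<^sup>2) * indicator (E i) y \<le> g y * indicator (E i) y"
        using E(1) by (auto simp: g_def indicator_def simp del: ennreal_plus intro!: ennreal_leI)
    qed
    finally have "ennreal (160 * V * R) * (ennreal ((L ?p)\<^sup>2) * hausdorff2_outer (E i))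
        \<le> ennreal (160 * V * R) * (\<integral>\<^sup>+y. g y * indicator (E i) y \<partial>hausdorff2)"
      by (rule mult_left_mono) simp
    then have "ennreal (160 * V * R * (L ?p)\<^sup>2) * hausdorff2_outer (E i)
        \<le> ennreal (160 * V * R) * (\<integral>\<^sup>+y. g y * indicator (E i) y \<partial>hausdorff2)"
      using V R by (simp add: ennreal_mult' mult.assoc)
    then show ?thesis using S by (meson add_right_mono order_trans)
  qed
  let ?I = "\<integral>\<^sup>+y. g y * indicator (M \<inter> ball x (2 * R)) y \<partial>hausdorff2"
  have "ennreal (V * R ^ 3) \<le> ennreal (160 * V * R) * ?I"
  proof (rule ennreal_le_epsilon)
    fix \<epsilon> :: real assume \<epsilon>: "0 < \<epsilon>"
    define \<eta> where "\<eta> = \<epsilon> / (real N + 1)"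
    have \<eta>: "\<eta> > 0" using \<epsilon> by (simp add: \<eta>_def add_nonneg_pos)
    define P where "P = (\<lambda>i S. S \<in> sets borel \<and> T (E i) \<subseteq> S \<and>
      emeasure lborel S \<le> ennreal (160 * V * R) * (\<integral>\<^sup>+y. g y * indicator (E i) y \<partial>hausdorff2) + ennreal \<eta>)"
    define S where "S = (\<lambda>i. SOME S. P i S)"
    have "P i (S i)" if "i < N" for i
    proof -
      have "\<exists>S. P i S" using piece[OF that \<eta>] by (simp only: P_def)
      then show ?thesis unfolding S_def by (rule someI_ex)
    qed
    then have S: "\<And>i. i < N \<Longrightarrow> S i \<in> sets borel" "\<And>i. i < N \<Longrightarrow> T (E i) \<subseteq> S i"
      "\<And>i. i < N \<Longrightarrow> emeasure lborel (S i)
        \<le> ennreal (160 * V * R) * (\<integral>\<^sup>+y. g y * indicator (E i) y \<partial>hausdorff2) + ennreal \<eta>"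
      by (simp_all add: P_def)
    have "ball x R \<subseteq> (\<Union>i<N. S i)"
    proof
      fix \<xi> assume \<xi>: "\<xi> \<in> ball x R"
      have "M \<noteq> {}" using x by blast
      from distance_attains_inf[OF compact_imp_closed[OF M(2)] this, of \<xi>]
      obtain y where y: "y \<in> M" "\<forall>x\<in>M. dist \<xi> y \<le> dist \<xi> x" by metis
      have "dist \<xi> y \<le> dist \<xi> x" using y(2) x by blast
      also have "\<dots> < R" using \<xi> by (simp add: dist_commute)
      finally have "dist \<xi> y < R" .
      moreover from this have "dist x y < 2 * R"
        using \<xi> dist_triangle[of x y \<xi>] by simp
      ultimately have "y \<in> (\<Union>i<N. E i)" using y cover by auto
      then obtain i where i: "i < N" "y \<in> E i" by blast
      then have "\<xi> \<in> T (E i)" using y \<open>dist \<xi> y < R\<close> by (auto simp: T_def)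
      then show "\<xi> \<in> (\<Union>i<N. S i)" using S(2)[OF i(1)] i by blast
    qed
    then have "emeasure lborel (ball x R) \<le> emeasure lborel (\<Union>i<N. S i)"
      using S(1) by (intro emeasure_mono) auto
    also have "\<dots> \<le> (\<Sum>i<N. emeasure lborel (S i))"
      using S(1) by (intro emeasure_subadditive_finite) auto
    also have "\<dots> \<le> (\<Sum>i<N. ennreal (160 * V * R) * (\<integral>\<^sup>+y. g y * indicator (E i) y \<partial>hausdorff2) + ennreal \<eta>)"
      using S(3) by (intro sum_mono) auto
    also have "\<dots> = ennreal (160 * V * R) * (\<Sum>i<N. \<integral>\<^sup>+y. g y * indicator (E i) y \<partial>hausdorff2)
        + of_nat N * ennreal \<eta>"
      by (simp add: sum.distrib sum_distrib_left)
    also have "(\<Sum>i<N. \<integral>\<^sup>+y. g y * indicator (E i) y \<partial>hausdorff2)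
        = (\<integral>\<^sup>+y. (\<Sum>i<N. g y * indicator (E i) y) \<partial>hausdorff2)"
      using g Eb by (intro nn_integral_sum[symmetric]) auto
    also have "\<dots> = ?I"
      using disj by (intro nn_integral_cong)
        (simp add: cover indicator_UN_disjoint sum_distrib_left)
    also have "of_nat N * ennreal \<eta> \<le> ennreal \<epsilon>"
    proof -
      have "real N * \<eta> \<le> \<epsilon>" using \<epsilon> by (simp add: \<eta>_def field_simps)
      then show ?thesis
        using \<eta> by (simp add: ennreal_of_nat_eq_real_of_nat ennreal_mult'[symmetric] ennreal_leI)
    qed
    also have "emeasure lborel (ball x R) = ennreal (V * R ^ 3)"
      using R by (simp add: emeasure_ball V_def)
    finally show "ennreal (V * R ^ 3) \<le> ennreal (160 * V * R) * ?I + ennreal \<epsilon>"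
      by (simp add: add_left_mono)
  qed
  then have "ennreal (1 / (8000 * V * R ^ 3)) * ennreal (V * R ^ 3)
      \<le> ennreal (1 / (8000 * V * R ^ 3)) * (ennreal (160 * V * R) * ?I)"
    by (rule mult_left_mono) simp
  then have "ennreal (1/8000) \<le> ennreal (1 / (50 * R\<^sup>2)) * ?I"
    using V R by (simp add: mult.assoc[symmetric] ennreal_mult'[symmetric] power2_eq_square power3_eq_cube)
  also have "\<dots> = (\<integral>\<^sup>+y. ennreal (1 / (50 * R\<^sup>2)) * (g y * indicator (M \<inter> ball x (2 * R)) y) \<partial>hausdorff2)"
    using Mb by (intro nn_integral_cmult[symmetric] borel_measurable_times_ennreal g borel_measurable_indicator) simp
  also have "\<dots> \<le> (\<integral>\<^sup>+y\<in>M \<inter> ball x (2 * R). ennreal (1 / R\<^sup>2 + (mean_curvature M y)\<^sup>2) \<partial>hausdorff2)"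
  proof (intro nn_integral_mono)
    fix y
    have "1 / (50 * R\<^sup>2) * (50 + 2 * R\<^sup>2 * (mean_curvature M y)\<^sup>2) = 1 / R\<^sup>2 + (mean_curvature M y)\<^sup>2 / 25"
      using R by (simp add: field_simps)
    also have "\<dots> \<le> 1 / R\<^sup>2 + (mean_curvature M y)\<^sup>2" by simp
    finally show "ennreal (1 / (50 * R\<^sup>2)) * (g y * indicator (M \<inter> ball x (2 * R)) y)
        \<le> ennreal (1 / R\<^sup>2 + (mean_curvature M y)\<^sup>2) * indicator (M \<inter> ball x (2 * R)) y"
      by (auto simp: g_def indicator_def ennreal_mult'[symmetric] simp del: ennreal_plus intro!: ennreal_leI)
  qed
  finally show ?thesis .
qed

section \<open>Varifold limits of connected surfaces\<close>

text \<open>By connectedness \<open>M\<close> contains points at \<open>N\<close> levels of \<open>g\<close> spaced by \<open>4 R\<close>. As \<open>g\<close> is 1-Lipschitz, the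
  balls of radius \<open>2 R\<close> around them lie in disjoint parts of the slab, and the density estimate applies to
  each of them.\<close>

lemma connected_slab_lower_bound:
  fixes g :: "real^3 \<Rightarrow> real"
  assumes M: "embedded_C2_surface M" "compact M" and conn: "connected M"
    and fin: "emeasure hausdorff2 M < \<infinity>"
    and g: "\<And>x y. \<bar>g x - g y\<bar> \<le> dist x y"
    and a: "a \<in> M" "g a \<le> s" and b: "b \<in> M" "s + 4 * R * real N \<le> g b" and R: "R > 0"
  shows "ennreal (real N / 8000)
    \<le> ennreal (1 / R\<^sup>2) * emeasure hausdorff2 (M \<inter> {x. s \<le> g x \<and> g x \<le> s + 4 * R * real N})
       + willmore_energy M"
proof -
  define K where "K = {x. s \<le> g x \<and> g x \<le> s + 4 * R * real N}"
  have g_cont: "continuous_on S g" for S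
    unfolding continuous_on_iff using g by (metis dist_real_def dist_commute le_less_trans)
  have Mb: "M \<in> sets borel" using M by (simp add: compact_imp_closed borel_closed)
  have "closed ({x. s \<le> g x} \<inter> {x. g x \<le> s + 4 * R * real N})"
    by (intro closed_Int closed_Collect_le continuous_on_const g_cont)
  then have Kb: "K \<in> sets borel" unfolding K_def by (simp add: borel_closed Collect_conj_eq)
  have "connected (g ` M)" by (rule connected_continuous_image[OF g_cont conn])
  then have Icc: "{g a..g b} \<subseteq> g ` M" using a b by (intro connected_contains_Icc) auto
  have "\<exists>y\<in>M. g y = s + 4 * R * real i + 2 * R" if "i < N" for i
  proof -
    have "4 * R * real i + 4 * R \<le> 4 * R * real N"
      using R that by (simp flip: distrib_left_numeral add: algebra_simps) (simp flip: distrib_left)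
    moreover have "0 \<le> 4 * R * real i" using R by simp
    ultimately have "g a \<le> s + 4 * R * real i + 2 * R" "s + 4 * R * real i + 2 * R \<le> g b"
      using a b R by linarith+
    then have "s + 4 * R * real i + 2 * R \<in> {g a..g b}" by simp
    then have "s + 4 * R * real i + 2 * R \<in> g ` M" using Icc by blast
    then show ?thesis by (metis imageE)
  qed
  then obtain y where y: "\<And>i. i < N \<Longrightarrow> y i \<in> M" "\<And>i. i < N \<Longrightarrow> g (y i) = s + 4 * R * real i + 2 * R"
    by metis
  define B where "B = (\<lambda>i. M \<inter> ball (y i) (2 * R))"
  have gB: "s + 4 * R * real i < g x \<and> g x < s + 4 * R * real (Suc i)" if "i < N" "x \<in> B i" for i x
  proof -
    have "\<bar>g (y i) - g x\<bar> < 2 * R" using g[of "y i" x] that by (auto simp: B_def)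
    then show ?thesis using y(2)[OF that(1)] by (simp add: algebra_simps) linarith
  qed
  have disj: "disjoint_family_on B {..<N}"
  proof -
    have "B i \<inter> B j = {}" if "i < j" "j < N" for i j
    proof -
      have "4 * R * real (Suc i) \<le> 4 * R * real j" using R that by simp
      moreover have "i < N" using that by simp
      ultimately show ?thesis using gB[of i] gB[of j] that by fastforce
    qed
    then show ?thesis unfolding disjoint_family_on_def by (metis Int_commute lessThan_iff nat_neq_iff)
  qed
  have sub: "(\<Union>i<N. B i) \<subseteq> M \<inter> K"
  proof
    fix x assume "x \<in> (\<Union>i<N. B i)"
    then obtain i where i: "i < N" "x \<in> B i" by blast
    have "4 * R * real (Suc i) \<le> 4 * R * real N" using R i by simp
    moreover have "0 \<le> 4 * R * real i" using R by simp
    ultimately show "x \<in> M \<inter> K" using gB[OF i] i by (auto simp: K_def B_def)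
  qed
  define f where "f = (\<lambda>x. ennreal (1 / R\<^sup>2 + 1 * (mean_curvature M x)\<^sup>2) * indicator M x)"
  have f: "f \<in> borel_measurable hausdorff2" unfolding f_def by (rule mean_curvature_sq_measurable[OF M])
  have f2: "(\<lambda>x. ennreal (0 + 1 * (mean_curvature M x)\<^sup>2) * indicator M x) \<in> borel_measurable hausdorff2"
    by (rule mean_curvature_sq_measurable[OF M])
  have Bb: "B i \<in> sets borel" for i unfolding B_def by (intro sets.Int Mb borel_open open_ball)
  have "ennreal (real N / 8000) = (\<Sum>i<N. ennreal (1 / 8000))"
    by (simp add: ennreal_of_nat_eq_real_of_nat ennreal_mult'[symmetric])
  also have "\<dots> \<le> (\<Sum>i<N. \<integral>\<^sup>+x. f x * indicator (B i) x \<partial>hausdorff2)"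
  proof (intro sum_mono)
    fix i assume "i \<in> {..<N}"
    then have "y i \<in> M" using y by simp
    from density_lower_bound[OF M fin this R]
    show "ennreal (1 / 8000) \<le> (\<integral>\<^sup>+x. f x * indicator (B i) x \<partial>hausdorff2)"
      by (rule order_trans) (auto intro!: nn_integral_mono simp: f_def B_def indicator_def)
  qed
  also have "\<dots> = (\<integral>\<^sup>+x. (\<Sum>i<N. f x * indicator (B i) x) \<partial>hausdorff2)"
    using f Bb by (intro nn_integral_sum[symmetric]) auto
  also have "\<dots> = (\<integral>\<^sup>+x. f x * indicator (\<Union>i<N. B i) x \<partial>hausdorff2)"
    using disj by (intro nn_integral_cong) (simp add: indicator_UN_disjoint sum_distrib_left)
  also have "\<dots> \<le> (\<integral>\<^sup>+x. ennreal (1 / R\<^sup>2) * indicator (M \<inter> K) x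
      + ennreal (0 + 1 * (mean_curvature M x)\<^sup>2) * indicator M x \<partial>hausdorff2)"
    using sub by (intro nn_integral_mono) (auto simp: f_def indicator_def)
  also have "\<dots> = (\<integral>\<^sup>+x. ennreal (1 / R\<^sup>2) * indicator (M \<inter> K) x \<partial>hausdorff2)
      + (\<integral>\<^sup>+x. ennreal (0 + 1 * (mean_curvature M x)\<^sup>2) * indicator M x \<partial>hausdorff2)"
    using Mb Kb by (intro nn_integral_add f2 borel_measurable_times_ennreal borel_measurable_indicator) auto
  also have "(\<integral>\<^sup>+x. ennreal (1 / R\<^sup>2) * indicator (M \<inter> K) x \<partial>hausdorff2)
      = ennreal (1 / R\<^sup>2) * emeasure hausdorff2 (M \<inter> K)"
    using Mb Kb by (intro nn_integral_cmult_indicator) auto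
  also have "(\<integral>\<^sup>+x. ennreal (0 + 1 * (mean_curvature M x)\<^sup>2) * indicator M x \<partial>hausdorff2) = willmore_energy M"
    by (simp add: willmore_energy_def)
  finally show ?thesis unfolding K_def .
qed

lemma integral_induced_varifold:
  fixes \<psi> :: "real^3 \<Rightarrow> real"
  assumes M: "embedded_C2_surface M" "compact M" and \<psi>: "continuous_on UNIV \<psi>"
  shows "integral\<^sup>L (induced_varifold M) (\<lambda>z. \<psi> (fst z)) = (\<integral>x. indicator M x *\<^sub>R \<psi> x \<partial>hausdorff2)"
proof -
  have Mb: "M \<in> sets borel" using M by (simp add: compact_imp_closed borel_closed)
  have "(\<lambda>x. (x, plane_matrix (tangent_space M x))) \<in> borel_measurable (restrict_space borel M)"
    by (intro borel_measurable_continuous_on_restrict continuous_on_Pair continuous_on_id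
        continuous_on_plane_matrix_tangent_space M)
  then have "(\<lambda>x. (x, plane_matrix (tangent_space M x))) \<in> borel_measurable (restrict_space hausdorff2 M)"
    using measurable_cong_sets[OF sets_restrict_space_cong[OF sets_hausdorff2] refl] by blast
  then have 1: "(\<lambda>x. (x, plane_matrix (tangent_space M x)))
      \<in> measurable (restrict_space hausdorff2 M) (restrict_space borel grassmann_bundle)"
    using plane_matrix_tangent_space_in[OF M(1)]
    by (intro measurable_restrict_space2) (auto simp: grassmann_bundle_def space_restrict_space)
  have "continuous_on UNIV (\<lambda>z :: (real^3) \<times> (real^3^3). \<psi> (fst z))"
    by (intro continuous_on_compose2[OF \<psi>] continuous_on_fst continuous_on_id) auto
  then have 2: "(\<lambda>z :: (real^3) \<times> (real^3^3). \<psi> (fst z)) \<in> borel_measurable (restrict_space borel grassmann_bundle)"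
    by (intro measurable_restrict_space1 borel_measurable_continuous_onI)
  show ?thesis
    unfolding induced_varifold_def integral_distr[OF 1 2] fst_conv
    by (rule integral_restrict_space) (simp add: Mb)
qed

text \<open>Because the Grassmannian is compact, functions of the base point alone are admissible test
  functions as soon as they have bounded support there.\<close>

lemma varifold_converges_mass:
  fixes \<psi> :: "real^3 \<Rightarrow> real"
  assumes M: "\<And>k. embedded_C2_surface (M k)" "\<And>k. compact (M k)"
    and conv: "varifold_converges (\<lambda>k. induced_varifold (M k)) V"
    and \<psi>: "continuous_on UNIV \<psi>" "bounded {x. \<psi> x \<noteq> 0}"
  shows "(\<lambda>k. \<integral>x. indicator (M k) x *\<^sub>R \<psi> x \<partial>hausdorff2) \<longlonglongrightarrow> integral\<^sup>L V (\<lambda>z. \<psi> (fst z))"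
proof -
  have c: "continuous_on grassmann_bundle (\<lambda>z :: (real^3) \<times> (real^3^3). \<psi> (fst z))"
    by (intro continuous_on_compose2[OF \<psi>(1)] continuous_on_fst continuous_on_id) auto
  have "{z\<in>grassmann_bundle. \<psi> (fst z) \<noteq> 0} \<subseteq> {x. \<psi> x \<noteq> 0} \<times> grassmannian2"
    by (auto simp: grassmann_bundle_def)
  then have "bounded {z\<in>grassmann_bundle. \<psi> (fst z) \<noteq> 0}"
    by (rule bounded_subset[rotated])
      (intro bounded_Times \<psi>(2) compact_imp_bounded compact_grassmannian2)
  then have "compact (closure {z\<in>grassmann_bundle. \<psi> (fst z) \<noteq> 0})"
    by (simp only: compact_closure)
  from conv[unfolded varifold_converges_def, THEN spec, THEN mp, OF conjI[OF c this]]
  have "(\<lambda>k. integral\<^sup>L (induced_varifold (M k)) (\<lambda>z. \<psi> (fst z))) \<longlonglongrightarrow> integral\<^sup>L V (\<lambda>z. \<psi> (fst z))" .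
  then show ?thesis unfolding integral_induced_varifold[OF M \<psi>(1)] .
qed

lemma varifold_fst_measurable:
  assumes "varifold V"
  shows "fst \<in> borel_measurable V" and "space V = grassmann_bundle"
proof -
  have s: "sets V = sets (restrict_space borel grassmann_bundle)" using assms by (simp add: varifold_def)
  have "fst \<in> borel_measurable (restrict_space borel (grassmann_bundle :: ((real^3) \<times> (real^3^3)) set))"
    by (intro measurable_restrict_space1 borel_measurable_continuous_onI continuous_on_fst continuous_on_id)
  then show "fst \<in> borel_measurable V" using measurable_cong_sets[OF s refl] by blast
  show "space V = grassmann_bundle" using sets_eq_imp_space_eq[OF s] by (simp add: space_restrict_space)
qed

lemma closed_measure_support: "closed (measure_support \<mu>)"
proof -
  have "\<exists>U. open U \<and> x \<in> U \<and> U \<subseteq> - measure_support \<mu>" if "x \<in> - measure_support \<mu>" for x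
    using that unfolding measure_support_def by blast
  then have "open (- measure_support \<mu>)" by (subst open_subopen) blast
  then show ?thesis by (simp add: open_closed)
qed

lemma emeasure_outside_support:
  assumes \<mu>: "sets \<mu> = sets borel" shows "emeasure \<mu> (- measure_support \<mu>) = 0"
proof -
  define \<F> where "\<F> = {U. open U \<and> emeasure \<mu> U = 0}"
  obtain \<F>' where F: "\<F>' \<subseteq> \<F>" "countable \<F>'" "\<Union>\<F>' = \<Union>\<F>"
    using Lindelof[of \<F>] by (auto simp: \<F>_def)
  have "- measure_support \<mu> = \<Union>\<F>'"
    unfolding F(3) by (auto simp: measure_support_def \<F>_def not_gr_zero)
  moreover have "(\<Union>U\<in>\<F>'. U) \<in> null_sets \<mu>"
    using F by (intro null_sets_UN') (auto simp: \<F>_def null_sets_def \<mu>)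
  ultimately show ?thesis by (simp add: null_sets_def)
qed

text \<open>A bump function at \<open>a\<close> has positive integral in the limit. Its integrability, without which the
  integral would be zero by convention, holds because varifolds are finite on compact sets.\<close>

lemma eventually_meets_ball:
  assumes M: "\<And>k. embedded_C2_surface (M k)" "\<And>k. compact (M k)"
    and V: "varifold V" and conv: "varifold_converges (\<lambda>k. induced_varifold (M k)) V"
    and a: "a \<in> measure_support (mass_measure V)" and r: "r > 0"
  shows "eventually (\<lambda>k. M k \<inter> ball a r \<noteq> {}) sequentially"
proof -
  define \<psi> where "\<psi> = (\<lambda>x. max 0 (r - dist a x))"
  have \<psi>_cont: "continuous_on UNIV \<psi>" unfolding \<psi>_def by (intro continuous_intros)
  have ne: "{x. \<psi> x \<noteq> 0} = ball a r" by (auto simp: \<psi>_def)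
  have bnd: "0 \<le> \<psi> x" "\<psi> x \<le> r" for x using r by (auto simp: \<psi>_def)
  note fst_m = varifold_fst_measurable[OF V]
  have \<psi>m: "(\<lambda>z. \<psi> (fst z)) \<in> borel_measurable V"
    using measurable_compose[OF fst_m(1) borel_measurable_continuous_onI[OF \<psi>_cont]] .
  have K: "compact (cball a r \<times> grassmannian2)" "cball a r \<times> grassmannian2 \<subseteq> grassmann_bundle"
    using compact_grassmannian2 by (auto simp: grassmann_bundle_def intro: compact_Times)
  then have Kfin: "emeasure V (cball a r \<times> grassmannian2) < \<infinity>" using V by (simp add: varifold_def)
  have Ks: "cball a r \<times> grassmannian2 \<in> sets V"
  proof -
    have "cball a r \<times> grassmannian2 = grassmann_bundle \<inter> (cball a r \<times> grassmannian2)" using K by blast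
    moreover have "cball a r \<times> grassmannian2 \<in> sets borel"
      using K(1) by (simp add: borel_compact)
    ultimately show ?thesis using V by (auto simp: varifold_def sets_restrict_space)
  qed
  have "integrable V (\<lambda>z. \<psi> (fst z))"
  proof (rule integrableI_bounded[OF \<psi>m])
    have "(\<integral>\<^sup>+z. ennreal (norm (\<psi> (fst z))) \<partial>V)
        \<le> (\<integral>\<^sup>+z. ennreal r * indicator (cball a r \<times> grassmannian2) z \<partial>V)"
    proof (intro nn_integral_mono)
      fix z assume "z \<in> space V"
      then show "ennreal (norm (\<psi> (fst z))) \<le> ennreal r * indicator (cball a r \<times> grassmannian2) z"
        using bnd[of "fst z"] by (auto simp: fst_m grassmann_bundle_def indicator_def ennreal_leI \<psi>_def)
    qed
    also have "\<dots> = ennreal r * emeasure V (cball a r \<times> grassmannian2)"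
      using Ks by (rule nn_integral_cmult_indicator)
    also have "\<dots> < \<infinity>" using Kfin by (simp add: ennreal_mult_less_top)
    finally show "(\<integral>\<^sup>+z. ennreal (norm (\<psi> (fst z))) \<partial>V) < \<infinity>" .
  qed
  moreover have "\<not> (AE z in V. \<psi> (fst z) = 0)"
  proof
    assume "AE z in V. \<psi> (fst z) = 0"
    then have "emeasure V {z\<in>space V. \<psi> (fst z) \<noteq> 0} = 0"
      using \<psi>m by (subst (asm) AE_iff_measurable[OF _ refl]) auto
    moreover have "{z\<in>space V. \<psi> (fst z) \<noteq> 0} = fst -` ball a r \<inter> space V" using ne by auto
    ultimately have "emeasure (mass_measure V) (ball a r) = 0"
      unfolding mass_measure_def using fst_m by (simp add: emeasure_distr)
    moreover have "a \<in> ball a r" using r by simp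
    ultimately show False using a unfolding measure_support_def by (metis (mono_tags, lifting) mem_Collect_eq less_irrefl open_ball)
  qed
  ultimately have "integral\<^sup>L V (\<lambda>z. \<psi> (fst z)) \<noteq> 0"
    using integral_nonneg_eq_0_iff_AE[of V "\<lambda>z. \<psi> (fst z)"] bnd by simp
  moreover have "bounded {x. \<psi> x \<noteq> 0}" unfolding ne by simp
  ultimately have "eventually (\<lambda>k. (\<integral>x. indicator (M k) x *\<^sub>R \<psi> x \<partial>hausdorff2) \<noteq> 0) sequentially"
    using varifold_converges_mass[OF M conv \<psi>_cont] tendsto_imp_eventually_ne by blast
  then show ?thesis
  proof (rule eventually_mono)
    fix k assume *: "(\<integral>x. indicator (M k) x *\<^sub>R \<psi> x \<partial>hausdorff2) \<noteq> 0"
    show "M k \<inter> ball a r \<noteq> {}"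
    proof
      assume "M k \<inter> ball a r = {}"
      then have "indicator (M k) x *\<^sub>R \<psi> x = 0" for x
        using ne by (auto simp: indicator_def)
      then have "(\<integral>x. indicator (M k) x *\<^sub>R \<psi> x \<partial>hausdorff2) = 0"
        by (intro integral_eq_zero_AE AE_I2)
      then show False using * by contradiction
    qed
  qed
qed

text \<open>A cutoff function that is one on \<open>K\<close> and vanishes on the support has integral zero in the limit.\<close>

lemma area_tendsto_0_off_support:
  assumes M: "\<And>k. embedded_C2_surface (M k)" "\<And>k. compact (M k)"
    and V: "varifold V" and conv: "varifold_converges (\<lambda>k. induced_varifold (M k)) V"
    and fin: "eventually (\<lambda>k. emeasure hausdorff2 (M k) < \<infinity>) sequentially"
    and K: "compact K" "K \<inter> measure_support (mass_measure V) = {}" and e: "e > 0"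
  shows "eventually (\<lambda>k. emeasure hausdorff2 (M k \<inter> K) < ennreal e) sequentially"
proof (cases "K = {}")
  case True
  then show ?thesis using e by simp
next
  case False
  let ?S = "measure_support (mass_measure V)"
  obtain d where d: "d > 0" "\<And>x y. x \<in> K \<Longrightarrow> y \<in> ?S \<Longrightarrow> d \<le> dist x y"
    using separate_compact_closed[OF K(1) closed_measure_support K(2)] by blast
  define \<psi> where "\<psi> = (\<lambda>x. max 0 (1 - infdist x K / d))"
  have \<psi>_cont: "continuous_on UNIV \<psi>" unfolding \<psi>_def by (intro continuous_intros) (use d in auto)
  have bnd: "0 \<le> \<psi> x" "\<psi> x \<le> 1" for x using d by (auto simp: \<psi>_def infdist_nonneg)
  have \<psi>K: "\<psi> x = 1" if "x \<in> K" for x using that by (simp add: \<psi>_def)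
  have \<psi>S: "\<psi> x = 0" if x: "x \<in> ?S" for x
  proof -
    obtain y where "y \<in> K" "infdist x K = dist x y"
      using infdist_attains_inf[OF compact_imp_closed[OF K(1)] False] by blast
    then have "d \<le> infdist x K" using d(2)[OF _ x] by (metis dist_commute)
    then show ?thesis using d(1) by (simp add: \<psi>_def)
  qed
  have "{x. \<psi> x \<noteq> 0} \<subseteq> {x. infdist x K \<le> d}" using d by (auto simp: \<psi>_def max_def field_simps split: if_splits)
  then have bd: "bounded {x. \<psi> x \<noteq> 0}"
    using compact_infdist_le[OF False K(1) d(1)] bounded_subset compact_imp_bounded by blast
  note fst_m = varifold_fst_measurable[OF V]
  have "integral\<^sup>L V (\<lambda>z. \<psi> (fst z)) = 0"
  proof (rule integral_eq_zero_AE)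
    have "emeasure (mass_measure V) (- ?S) = 0"
      by (rule emeasure_outside_support) (simp add: mass_measure_def)
    then have "emeasure V (fst -` (- ?S) \<inter> space V) = 0"
      using fst_m closed_measure_support[of "mass_measure V"]
      by (simp add: mass_measure_def emeasure_distr borel_open open_Compl)
    moreover have "fst -` (- ?S) \<inter> space V \<in> sets V"
      using closed_measure_support[of "mass_measure V"]
      by (intro measurable_sets[OF fst_m(1)] borel_open open_Compl)
    ultimately have "fst -` (- ?S) \<inter> space V \<in> null_sets V" by (simp add: null_sets_def)
    then show "AE z in V. \<psi> (fst z) = 0" by (rule AE_I') (use \<psi>S in auto)
  qed
  then have "(\<lambda>k. \<integral>x. indicator (M k) x *\<^sub>R \<psi> x \<partial>hausdorff2) \<longlonglongrightarrow> 0"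
    using varifold_converges_mass[OF M conv \<psi>_cont bd] by simp
  then have "eventually (\<lambda>k. (\<integral>x. indicator (M k) x *\<^sub>R \<psi> x \<partial>hausdorff2) < e) sequentially"
    using e by (rule order_tendstoD)
  with fin show ?thesis
  proof eventually_elim
    case (elim k)
    have Mb: "M k \<in> sets borel" "K \<in> sets borel"
      using M K by (simp_all add: compact_imp_closed borel_closed)
    have int: "integrable hausdorff2 (\<lambda>x. indicator (M k) x *\<^sub>R \<psi> x)"
    proof (rule Bochner_Integration.integrable_bound[where f = "indicator (M k) :: _ \<Rightarrow> real"])
      show "integrable hausdorff2 (indicator (M k) :: _ \<Rightarrow> real)"
        using Mb elim by (simp add: integrable_indicator_iff)
      have "\<psi> \<in> borel_measurable hausdorff2"
        using borel_measurable_continuous_onI[OF \<psi>_cont] by (simp add: measurable_cong_sets[OF sets_hausdorff2 refl])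
      then show "(\<lambda>x. indicator (M k) x *\<^sub>R \<psi> x) \<in> borel_measurable hausdorff2"
        using Mb by (intro borel_measurable_scaleR borel_measurable_indicator) auto
      show "AE x in hausdorff2. norm (indicator (M k) x *\<^sub>R \<psi> x) \<le> norm (indicator (M k) x :: real)"
        using bnd by (auto simp: indicator_def)
    qed
    have "emeasure hausdorff2 (M k \<inter> K) = (\<integral>\<^sup>+x. indicator (M k \<inter> K) x \<partial>hausdorff2)"
      using Mb by simp
    also have "\<dots> \<le> (\<integral>\<^sup>+x. ennreal (indicator (M k) x *\<^sub>R \<psi> x) \<partial>hausdorff2)"
      using \<psi>K by (intro nn_integral_mono) (auto simp: indicator_def)
    also have "\<dots> = ennreal (\<integral>x. indicator (M k) x *\<^sub>R \<psi> x \<partial>hausdorff2)"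
      using bnd by (intro nn_integral_eq_integral int) auto
    also have "\<dots> < ennreal e" using elim e by (simp add: ennreal_lessI)
    finally show ?case .
  qed
qed

theorem corollary3p5:
  fixes M :: "nat \<Rightarrow> (real^3) set"
    and V :: "((real^3) \<times> (real^3^3)) measure"
  assumes "\<And>k. embedded_C2_surface (M k)"
    and "\<And>k. compact (M k)"
    and "\<And>k. orientable_surface (M k)"
    and "varifold V"
    and "varifold_converges (\<lambda>k. induced_varifold (M k)) V"
    and "limsup (\<lambda>k. willmore_energy (M k) + emeasure hausdorff2 (M k)) < \<infinity>"
    and "\<And>k. connected (M k)"
  shows "connected (measure_support (mass_measure V))"
proof -
  let ?S = "measure_support (mass_measure V)"
  note M = assms(1,2) and V = assms(4) and conv = assms(5)
  obtain c where c: "limsup (\<lambda>k. willmore_energy (M k) + emeasure hausdorff2 (M k)) < c" "c < \<infinity>"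
    using dense[OF assms(6)] by blast
  define C where "C = enn2real c"
  have C: "c = ennreal C" "C \<ge> 0" using c(2) by (simp_all add: C_def less_top)
  have bound: "eventually (\<lambda>k. willmore_energy (M k) + emeasure hausdorff2 (M k) < ennreal C) sequentially"
    using Limsup_lessD[OF c(1)] C by simp
  then have fin: "eventually (\<lambda>k. emeasure hausdorff2 (M k) < \<infinity>) sequentially"
  proof (rule eventually_mono)
    fix k assume "willmore_energy (M k) + emeasure hausdorff2 (M k) < ennreal C"
    then have "emeasure hausdorff2 (M k) < ennreal C" by (rule le_less_trans[rotated]) simp
    then show "emeasure hausdorff2 (M k) < \<infinity>" using less_trans by fastforce
  qed
  show ?thesis
  proof (rule ccontr)
    assume not_connected: "\<not> ?thesis"
    have "\<exists>A B. closed A \<and> closed B \<and> A \<noteq> {} \<and> B \<noteq> {} \<and> A \<union> B = ?S \<and> A \<inter> B = {}"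
      using not_connected unfolding connected_closed_set[OF closed_measure_support] by (rule notnotD)
    then obtain A B where AB: "closed A" "closed B" "A \<noteq> {}" "B \<noteq> {}" "A \<union> B = ?S" "A \<inter> B = {}"
      by (elim exE conjE)
    then obtain a b where a: "a \<in> A" and b: "b \<in> B" by blast
    obtain N :: nat where N: "8000 * (C + 1) < real N" using reals_Archimedean2 by blast
    \<comment> \<open>Each of \<open>N\<close> disjoint balls costs \<open>1/8000\<close>, so \<open>N\<close> balls exceed the total \<open>C\<close>. With balls of radius
      two this bounds the support: to reach a distant point, \<open>M k\<close> would have to pass \<open>N\<close> of them.\<close>
    have bdd: "dist a x \<le> 4 * real N + 2" if x: "x \<in> ?S" for x
    proof (rule ccontr)
      assume far: "\<not> ?thesis"
      have "a \<in> ?S" using a AB by blast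
      then have "eventually (\<lambda>k. M k \<inter> ball a 1 \<noteq> {}) sequentially"
        by (intro eventually_meets_ball[OF M V conv]) auto
      moreover have "eventually (\<lambda>k. M k \<inter> ball x 1 \<noteq> {}) sequentially"
        by (intro eventually_meets_ball[OF M V conv] x) auto
      ultimately have "eventually (\<lambda>k. False) sequentially" using bound fin
      proof eventually_elim
        case (elim k)
        then obtain p q where p: "p \<in> M k" "dist a p < 1" and q: "q \<in> M k" "dist x q < 1" by auto
        have lip: "\<bar>dist a u - dist a v\<bar> \<le> dist u v" for u v
          using abs_dist_diff_le[of u a v] by (simp add: dist_commute)
        have "1 + 4 * 1 * real N \<le> dist a q"
          using far q lip[of x q] by simp
        with p q have "ennreal (real N / 8000) \<le> ennreal (1 / 1\<^sup>2) * emeasure hausdorff2 (M k \<inter> {u. 1 \<le> dist a u \<and> dist a u \<le> 1 + 4 * 1 * real N})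
            + willmore_energy (M k)"
          using elim lip assms(7)
          by (intro connected_slab_lower_bound[OF M, where g="dist a" and a=p and b=q]) auto
        also have "\<dots> \<le> emeasure hausdorff2 (M k) + willmore_energy (M k)"
          using M(2)[of k] by (auto intro!: add_right_mono emeasure_mono simp: compact_imp_closed borel_closed)
        also have "\<dots> < ennreal C" using elim by (simp add: add.commute)
        finally show False using N C by (simp add: ennreal_less_iff)
      qed
      then show False by simp
    qed
    then have "bounded ?S" unfolding bounded_def by blast
    then have cA: "compact A" and cB: "compact B"
      using AB by (auto simp: compact_eq_bounded_closed intro: bounded_subset)
    obtain d where d: "d > 0" "\<And>x y. x \<in> A \<Longrightarrow> y \<in> B \<Longrightarrow> d \<le> dist x y"
      using separate_compact_closed[OF cA AB(2,6)] by blast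
    define g where "g = (\<lambda>x. infdist x A)"
    have g: "\<bar>g x - g y\<bar> \<le> dist x y" for x y unfolding g_def by (rule infdist_triangle_abs)
    have gA: "g x = 0" if "x \<in> A" for x using that by (simp add: g_def)
    have gB: "d \<le> g x" if x: "x \<in> B" for x
    proof -
      obtain y where "y \<in> A" "infdist x A = dist x y" using infdist_attains_inf[OF AB(1,3)] by blast
      then show ?thesis using d(2)[OF _ x] unfolding g_def by (metis dist_commute)
    qed
    have "0 \<le> 8000 * (C + 1)" using C(2) by simp
    then have N0: "0 < real N" using N by (rule le_less_trans)
    \<comment> \<open>The slab between \<open>A\<close> and \<open>B\<close> has width \<open>d / 2 = 4 R N\<close>. Its area tends to zero, eventually below
      \<open>R\<^sup>2\<close>, so the balls in it have to be paid for by the Willmore energy, up to an error of one.\<close>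
    define R where "R = d / (8 * real N)"
    have R: "R > 0" "4 * R * real N = d / 2" using d N0 by (simp_all add: R_def)
    define K where "K = {x. d / 4 \<le> g x \<and> g x \<le> d / 4 + 4 * R * real N}"
    have "compact K"
    proof -
      have "compact {x. infdist x A \<le> 3 * d / 4}" using d by (intro compact_infdist_le AB cA) auto
      moreover have "closed K"
        unfolding K_def g_def Collect_conj_eq
        by (intro closed_Int closed_Collect_le continuous_intros)
      moreover have "K \<subseteq> {x. infdist x A \<le> 3 * d / 4}" using R(2) by (auto simp: K_def g_def)
      ultimately show ?thesis by (metis compact_Int_closed inf.absorb2)
    qed
    moreover have "K \<inter> ?S = {}" using gA gB d R(2) unfolding AB(5)[symmetric] by (force simp: K_def)
    ultimately have "eventually (\<lambda>k. emeasure hausdorff2 (M k \<inter> K) < ennreal (R\<^sup>2)) sequentially"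
      using R by (intro area_tendsto_0_off_support[OF M V conv fin]) auto
    moreover have "eventually (\<lambda>k. M k \<inter> ball a (d / 4) \<noteq> {}) sequentially"
      using a AB d by (intro eventually_meets_ball[OF M V conv]) auto
    moreover have "eventually (\<lambda>k. M k \<inter> ball b (d / 4) \<noteq> {}) sequentially"
      using b AB d by (intro eventually_meets_ball[OF M V conv]) auto
    ultimately have "eventually (\<lambda>k. False) sequentially" using bound fin
    proof eventually_elim
      case (elim k)
      then obtain p q where p: "p \<in> M k" "dist a p < d / 4" and q: "q \<in> M k" "dist b q < d / 4" by auto
      have "g p \<le> d / 4" using g[of a p] gA[OF a] p by simp
      moreover have "d / 4 + 4 * R * real N \<le> g q" using g[of b q] gB[OF b] q R(2) by simp
      ultimately have "ennreal (real N / 8000) \<le> ennreal (1 / R\<^sup>2) * emeasure hausdorff2 (M k \<inter> K)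
          + willmore_energy (M k)"
        unfolding K_def using elim p q assms(7) R(1)
        by (intro connected_slab_lower_bound[OF M, where g=g and a=p and b=q] g) auto
      also have "\<dots> \<le> ennreal (1 / R\<^sup>2) * ennreal (R\<^sup>2) + ennreal C"
      proof (intro add_mono mult_left_mono)
        have "willmore_energy (M k) \<le> willmore_energy (M k) + emeasure hausdorff2 (M k)" by simp
        also have "\<dots> < ennreal C" using elim by simp
        finally show "willmore_energy (M k) \<le> ennreal C" by (rule less_imp_le)
      qed (use elim in auto)
      also have "\<dots> = ennreal (1 + C)" using R C by (simp add: ennreal_mult[symmetric])
      finally have "ennreal (real N / 8000) \<le> ennreal (1 + C)" .
      then have "real N / 8000 \<le> 1 + C" using C(2) by (subst (asm) ennreal_le_iff) simp_all
      then show False using N by simp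
    qed
    then show False by simp
  qed
qed

end
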